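(* Let $H$ and $H'$ be cocommutative Hopf algebras, let $(H,H',\rhd,\lhd)$ be a matched pair of Hopf algebras and let $(B,B')$ be a projection homomorphism pair on $(H,H',\rhd,\lhd)$. Let $K=\operatorname{Im}B\subseteq H'\bowtie H$. Then the (linear) operator $C:K\to K$ defined by $$C((x,y))=B\big((x,\epsilon(y)1_H)\big),\quad \forall\,(x,y)\in K,$$ is a Rota-Baxter operator of weight $-1$ on the Hopf algebra $K$.
   Context: The base field $\mathbb{K}$ has characteristic $0$; Sweedler notation $\Delta(x)=x_1\otimes x_2$ is used. A coalgebra map is a linear map $f$ with $\Delta\circ f=(f\otimes f)\circ\Delta$ and $\epsilon\circ f=\epsilon$. Rota-Baxter operator of weight $-1$ on a cocommutative Hopf algebra $A$: a coalgebra map $R:A\to A$ with $R(x)R(y)=R\big(R(x_1)\,y\,S(R(x_2))\,x_3\big)$ for all $x,y\in A$. Matched pair of Hopf algebras: a quadruple $(H,H',\rhd,\lhd)$ of Hopf algebras $H,H'$, a left action $\rhd:H\otimes H'\to H'$ making $H'$ a left $H$-module coalgebra, and a right action $\lhd:H\otimes H'\to H$ making $H$ a right $H'$-module coalgebra, such that for all $x,y\in H$, $a,b\in H'$: $x\rhd 1_{H'}=\epsilon_H(x)1_{H'}$; $1_H\lhd a=\epsilon_{H'}(a)1_H$; $x\rhd(ab)=(x_1\rhd a_1)\big((x_2\lhd a_2)\rhd b\big)$; $(xy)\lhd a=\big(x\lhd(y_1\rhd a_1)\big)(y_2\lhd a_2)$. It induces the double cross product $H'\bowtie H$, the Hopf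 algebra on $H'\otimes H$ with product $(a\otimes x)(a'\otimes x')=a(x_1\rhd a'_1)\otimes(x_2\lhd a'_2)x'$, unit $1\otimes 1$ and the usual tensor product coalgebra structure. The element $a\otimes x$ is written $(a,x)$; formulas written on elements $(a,x)$ are extended linearly (so $C$ is the restriction to $K$ of the linear map $a\otimes x\mapsto B(a\otimes\epsilon(x)1_H)$). Projection homomorphism pair on $(H,H',\rhd,\lhd)$: a pair $(B,B')$ of idempotent homomorphisms of Hopf algebras $H'\bowtie H\to H'\bowtie H$ such that $B(z_1)B'(z_2)=z$ for all $z\in H'\bowtie H$. The image $K$ of $B$ is a Hopf subalgebra of $H'\bowtie H$. *)

theory Defs
  imports Complex_Main "HOL-Library.Function_Algebras"
begin

section \<open>Vector spaces with a carrier\<close>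

text \<open>
  The base field is the type \<open>'k\<close>; characteristic 0 is the sort \<open>field_char_0\<close>.
  A vector space is a subspace \<open>carrier V\<close> of an ambient vector space that fills the
  type \<open>'a\<close> (addition from the type class, scalar multiplication \<open>scal V\<close>). Every vector
  space is of this form (take the ambient space to be the space itself); the ambient space
  makes it possible to pass to a subspace by changing only the carrier.
\<close>

record ('k, 'a) vspace =
  carrier :: "'a set"
  scal :: "'k \<Rightarrow> 'a \<Rightarrow> 'a"  (infixr "\<star>\<index>" 75)

definition vspace :: "('k::field_char_0, 'a::ab_group_add, 'm) vspace_scheme \<Rightarrow> bool" where
  "vspace V \<longleftrightarrow> vector_space (scal V) \<and> module.subspace (scal V) (carrier V)"

definition ground :: "('k::field_char_0, 'k) vspace" where
  "ground = \<lparr>carrier = UNIV, scal = (*)\<rparr>"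

definition linear_map ::
  "('k::field_char_0, 'a::ab_group_add, 'm) vspace_scheme \<Rightarrow>
   ('k, 'b::ab_group_add, 'n) vspace_scheme \<Rightarrow> ('a \<Rightarrow> 'b) \<Rightarrow> bool" where
  "linear_map V W f \<longleftrightarrow>
     (\<forall>x\<in>carrier V. f x \<in> carrier W) \<and>
     (\<forall>x\<in>carrier V. \<forall>y\<in>carrier V. f (x + y) = f x + f y) \<and>
     (\<forall>c. \<forall>x\<in>carrier V. f (c \<star>\<^bsub>V\<^esub> x) = c \<star>\<^bsub>W\<^esub> f x)"

definition bilinear_map ::
  "('k::field_char_0, 'a::ab_group_add, 'm) vspace_scheme \<Rightarrow>
   ('k, 'b::ab_group_add, 'n) vspace_scheme \<Rightarrow>
   ('k, 'c::ab_group_add, 'p) vspace_scheme \<Rightarrow> ('a \<Rightarrow> 'b \<Rightarrow> 'c) \<Rightarrow> bool" where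
  "bilinear_map V W U f \<longleftrightarrow>
     (\<forall>x\<in>carrier V. linear_map W U (f x)) \<and>
     (\<forall>y\<in>carrier W. linear_map V U (\<lambda>x. f x y))"


section \<open>Tensor products\<close>

text \<open>
  Over a field, \<open>V \<otimes> W\<close> embeds into the dual of the space of bilinear forms by
  \<open>v \<otimes> w \<mapsto> (\<beta> \<mapsto> \<beta>(v, w))\<close>; the tensor product is taken to be the image of this embedding.
  The forms \<open>\<beta>\<close> range over the bilinear forms on the ambient spaces, so that for subspaces
  \<open>V' \<subseteq> V\<close> and \<open>W' \<subseteq> W\<close> the space \<open>V' \<otimes> W'\<close> is literally a subspace of \<open>V \<otimes> W\<close>. The universal
  property is proved below (\<open>tlift_linear\<close>, \<open>tlift_ptensor\<close>, \<open>tensor_universal\<close>).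
\<close>

type_synonym ('k, 'a, 'b) tensor = "('a \<Rightarrow> 'b \<Rightarrow> 'k) \<Rightarrow> 'k"

definition bilinear_form ::
  "('k::field_char_0, 'a::ab_group_add, 'm) vspace_scheme \<Rightarrow>
   ('k, 'b::ab_group_add, 'n) vspace_scheme \<Rightarrow> ('a \<Rightarrow> 'b \<Rightarrow> 'k) \<Rightarrow> bool" where
  "bilinear_form V W \<beta> \<longleftrightarrow>
     (\<forall>x. Vector_Spaces.linear (scal W) (*) (\<beta> x)) \<and>
     (\<forall>y. Vector_Spaces.linear (scal V) (*) (\<lambda>x. \<beta> x y))"

definition ptensor ::
  "'a::ab_group_add \<Rightarrow> ('k::field_char_0, 'a, 'm) vspace_scheme \<Rightarrow>
   ('k, 'b, 'n) vspace_scheme \<Rightarrow> 'b::ab_group_add \<Rightarrow> ('k, 'a, 'b) tensor"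
  ("(_ \<otimes>\<^bsub>_,_\<^esub>/ _)" [71, 0, 0, 70] 70) where
  "v \<otimes>\<^bsub>V,W\<^esub> w = (\<lambda>\<beta>. if bilinear_form V W \<beta> then \<beta> v w else 0)"

definition tensor ::
  "('k::field_char_0, 'a::ab_group_add, 'm) vspace_scheme \<Rightarrow>
   ('k, 'b::ab_group_add, 'n) vspace_scheme \<Rightarrow> ('k, ('k, 'a, 'b) tensor) vspace" where
  "tensor V W =
     \<lparr>carrier = module.span (\<lambda>c t \<beta>. c * t \<beta>)
                 {v \<otimes>\<^bsub>V,W\<^esub> w | v w. v \<in> carrier V \<and> w \<in> carrier W},
      scal = (\<lambda>c t \<beta>. c * t \<beta>)\<rparr>"

text \<open>
  \<open>tlift V W f\<close> is the linear map on \<open>V \<otimes> W\<close> induced by a bilinear map \<open>f\<close>, i.e.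
  \<open>v \<otimes> w \<mapsto> f v w\<close> extended linearly.
\<close>

definition tlift ::
  "('k::field_char_0, 'a::ab_group_add, 'm) vspace_scheme \<Rightarrow>
   ('k, 'b::ab_group_add, 'n) vspace_scheme \<Rightarrow>
   ('a \<Rightarrow> 'b \<Rightarrow> 'c::ab_group_add) \<Rightarrow> ('k, 'a, 'b) tensor \<Rightarrow> 'c" where
  "tlift V W f t = (THE u. \<exists>(n::nat) v w.
     (\<forall>i<n. v i \<in> carrier V \<and> w i \<in> carrier W) \<and>
     t = (\<Sum>i<n. v i \<otimes>\<^bsub>V,W\<^esub> w i) \<and> u = (\<Sum>i<n. f (v i) (w i)))"


section \<open>Hopf algebras\<close>

record ('k, 'a) hopf = "('k, 'a) vspace" +
  mult :: "'a \<Rightarrow> 'a \<Rightarrow> 'a"  (infixl "\<bullet>\<index>" 72)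
  one :: 'a  ("\<one>\<index>")
  comult :: "'a \<Rightarrow> ('k, 'a, 'a) tensor"
  counit :: "'a \<Rightarrow> 'k"
  antipode :: "'a \<Rightarrow> 'a"

text \<open>
  Sweedler notation: \<open>sweedler H x (\<lambda>x\<^sub>1 x\<^sub>2. f x\<^sub>1 x\<^sub>2)\<close> is the expression \<open>f(x\<^sub>1, x\<^sub>2)\<close> where
  \<open>\<Delta>(x) = x\<^sub>1 \<otimes> x\<^sub>2\<close> and \<open>f\<close> is bilinear; \<open>sweedler3\<close> is its analogue for \<open>(\<Delta> \<otimes> id)(\<Delta>(x))\<close>.
\<close>

definition sweedler ::
  "('k::field_char_0, 'a::ab_group_add) hopf \<Rightarrow> 'a \<Rightarrow> ('a \<Rightarrow> 'a \<Rightarrow> 'c::ab_group_add) \<Rightarrow> 'c" where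
  "sweedler H x f = tlift H H f (comult H x)"

definition sweedler3 ::
  "('k::field_char_0, 'a::ab_group_add) hopf \<Rightarrow> 'a \<Rightarrow>
   ('a \<Rightarrow> 'a \<Rightarrow> 'a \<Rightarrow> 'c::ab_group_add) \<Rightarrow> 'c" where
  "sweedler3 H x f =
     sweedler H x (\<lambda>y x\<^sub>3. sweedler H y (\<lambda>x\<^sub>1 x\<^sub>2. f x\<^sub>1 x\<^sub>2 x\<^sub>3))"

locale hopf_algebra =
  fixes H :: "('k::field_char_0, 'a::ab_group_add) hopf" (structure)
  assumes vspace: "vspace H"
    and mult_bilinear: "bilinear_map H H H (mult H)"
    and one_closed: "\<one> \<in> carrier H"
    and mult_assoc: "\<lbrakk>x \<in> carrier H; y \<in> carrier H; z \<in> carrier H\<rbrakk>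
          \<Longrightarrow> (x \<bullet> y) \<bullet> z = x \<bullet> (y \<bullet> z)"
    and one_mult: "x \<in> carrier H \<Longrightarrow> \<one> \<bullet> x = x"
    and mult_one: "x \<in> carrier H \<Longrightarrow> x \<bullet> \<one> = x"
    and comult_linear: "linear_map H (tensor H H) (comult H)"
    and counit_linear: "linear_map H ground (counit H)"
    and coassoc: "x \<in> carrier H \<Longrightarrow>
          sweedler H x (\<lambda>y x\<^sub>3. sweedler H y (\<lambda>x\<^sub>1 x\<^sub>2.
            x\<^sub>1 \<otimes>\<^bsub>H,tensor H H\<^esub> (x\<^sub>2 \<otimes>\<^bsub>H,H\<^esub> x\<^sub>3))) =
          sweedler H x (\<lambda>x\<^sub>1 y. sweedler H y (\<lambda>x\<^sub>2 x\<^sub>3.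
            x\<^sub>1 \<otimes>\<^bsub>H,tensor H H\<^esub> (x\<^sub>2 \<otimes>\<^bsub>H,H\<^esub> x\<^sub>3)))"
    and counit_left: "x \<in> carrier H \<Longrightarrow> sweedler H x (\<lambda>x\<^sub>1 x\<^sub>2. counit H x\<^sub>1 \<star> x\<^sub>2) = x"
    and counit_right: "x \<in> carrier H \<Longrightarrow> sweedler H x (\<lambda>x\<^sub>1 x\<^sub>2. counit H x\<^sub>2 \<star> x\<^sub>1) = x"
    and comult_mult: "\<lbrakk>x \<in> carrier H; y \<in> carrier H\<rbrakk> \<Longrightarrow>
          comult H (x \<bullet> y) =
          sweedler H x (\<lambda>x\<^sub>1 x\<^sub>2. sweedler H y (\<lambda>y\<^sub>1 y\<^sub>2.
            (x\<^sub>1 \<bullet> y\<^sub>1) \<otimes>\<^bsub>H,H\<^esub> (x\<^sub>2 \<bullet> y\<^sub>2)))"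
    and comult_one: "comult H \<one> = \<one> \<otimes>\<^bsub>H,H\<^esub> \<one>"
    and counit_mult: "\<lbrakk>x \<in> carrier H; y \<in> carrier H\<rbrakk> \<Longrightarrow>
          counit H (x \<bullet> y) = counit H x * counit H y"
    and counit_one: "counit H \<one> = 1"
    and antipode_linear: "linear_map H H (antipode H)"
    and antipode_left: "x \<in> carrier H \<Longrightarrow>
          sweedler H x (\<lambda>x\<^sub>1 x\<^sub>2. antipode H x\<^sub>1 \<bullet> x\<^sub>2) = counit H x \<star> \<one>"
    and antipode_right: "x \<in> carrier H \<Longrightarrow>
          sweedler H x (\<lambda>x\<^sub>1 x\<^sub>2. x\<^sub>1 \<bullet> antipode H x\<^sub>2) = counit H x \<star> \<one>"

locale cocommutative_hopf_algebra = hopf_algebra +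
  assumes cocommutative: "x \<in> carrier H \<Longrightarrow>
    comult H x = sweedler H x (\<lambda>x\<^sub>1 x\<^sub>2. x\<^sub>2 \<otimes>\<^bsub>H,H\<^esub> x\<^sub>1)"

definition coalgebra_map ::
  "('k::field_char_0, 'a::ab_group_add) hopf \<Rightarrow> ('k, 'b::ab_group_add) hopf \<Rightarrow>
   ('a \<Rightarrow> 'b) \<Rightarrow> bool" where
  "coalgebra_map H G f \<longleftrightarrow>
     linear_map H G f \<and>
     (\<forall>x\<in>carrier H.
        comult G (f x) = sweedler H x (\<lambda>x\<^sub>1 x\<^sub>2. f x\<^sub>1 \<otimes>\<^bsub>G,G\<^esub> f x\<^sub>2) \<and>
        counit G (f x) = counit H x)"

text \<open>Bialgebra maps between Hopf algebras preserve the antipode, so this is not demanded.\<close>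

definition hopf_hom ::
  "('k::field_char_0, 'a::ab_group_add) hopf \<Rightarrow> ('k, 'b::ab_group_add) hopf \<Rightarrow>
   ('a \<Rightarrow> 'b) \<Rightarrow> bool" where
  "hopf_hom H G f \<longleftrightarrow>
     coalgebra_map H G f \<and>
     (\<forall>x\<in>carrier H. \<forall>y\<in>carrier H. f (x \<bullet>\<^bsub>H\<^esub> y) = f x \<bullet>\<^bsub>G\<^esub> f y) \<and>
     f \<one>\<^bsub>H\<^esub> = \<one>\<^bsub>G\<^esub>"

definition rota_baxter_operator ::
  "('k::field_char_0, 'a::ab_group_add) hopf \<Rightarrow> ('a \<Rightarrow> 'a) \<Rightarrow> bool" where
  "rota_baxter_operator A R \<longleftrightarrow>
     cocommutative_hopf_algebra A \<and>
     coalgebra_map A A R \<and>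
     (\<forall>x\<in>carrier A. \<forall>y\<in>carrier A.
        R x \<bullet>\<^bsub>A\<^esub> R y =
        R (sweedler3 A x (\<lambda>x\<^sub>1 x\<^sub>2 x\<^sub>3.
             R x\<^sub>1 \<bullet>\<^bsub>A\<^esub> y \<bullet>\<^bsub>A\<^esub> antipode A (R x\<^sub>2) \<bullet>\<^bsub>A\<^esub> x\<^sub>3)))"

text \<open>
  The image of \<open>B\<close> with the operations of \<open>A\<close>. No adjustment of \<open>comult A\<close> is needed because
  \<open>K \<otimes> K\<close> is a subspace of \<open>A \<otimes> A\<close> in the above model of the tensor product.
\<close>

definition hopf_image ::
  "('k::field_char_0, 'a::ab_group_add) hopf \<Rightarrow> ('a \<Rightarrow> 'a) \<Rightarrow> ('k, 'a) hopf" where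
  "hopf_image A B = A\<lparr>carrier := B ` carrier A\<rparr>"


section \<open>Matched pairs and double cross products\<close>

text \<open>
  The actions, i.e. linear maps on \<open>H \<otimes> H'\<close>, are given as bilinear maps of two arguments.
\<close>

locale matched_pair = H: hopf_algebra H + H': hopf_algebra H'
  for H :: "('k::field_char_0, 'a::ab_group_add) hopf"
    and H' :: "('k, 'b::ab_group_add) hopf"
    and left :: "'a \<Rightarrow> 'b \<Rightarrow> 'b"  (infixr "\<rhd>" 73)
    and right :: "'a \<Rightarrow> 'b \<Rightarrow> 'a"  (infixl "\<lhd>" 73) +
  assumes left_bilinear: "bilinear_map H H' H' (\<rhd>)"
    and left_one: "a \<in> carrier H' \<Longrightarrow> \<one>\<^bsub>H\<^esub> \<rhd> a = a"
    and left_mult: "\<lbrakk>x \<in> carrier H; y \<in> carrier H; a \<in> carrier H'\<rbrakk> \<Longrightarrow>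
          (x \<bullet>\<^bsub>H\<^esub> y) \<rhd> a = x \<rhd> (y \<rhd> a)"
    and left_comult: "\<lbrakk>x \<in> carrier H; a \<in> carrier H'\<rbrakk> \<Longrightarrow>
          comult H' (x \<rhd> a) =
          sweedler H x (\<lambda>x\<^sub>1 x\<^sub>2. sweedler H' a (\<lambda>a\<^sub>1 a\<^sub>2.
            (x\<^sub>1 \<rhd> a\<^sub>1) \<otimes>\<^bsub>H',H'\<^esub> (x\<^sub>2 \<rhd> a\<^sub>2)))"
    and left_counit: "\<lbrakk>x \<in> carrier H; a \<in> carrier H'\<rbrakk> \<Longrightarrow>
          counit H' (x \<rhd> a) = counit H x * counit H' a"
    and right_bilinear: "bilinear_map H H' H (\<lhd>)"
    and right_one: "x \<in> carrier H \<Longrightarrow> x \<lhd> \<one>\<^bsub>H'\<^esub> = x"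
    and right_mult: "\<lbrakk>x \<in> carrier H; a \<in> carrier H'; b \<in> carrier H'\<rbrakk> \<Longrightarrow>
          x \<lhd> (a \<bullet>\<^bsub>H'\<^esub> b) = (x \<lhd> a) \<lhd> b"
    and right_comult: "\<lbrakk>x \<in> carrier H; a \<in> carrier H'\<rbrakk> \<Longrightarrow>
          comult H (x \<lhd> a) =
          sweedler H x (\<lambda>x\<^sub>1 x\<^sub>2. sweedler H' a (\<lambda>a\<^sub>1 a\<^sub>2.
            (x\<^sub>1 \<lhd> a\<^sub>1) \<otimes>\<^bsub>H,H\<^esub> (x\<^sub>2 \<lhd> a\<^sub>2)))"
    and right_counit: "\<lbrakk>x \<in> carrier H; a \<in> carrier H'\<rbrakk> \<Longrightarrow>
          counit H (x \<lhd> a) = counit H x * counit H' a"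
    and left_on_one: "x \<in> carrier H \<Longrightarrow>
          x \<rhd> \<one>\<^bsub>H'\<^esub> = counit H x \<star>\<^bsub>H'\<^esub> \<one>\<^bsub>H'\<^esub>"
    and right_on_one: "a \<in> carrier H' \<Longrightarrow>
          \<one>\<^bsub>H\<^esub> \<lhd> a = counit H' a \<star>\<^bsub>H\<^esub> \<one>\<^bsub>H\<^esub>"
    and left_on_mult: "\<lbrakk>x \<in> carrier H; a \<in> carrier H'; b \<in> carrier H'\<rbrakk> \<Longrightarrow>
          x \<rhd> (a \<bullet>\<^bsub>H'\<^esub> b) =
          sweedler H x (\<lambda>x\<^sub>1 x\<^sub>2. sweedler H' a (\<lambda>a\<^sub>1 a\<^sub>2.
            (x\<^sub>1 \<rhd> a\<^sub>1) \<bullet>\<^bsub>H'\<^esub> ((x\<^sub>2 \<lhd> a\<^sub>2) \<rhd> b)))"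
    and right_on_mult: "\<lbrakk>x \<in> carrier H; y \<in> carrier H; a \<in> carrier H'\<rbrakk> \<Longrightarrow>
          (x \<bullet>\<^bsub>H\<^esub> y) \<lhd> a =
          sweedler H y (\<lambda>y\<^sub>1 y\<^sub>2. sweedler H' a (\<lambda>a\<^sub>1 a\<^sub>2.
            (x \<lhd> (y\<^sub>1 \<rhd> a\<^sub>1)) \<bullet>\<^bsub>H\<^esub> (y\<^sub>2 \<lhd> a\<^sub>2)))"

definition dcp_mult ::
  "('k::field_char_0, 'a::ab_group_add) hopf \<Rightarrow> ('k, 'b::ab_group_add) hopf \<Rightarrow>
   ('a \<Rightarrow> 'b \<Rightarrow> 'b) \<Rightarrow> ('a \<Rightarrow> 'b \<Rightarrow> 'a) \<Rightarrow>
   ('k, 'b, 'a) tensor \<Rightarrow> ('k, 'b, 'a) tensor \<Rightarrow> ('k, 'b, 'a) tensor" where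
  "dcp_mult H H' left right s t =
     tlift H' H (\<lambda>a x. tlift H' H (\<lambda>a' x'.
       sweedler H x (\<lambda>x\<^sub>1 x\<^sub>2. sweedler H' a' (\<lambda>a\<^sub>1' a\<^sub>2'.
         (a \<bullet>\<^bsub>H'\<^esub> left x\<^sub>1 a\<^sub>1') \<otimes>\<^bsub>H',H\<^esub> (right x\<^sub>2 a\<^sub>2' \<bullet>\<^bsub>H\<^esub> x')))) t) s"

text \<open>
  The double cross product on \<open>H' \<otimes> H\<close>. The antipode is forced by
  \<open>a \<otimes> x = (a \<otimes> 1)(1 \<otimes> x)\<close>, which gives \<open>S(a \<otimes> x) = (1 \<otimes> S(x))(S(a) \<otimes> 1)\<close>.
\<close>

definition double_cross_product ::
  "('k::field_char_0, 'a::ab_group_add) hopf \<Rightarrow> ('k, 'b::ab_group_add) hopf \<Rightarrow>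
   ('a \<Rightarrow> 'b \<Rightarrow> 'b) \<Rightarrow> ('a \<Rightarrow> 'b \<Rightarrow> 'a) \<Rightarrow> ('k, ('k, 'b, 'a) tensor) hopf" where
  "double_cross_product H H' left right =
     \<lparr>carrier = carrier (tensor H' H),
      scal = scal (tensor H' H),
      mult = dcp_mult H H' left right,
      one = \<one>\<^bsub>H'\<^esub> \<otimes>\<^bsub>H',H\<^esub> \<one>\<^bsub>H\<^esub>,
      comult = tlift H' H (\<lambda>a x.
        sweedler H' a (\<lambda>a\<^sub>1 a\<^sub>2. sweedler H x (\<lambda>x\<^sub>1 x\<^sub>2.
          (a\<^sub>1 \<otimes>\<^bsub>H',H\<^esub> x\<^sub>1) \<otimes>\<^bsub>tensor H' H,tensor H' H\<^esub> (a\<^sub>2 \<otimes>\<^bsub>H',H\<^esub> x\<^sub>2)))),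
      counit = tlift H' H (\<lambda>a x. counit H' a * counit H x),
      antipode = tlift H' H (\<lambda>a x.
        dcp_mult H H' left right
          (\<one>\<^bsub>H'\<^esub> \<otimes>\<^bsub>H',H\<^esub> antipode H x) (antipode H' a \<otimes>\<^bsub>H',H\<^esub> \<one>\<^bsub>H\<^esub>))\<rparr>"

definition projection_hom_pair ::
  "('k::field_char_0, 'a::ab_group_add) hopf \<Rightarrow> ('k, 'b::ab_group_add) hopf \<Rightarrow>
   ('a \<Rightarrow> 'b \<Rightarrow> 'b) \<Rightarrow> ('a \<Rightarrow> 'b \<Rightarrow> 'a) \<Rightarrow>
   (('k, 'b, 'a) tensor \<Rightarrow> ('k, 'b, 'a) tensor) \<Rightarrow>
   (('k, 'b, 'a) tensor \<Rightarrow> ('k, 'b, 'a) tensor) \<Rightarrow> bool" where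
  "projection_hom_pair H H' left right B B' \<longleftrightarrow>
     (let A = double_cross_product H H' left right in
        hopf_hom A A B \<and> (\<forall>z\<in>carrier A. B (B z) = B z) \<and>
        hopf_hom A A B' \<and> (\<forall>z\<in>carrier A. B' (B' z) = B' z) \<and>
        (\<forall>z\<in>carrier A. sweedler A z (\<lambda>z\<^sub>1 z\<^sub>2. B z\<^sub>1 \<bullet>\<^bsub>A\<^esub> B' z\<^sub>2) = z))"

text \<open>The linear map \<open>a \<otimes> x \<mapsto> a \<otimes> \<epsilon>(x)1\<close> on \<open>H' \<otimes> H\<close>.\<close>

definition first_part ::
  "('k::field_char_0, 'a::ab_group_add) hopf \<Rightarrow> ('k, 'b::ab_group_add) hopf \<Rightarrow>
   ('k, 'b, 'a) tensor \<Rightarrow> ('k, 'b, 'a) tensor" where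
  "first_part H H' =
     tlift H' H (\<lambda>a x. a \<otimes>\<^bsub>H',H\<^esub> (counit H x \<star>\<^bsub>H\<^esub> \<one>\<^bsub>H\<^esub>))"


section \<open>The universal property of the tensor product\<close>

lemma vector_space_tensor_scal:
  "vector_space (\<lambda>(c::'k::field_char_0) (t::('k, 'a, 'b) tensor) \<beta>. c * t \<beta>)"
  by unfold_locales (auto simp: fun_eq_iff algebra_simps)

lemma vspace_tensor:
  fixes V :: "('k::field_char_0, 'a::ab_group_add, 'm) vspace_scheme"
    and W :: "('k, 'b::ab_group_add, 'n) vspace_scheme"
  shows "vspace (tensor V W)"
proof -
  interpret vector_space "\<lambda>(c::'k::field_char_0) (t::('k, 'a, 'b) tensor) \<beta>. c * t \<beta>"
    by (rule vector_space_tensor_scal)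
  show ?thesis
    unfolding vspace_def tensor_def
    using subspace_span by (simp add: vector_space_tensor_scal)
qed

lemma vspace_ground: "vspace ground"
proof -
  interpret vector_space "(*) :: 'a \<Rightarrow> 'a \<Rightarrow> 'a::field_char_0"
    by unfold_locales (auto simp: algebra_simps)
  show ?thesis
    unfolding vspace_def ground_def by (simp add: vector_space_axioms)
qed

lemma scal_ptensor:
  fixes V :: "('k::field_char_0, 'a::ab_group_add, 'm) vspace_scheme"
    and W :: "('k, 'b::ab_group_add, 'n) vspace_scheme"
  shows "c \<star>\<^bsub>tensor V W\<^esub> (v \<otimes>\<^bsub>V,W\<^esub> w) = (c \<star>\<^bsub>V\<^esub> v) \<otimes>\<^bsub>V,W\<^esub> w"
    and "c \<star>\<^bsub>tensor V W\<^esub> (v \<otimes>\<^bsub>V,W\<^esub> w) = v \<otimes>\<^bsub>V,W\<^esub> (c \<star>\<^bsub>W\<^esub> w)"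
  by (auto simp: tensor_def ptensor_def fun_eq_iff bilinear_form_def
      Vector_Spaces.linear_def module_hom_iff)

lemma ptensor_add:
  fixes V :: "('k::field_char_0, 'a::ab_group_add, 'm) vspace_scheme"
    and W :: "('k, 'b::ab_group_add, 'n) vspace_scheme"
  shows "(v + v') \<otimes>\<^bsub>V,W\<^esub> w = (v \<otimes>\<^bsub>V,W\<^esub> w) + (v' \<otimes>\<^bsub>V,W\<^esub> w)"
    and "v \<otimes>\<^bsub>V,W\<^esub> (w + w') = (v \<otimes>\<^bsub>V,W\<^esub> w) + (v \<otimes>\<^bsub>V,W\<^esub> w')"
  by (auto simp: ptensor_def fun_eq_iff bilinear_form_def
      Vector_Spaces.linear_def module_hom_iff)

lemma ptensor_closed:
  fixes V :: "('k::field_char_0, 'a::ab_group_add, 'm) vspace_scheme"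
    and W :: "('k, 'b::ab_group_add, 'n) vspace_scheme"
  assumes "v \<in> carrier V" "w \<in> carrier W"
  shows "v \<otimes>\<^bsub>V,W\<^esub> w \<in> carrier (tensor V W)"
proof -
  interpret vector_space "\<lambda>(c::'k) (t::('k, 'a, 'b) tensor) \<beta>. c * t \<beta>"
    by (rule vector_space_tensor_scal)
  show ?thesis
    using assms unfolding tensor_def by (auto intro!: span_base)
qed

lemma ptensor_bilinear:
  fixes V :: "('k::field_char_0, 'a::ab_group_add, 'm) vspace_scheme"
    and W :: "('k, 'b::ab_group_add, 'n) vspace_scheme"
  shows "bilinear_map V W (tensor V W) (\<lambda>v w. v \<otimes>\<^bsub>V,W\<^esub> w)"
  unfolding bilinear_map_def linear_map_def
  by (intro conjI ballI allI)
    (simp_all only: ptensor_closed ptensor_add scal_ptensor(1)[symmetric] scal_ptensor(2)[symmetric])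

lemma tensor_repr:
  fixes V :: "('k::field_char_0, 'a::ab_group_add, 'm) vspace_scheme"
    and W :: "('k, 'b::ab_group_add, 'n) vspace_scheme"
  assumes V: "vspace V" and t: "t \<in> carrier (tensor V W)"
  obtains n :: nat and v w where
    "\<forall>i<n. v i \<in> carrier V \<and> w i \<in> carrier W"
    "t = (\<Sum>i<n. v i \<otimes>\<^bsub>V,W\<^esub> w i)"
proof -
  interpret T: vector_space "\<lambda>(c::'k) (t::('k, 'a, 'b) tensor) \<beta>. c * t \<beta>"
    by (rule vector_space_tensor_scal)
  interpret V: vector_space "scal V"
    using V by (simp add: vspace_def)
  define P where "P t \<longleftrightarrow> (\<exists>(n::nat) v w.
     (\<forall>i<n. v i \<in> carrier V \<and> w i \<in> carrier W) \<and> t = (\<Sum>i<n. v i \<otimes>\<^bsub>V,W\<^esub> w i))" for t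
  have "t \<in> T.span {v \<otimes>\<^bsub>V,W\<^esub> w | v w. v \<in> carrier V \<and> w \<in> carrier W}"
    using t by (simp add: tensor_def)
  then have "P t"
  proof (induction rule: T.span_induct_alt)
    case base
    show ?case unfolding P_def by (intro exI[of _ 0]) simp
  next
    case (step c x y)
    obtain a b where x: "x = a \<otimes>\<^bsub>V,W\<^esub> b" and ab: "a \<in> carrier V" "b \<in> carrier W"
      using step by blast
    obtain n v w where n: "\<forall>i<n. v i \<in> carrier V \<and> w i \<in> carrier W"
      and y: "y = (\<Sum>i<(n::nat). v i \<otimes>\<^bsub>V,W\<^esub> w i)"
      using step unfolding P_def by blast
    have *: "(\<lambda>\<beta>. c * x \<beta>) = (c \<star>\<^bsub>V\<^esub> a) \<otimes>\<^bsub>V,W\<^esub> b"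
      using scal_ptensor(1)[of V W c a b] by (simp add: x tensor_def)
    have "c \<star>\<^bsub>V\<^esub> a \<in> carrier V"
      using V ab by (auto simp: vspace_def intro: V.subspace_scale)
    then show ?case
      unfolding P_def using n ab
      by (intro exI[of _ "Suc n"] exI[of _ "v(n := c \<star>\<^bsub>V\<^esub> a)"] exI[of _ "w(n := b)"])
        (auto simp: * y less_Suc_eq add.commute)
  qed
  then show thesis
    using that unfolding P_def by blast
qed

lemma sum_eq_of_tensor_eq:
  fixes V :: "('k::field_char_0, 'a::ab_group_add, 'm) vspace_scheme"
    and W :: "('k, 'b::ab_group_add, 'n) vspace_scheme"
    and U :: "('k, 'c::ab_group_add, 'p) vspace_scheme"
  assumes V: "vspace V" and W: "vspace W" and U: "vspace U"
    and f: "bilinear_map V W U f"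
    and I: "\<forall>i<(n::nat). v i \<in> carrier V \<and> w i \<in> carrier W"
    and J: "\<forall>i<(m::nat). v' i \<in> carrier V \<and> w' i \<in> carrier W"
    and eq: "(\<Sum>i<n. v i \<otimes>\<^bsub>V,W\<^esub> w i) = (\<Sum>i<m. v' i \<otimes>\<^bsub>V,W\<^esub> w' i)"
  shows "(\<Sum>i<n. f (v i) (w i)) = (\<Sum>i<m. f (v' i) (w' i))"
proof (rule ccontr)
  assume "\<not> ?thesis"
  then have d: "(\<Sum>i<n. f (v i) (w i)) - (\<Sum>i<m. f (v' i) (w' i)) \<noteq> 0"
    (is "?d \<noteq> 0") by simp
  interpret V: vector_space "scal V" using V by (simp add: vspace_def)
  interpret W: vector_space "scal W" using W by (simp add: vspace_def)
  interpret U: vector_space "scal U" using U by (simp add: vspace_def)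
  interpret K: vector_space "(*) :: 'k \<Rightarrow> 'k \<Rightarrow> 'k"
    by unfold_locales (auto simp: algebra_simps)
  interpret VV: vector_space_pair "scal V" "scal V" ..
  interpret WW: vector_space_pair "scal W" "scal W" ..
  interpret UK: vector_space_pair "scal U" "(*) :: 'k \<Rightarrow> 'k \<Rightarrow> 'k" ..
  obtain p where p: "range p \<subseteq> carrier V" "Vector_Spaces.linear (scal V) (scal V) p"
    "\<And>x. x \<in> carrier V \<Longrightarrow> p x = x"
    using VV.linear_exists_left_inverse_on[OF V.linear_id, of "carrier V"] V
    by (auto simp: vspace_def)
  obtain q where q: "range q \<subseteq> carrier W" "Vector_Spaces.linear (scal W) (scal W) q"
    "\<And>x. x \<in> carrier W \<Longrightarrow> q x = x"
    using WW.linear_exists_left_inverse_on[OF W.linear_id, of "carrier W"] W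
    by (auto simp: vspace_def)
  have "U.independent {?d}"
    using d by simp
  then obtain \<phi> where \<phi>: "Vector_Spaces.linear (scal U) (*) \<phi>" "\<phi> ?d = 1"
    using UK.linear_independent_extend[of "{?d}" "\<lambda>_. 1"] by auto
  interpret p: Vector_Spaces.linear "scal V" "scal V" p by (rule p)
  interpret q: Vector_Spaces.linear "scal W" "scal W" q by (rule q)
  interpret \<phi>: Vector_Spaces.linear "scal U" "(*)" \<phi> by (rule \<phi>)
  define \<beta> where "\<beta> x y = \<phi> (f (p x) (q y))" for x y
  have pr: "p x \<in> carrier V" "q y \<in> carrier W" for x y
    using p(1) q(1) by auto
  have "bilinear_form V W \<beta>"
    unfolding bilinear_form_def
  proof (intro conjI allI)
    fix x
    show "Vector_Spaces.linear (scal W) (*) (\<beta> x)"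
      using f pr unfolding bilinear_map_def linear_map_def
      by unfold_locales (auto simp: \<beta>_def q.add q.scale \<phi>.add \<phi>.scale)
  next
    fix y
    show "Vector_Spaces.linear (scal V) (*) (\<lambda>x. \<beta> x y)"
      using f pr unfolding bilinear_map_def linear_map_def
      by unfold_locales (auto simp: \<beta>_def p.add p.scale \<phi>.add \<phi>.scale)
  qed
  have sum_ap: "(\<Sum>i\<in>A. g i) \<beta> = (\<Sum>i\<in>A. g i \<beta>)"
    if "finite A" for A :: "nat set" and g :: "nat \<Rightarrow> ('k, 'a, 'b) tensor"
    using that by (induction A) auto
  have "(\<Sum>i<n. \<beta> (v i) (w i)) = (\<Sum>i<m. \<beta> (v' i) (w' i))"
    using fun_cong[OF eq, of \<beta>] \<open>bilinear_form V W \<beta>\<close>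
    by (simp add: sum_ap ptensor_def)
  moreover have "(\<Sum>i<n. \<beta> (v i) (w i)) = \<phi> (\<Sum>i<n. f (v i) (w i))"
    using I by (simp add: \<phi>.sum \<beta>_def p(3) q(3))
  moreover have "(\<Sum>i<m. \<beta> (v' i) (w' i)) = \<phi> (\<Sum>i<m. f (v' i) (w' i))"
    using J by (simp add: \<phi>.sum \<beta>_def p(3) q(3))
  ultimately show False
    using \<phi>(2) by (simp add: \<phi>.diff)
qed

lemma tlift_sum:
  fixes V :: "('k::field_char_0, 'a::ab_group_add, 'm) vspace_scheme"
    and W :: "('k, 'b::ab_group_add, 'n) vspace_scheme"
    and U :: "('k, 'c::ab_group_add, 'p) vspace_scheme"
  assumes "vspace V" "vspace W" "vspace U" "bilinear_map V W U f"
    and "\<forall>i<(n::nat). v i \<in> carrier V \<and> w i \<in> carrier W"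
  shows "tlift V W f (\<Sum>i<n. v i \<otimes>\<^bsub>V,W\<^esub> w i) = (\<Sum>i<n. f (v i) (w i))"
  unfolding tlift_def
proof (rule the_equality)
  fix u
  assume "\<exists>(m::nat) v' w'. (\<forall>i<m. v' i \<in> carrier V \<and> w' i \<in> carrier W) \<and>
    (\<Sum>i<n. v i \<otimes>\<^bsub>V,W\<^esub> w i) = (\<Sum>i<m. v' i \<otimes>\<^bsub>V,W\<^esub> w' i) \<and>
    u = (\<Sum>i<m. f (v' i) (w' i))"
  then show "u = (\<Sum>i<n. f (v i) (w i))"
  proof (elim exE conjE)
    fix m :: nat and v' w'
    assume *: "\<forall>i<m. v' i \<in> carrier V \<and> w' i \<in> carrier W"
      "(\<Sum>i<n. v i \<otimes>\<^bsub>V,W\<^esub> w i) = (\<Sum>i<m. v' i \<otimes>\<^bsub>V,W\<^esub> w' i)"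
      "u = (\<Sum>i<m. f (v' i) (w' i))"
    show ?thesis
      unfolding *(3)
      by (rule sum_eq_of_tensor_eq[OF assms(1-4) *(1) assms(5) *(2)[symmetric]])
  qed
qed (use assms(5) in blast)

lemma tlift_ptensor:
  assumes "vspace V" "vspace W" "vspace U" "bilinear_map V W U f"
    and "v \<in> carrier V" "w \<in> carrier W"
  shows "tlift V W f (v \<otimes>\<^bsub>V,W\<^esub> w) = f v w"
  using tlift_sum[OF assms(1-4), of 1 "\<lambda>_. v" "\<lambda>_. w"] assms(5,6) by simp

lemma tlift_linear:
  fixes V :: "('k::field_char_0, 'a::ab_group_add, 'm) vspace_scheme"
    and W :: "('k, 'b::ab_group_add, 'n) vspace_scheme"
    and U :: "('k, 'c::ab_group_add, 'p) vspace_scheme"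
  assumes V: "vspace V" and W: "vspace W" and U: "vspace U"
    and f: "bilinear_map V W U f"
  shows "linear_map (tensor V W) U (tlift V W f)"
  unfolding linear_map_def
proof (intro conjI ballI allI)
  interpret V: vector_space "scal V" using V by (simp add: vspace_def)
  interpret U: vector_space "scal U" using U by (simp add: vspace_def)
  have sV: "V.subspace (carrier V)" and sU: "U.subspace (carrier U)"
    using V U by (auto simp: vspace_def)
  note f' = f[unfolded bilinear_map_def linear_map_def]
  note L = tlift_sum[OF V W U f]
  {
    fix t assume "t \<in> carrier (tensor V W)"
    then obtain n :: nat and v w where
      r: "\<forall>i<n. v i \<in> carrier V \<and> w i \<in> carrier W"
        "t = (\<Sum>i<n. v i \<otimes>\<^bsub>V,W\<^esub> w i)" by (rule tensor_repr[OF V])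
    show "tlift V W f t \<in> carrier U"
      unfolding r(2) L[OF r(1)] using r(1) f' by (intro U.subspace_sum[OF sU]) auto
    fix c
    have "c \<star>\<^bsub>tensor V W\<^esub> t = (\<Sum>i<n. (c \<star>\<^bsub>V\<^esub> v i) \<otimes>\<^bsub>V,W\<^esub> w i)"
    proof -
      interpret T: vector_space "scal (tensor V W)"
        using vspace_tensor[of V W] by (simp add: vspace_def)
      show ?thesis by (simp add: r(2) T.scale_sum_right scal_ptensor(1))
    qed
    moreover have "\<forall>i<n. c \<star>\<^bsub>V\<^esub> v i \<in> carrier V \<and> w i \<in> carrier W"
      using r(1) V.subspace_scale[OF sV] by auto
    note L[OF this]
    ultimately show "tlift V W f (c \<star>\<^bsub>tensor V W\<^esub> t) = c \<star>\<^bsub>U\<^esub> tlift V W f t"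
      using f' r(1) by (auto simp: r(2) L U.scale_sum_right intro!: sum.cong)
    fix s assume "s \<in> carrier (tensor V W)"
    then obtain m :: nat and v' w' where
      r': "\<forall>i<m. v' i \<in> carrier V \<and> w' i \<in> carrier W"
        "s = (\<Sum>i<m. v' i \<otimes>\<^bsub>V,W\<^esub> w' i)" by (rule tensor_repr[OF V])
    define v'' where "v'' i = (if i < n then v i else v' (i - n))" for i
    define w'' where "w'' i = (if i < n then w i else w' (i - n))" for i
    have split: "(\<Sum>i<n + m. g (v'' i) (w'' i)) =
        (\<Sum>i<n. g (v i) (w i)) + (\<Sum>i<m. g (v' i) (w' i))"
      for g :: "'a \<Rightarrow> 'b \<Rightarrow> 'd::ab_group_add"
    proof -
      have "(\<Sum>i<n + k. g (v'' i) (w'' i)) =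
        (\<Sum>i<n. g (v i) (w i)) + (\<Sum>i<k. g (v' i) (w' i))" for k
        by (induction k) (simp_all add: v''_def w''_def add.assoc)
      then show ?thesis .
    qed
    have ts: "t + s = (\<Sum>i<n + m. v'' i \<otimes>\<^bsub>V,W\<^esub> w'' i)"
      using split[of "\<lambda>v w. v \<otimes>\<^bsub>V,W\<^esub> w"] by (simp only: r(2) r'(2))
    have "\<forall>i<n + m. v'' i \<in> carrier V \<and> w'' i \<in> carrier W"
      using r(1) r'(1) by (auto simp: v''_def w''_def)
    then have "tlift V W f (t + s) = (\<Sum>i<n + m. f (v'' i) (w'' i))"
      unfolding ts by (rule L)
    moreover have "tlift V W f t = (\<Sum>i<n. f (v i) (w i))"
      unfolding r(2) by (rule L[OF r(1)])
    moreover have "tlift V W f s = (\<Sum>i<m. f (v' i) (w' i))"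
      unfolding r'(2) by (rule L[OF r'(1)])
    ultimately show "tlift V W f (t + s) = tlift V W f t + tlift V W f s"
      using split[of f] by simp
  }
qed

theorem tensor_universal:
  fixes V :: "('k::field_char_0, 'a::ab_group_add, 'm) vspace_scheme"
    and W :: "('k, 'b::ab_group_add, 'n) vspace_scheme"
    and U :: "('k, 'c::ab_group_add, 'p) vspace_scheme"
  assumes V: "vspace V" and W: "vspace W" and U: "vspace U"
    and f: "bilinear_map V W U f"
    and g: "linear_map (tensor V W) U g"
  shows "(\<forall>v\<in>carrier V. \<forall>w\<in>carrier W. g (v \<otimes>\<^bsub>V,W\<^esub> w) = f v w) \<longleftrightarrow>
         (\<forall>t\<in>carrier (tensor V W). g t = tlift V W f t)"
proof safe
  fix t
  assume fg: "\<forall>v\<in>carrier V. \<forall>w\<in>carrier W. g (v \<otimes>\<^bsub>V,W\<^esub> w) = f v w"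
    and t: "t \<in> carrier (tensor V W)"
  from t obtain n :: nat and v w where
    r: "\<forall>i<n. v i \<in> carrier V \<and> w i \<in> carrier W"
      "t = (\<Sum>i<n. v i \<otimes>\<^bsub>V,W\<^esub> w i)" by (rule tensor_repr[OF V])
  interpret T: vector_space "scal (tensor V W)"
    using vspace_tensor[of V W] by (simp add: vspace_def)
  interpret U: vector_space "scal U" using U by (simp add: vspace_def)
  have sT: "T.subspace (carrier (tensor V W))"
    using vspace_tensor[of V W] by (simp add: vspace_def)
  have "0 \<in> carrier (tensor V W)"
    by (rule T.subspace_0[OF sT])
  then have "g (0 \<star>\<^bsub>tensor V W\<^esub> 0) = 0 \<star>\<^bsub>U\<^esub> g 0"
    using g unfolding linear_map_def by blast
  then have g0: "g 0 = 0"
    by (simp only: T.scale_zero_left U.scale_zero_left)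
  have "k \<le> n \<Longrightarrow> (\<Sum>i<k. v i \<otimes>\<^bsub>V,W\<^esub> w i) \<in> carrier (tensor V W) \<and>
      g (\<Sum>i<k. v i \<otimes>\<^bsub>V,W\<^esub> w i) = (\<Sum>i<k. f (v i) (w i))" for k
  proof (induction k)
    case 0
    show ?case using g0 T.subspace_0[OF sT] by (simp only: lessThan_0 sum.empty)
  next
    case (Suc k)
    then have "v k \<in> carrier V" "w k \<in> carrier W" using r(1) by auto
    then show ?case
      using Suc fg g T.subspace_add[OF sT] ptensor_closed[where V = V and W = W and v = "v k" and w = "w k"]
      unfolding linear_map_def by (simp del: plus_fun_apply)
  qed
  then show "g t = tlift V W f t"
    using r by (simp add: tlift_sum[OF V W U f])
qed (use tlift_ptensor[OF V W U f] ptensor_closed in metis)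

end

theory Submission
  imports Defs
begin

text \<open>
  Cocommutative Hopf algebras are treated like groups through their points: for a cocommutative
  coalgebra \<open>X\<close>, the coalgebra maps \<open>X \<rightarrow> A\<close> form a group under convolution, and a Sweedler identity
  in \<open>A\<close> is an identity between such maps on a suitable tensor power \<open>X\<close>. On points \<open>A = H' \<bowtie> H\<close> is
  the product \<open>(a, x)(b, y) = (a (x \<rhd> b), (x \<lhd> b) y)\<close> of a matched pair of groups, which makes \<open>A\<close>
  a Hopf algebra.

  Write \<open>z = P(z) Q(z)\<close> for the factorization of a point into its parts in \<open>H'\<close> and \<open>H\<close>, so that
  \<open>C = B \<circ> P\<close> on \<open>K\<close>. From \<open>z = B(z) B'(z)\<close> and \<open>B\<^sup>2 = B\<close> it follows that \<open>B'\<close> is trivial on \<open>K\<close>. For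
  \<open>x, y \<in> K\<close> put \<open>u = P(x) y Q(x)\<close>. Then \<open>B'(u) = B'(P(x) Q(x)) = B'(x) = 1\<close>, hence
  \<open>u = B(u) = C(x) y B(Q(x)) = C(x) y C(x)\<^sup>-\<^sup>1 x\<close>. Since \<open>P(u) = P(x) P(y)\<close>, applying \<open>B\<close> to it gives
  \<open>C(C(x) y C(x)\<^sup>-\<^sup>1 x) = C(x) C(y)\<close>.
\<close>

section \<open>Linear and bilinear maps\<close>

text \<open>Cocommutativity of \<open>X\<close> is what makes points usable: comultiplying a product
  \<open>f(z\<^sub>1) g(z\<^sub>2)\<close> yields pieces in the order f, f, g, g that must be
  regrouped as f, g, f, g, and only then is the product again a coalgebra map. The return from
  points to elements is of Yoneda type. For an identity in elements s and t, \<open>X\<close> is the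
  tensor product of the coalgebras they come from, the points are the two projections, and
  everything is evaluated at the pure tensor of s and t. Inverses are handled in the larger
  convolution monoid of linear maps, where cancellation is available as soon as the antipode axiom
  is. The double cross product is given by bare formulas, so its Hopf axioms have to be established
  as well; they are also what makes the image \<open>K\<close> a Hopf algebra. Since associativity
  of its product is itself proved through points, the coalgebra layer has to come before any algebra
  on it.\<close>

lemma vspace_vector_space: "vspace V \<Longrightarrow> vector_space (scal V)"
  by (simp add: vspace_def)

lemma vspace_zero: "vspace V \<Longrightarrow> 0 \<in> carrier V"
  unfolding vspace_def using module.subspace_0 module_iff_vector_space by blast

lemma vspace_add: "vspace V \<Longrightarrow> x \<in> carrier V \<Longrightarrow> y \<in> carrier V \<Longrightarrow> x + y \<in> carrier V"
  unfolding vspace_def using module.subspace_add module_iff_vector_space by blast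

lemma vspace_scale: "vspace V \<Longrightarrow> x \<in> carrier V \<Longrightarrow> c \<star>\<^bsub>V\<^esub> x \<in> carrier V"
  unfolding vspace_def using module.subspace_scale module_iff_vector_space by blast

lemma vspace_sum: "vspace V \<Longrightarrow> (\<And>i. i \<in> I \<Longrightarrow> f i \<in> carrier V) \<Longrightarrow> (\<Sum>i\<in>I. f i) \<in> carrier V"
  by (induction I rule: infinite_finite_induct) (auto intro: vspace_zero vspace_add)

lemma vspace_scale_sum: "vspace V \<Longrightarrow> c \<star>\<^bsub>V\<^esub> (\<Sum>i\<in>I. f i) = (\<Sum>i\<in>I. c \<star>\<^bsub>V\<^esub> f i)"
  using module.scale_sum_right module_iff_vector_space unfolding vspace_def by blast

lemma vspace_scale_add: "vspace V \<Longrightarrow> c \<star>\<^bsub>V\<^esub> (x + y) = c \<star>\<^bsub>V\<^esub> x + c \<star>\<^bsub>V\<^esub> y"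
  unfolding vspace_def vector_space_def by blast

lemma vspace_scale_add_left: "vspace V \<Longrightarrow> (c + d) \<star>\<^bsub>V\<^esub> x = c \<star>\<^bsub>V\<^esub> x + d \<star>\<^bsub>V\<^esub> x"
  unfolding vspace_def vector_space_def by blast

lemma vspace_scale_scale: "vspace V \<Longrightarrow> c \<star>\<^bsub>V\<^esub> (d \<star>\<^bsub>V\<^esub> x) = (c * d) \<star>\<^bsub>V\<^esub> x"
  unfolding vspace_def vector_space_def by blast

lemma linear_mapI:
  assumes "\<And>x. x \<in> carrier V \<Longrightarrow> f x \<in> carrier W"
    and "\<And>x y. x \<in> carrier V \<Longrightarrow> y \<in> carrier V \<Longrightarrow> f (x + y) = f x + f y"
    and "\<And>c x. x \<in> carrier V \<Longrightarrow> f (c \<star>\<^bsub>V\<^esub> x) = c \<star>\<^bsub>W\<^esub> f x"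
  shows "linear_map V W f"
  using assms by (simp add: linear_map_def)

lemma linear_map_closed: "linear_map V W f \<Longrightarrow> x \<in> carrier V \<Longrightarrow> f x \<in> carrier W"
  by (simp add: linear_map_def)

lemma linear_map_add:
  "linear_map V W f \<Longrightarrow> x \<in> carrier V \<Longrightarrow> y \<in> carrier V \<Longrightarrow> f (x + y) = f x + f y"
  by (simp add: linear_map_def)

lemma linear_map_scale:
  "linear_map V W f \<Longrightarrow> x \<in> carrier V \<Longrightarrow> f (c \<star>\<^bsub>V\<^esub> x) = c \<star>\<^bsub>W\<^esub> f x"
  by (simp add: linear_map_def)

lemma linear_map_zero:
  assumes "vspace V" "linear_map V W f"
  shows "f 0 = 0"
  using linear_map_add[OF assms(2) vspace_zero[OF assms(1)] vspace_zero[OF assms(1)]] by simp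

lemma linear_map_sum:
  assumes "vspace V" "linear_map V W f" "\<And>i. i \<in> I \<Longrightarrow> g i \<in> carrier V"
  shows "f (\<Sum>i\<in>I. g i) = (\<Sum>i\<in>I. f (g i))"
  using assms(3)
  by (induction I rule: infinite_finite_induct)
    (auto simp: linear_map_zero[OF assms(1,2)] linear_map_add[OF assms(2)] vspace_sum[OF assms(1)])

lemma linear_map_cong:
  assumes "\<And>x. x \<in> carrier V \<Longrightarrow> f x = g x" "vspace V" "linear_map V W f"
  shows "linear_map V W g"
proof (rule linear_mapI)
  fix x y assume xy: "x \<in> carrier V" "y \<in> carrier V"
  show "g x \<in> carrier W" using assms(1)[OF xy(1)] linear_map_closed[OF assms(3) xy(1)] by simp
  show "g (x + y) = g x + g y"
    using linear_map_add[OF assms(3) xy] by (simp add: assms(1) xy vspace_add[OF assms(2) xy])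
next
  fix c x assume x: "x \<in> carrier V"
  show "g (c \<star>\<^bsub>V\<^esub> x) = c \<star>\<^bsub>W\<^esub> g x"
    using linear_map_scale[OF assms(3) x, of c] by (simp add: assms(1) x vspace_scale[OF assms(2) x])
qed

lemma linear_map_ident: "linear_map V V (\<lambda>x. x)"
  by (simp add: linear_map_def)

lemma linear_map_comp:
  "linear_map V W g \<Longrightarrow> linear_map Y V f \<Longrightarrow> linear_map Y W (\<lambda>y. g (f y))"
  by (simp add: linear_map_def)

lemma linear_map_sums:
  assumes U: "vspace U" and f: "\<And>i. i \<in> I \<Longrightarrow> linear_map Y U (f i)"
  shows "linear_map Y U (\<lambda>y. \<Sum>i\<in>I. f i y)"
proof (rule linear_mapI)
  fix x assume x: "x \<in> carrier Y"
  show "(\<Sum>i\<in>I. f i x) \<in> carrier U"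
    using linear_map_closed[OF f x] by (intro vspace_sum[OF U])
  show "(\<Sum>i\<in>I. f i (c \<star>\<^bsub>Y\<^esub> x)) = c \<star>\<^bsub>U\<^esub> (\<Sum>i\<in>I. f i x)" for c
    unfolding vspace_scale_sum[OF U] by (intro sum.cong refl linear_map_scale[OF f x])
  fix y assume y: "y \<in> carrier Y"
  show "(\<Sum>i\<in>I. f i (x + y)) = (\<Sum>i\<in>I. f i x) + (\<Sum>i\<in>I. f i y)"
    unfolding sum.distrib[symmetric] by (intro sum.cong refl linear_map_add[OF f x y])
qed

lemma bilinear_mapI:
  "(\<And>x. x \<in> carrier V \<Longrightarrow> linear_map W U (\<lambda>y. f x y)) \<Longrightarrow>
   (\<And>y. y \<in> carrier W \<Longrightarrow> linear_map V U (\<lambda>x. f x y)) \<Longrightarrow> bilinear_map V W U f"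
  by (simp add: bilinear_map_def)

lemma bilinear_map_left:
  "bilinear_map V W U \<beta> \<Longrightarrow> linear_map Y V f \<Longrightarrow> w \<in> carrier W \<Longrightarrow> linear_map Y U (\<lambda>y. \<beta> (f y) w)"
  unfolding bilinear_map_def using linear_map_comp[of V U "\<lambda>x. \<beta> x w" Y f] by blast

lemma bilinear_map_right:
  "bilinear_map V W U \<beta> \<Longrightarrow> linear_map Y W g \<Longrightarrow> v \<in> carrier V \<Longrightarrow> linear_map Y U (\<lambda>y. \<beta> v (g y))"
  unfolding bilinear_map_def using linear_map_comp[of W U "\<beta> v" Y g] by blast

lemma bilinear_map_closed:
  "bilinear_map V W U \<beta> \<Longrightarrow> v \<in> carrier V \<Longrightarrow> w \<in> carrier W \<Longrightarrow> \<beta> v w \<in> carrier U"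
  by (simp add: bilinear_map_def linear_map_def)

lemma bilinear_map_scale_left:
  "bilinear_map V W U \<beta> \<Longrightarrow> v \<in> carrier V \<Longrightarrow> w \<in> carrier W \<Longrightarrow> \<beta> (c \<star>\<^bsub>V\<^esub> v) w = c \<star>\<^bsub>U\<^esub> \<beta> v w"
  by (simp add: bilinear_map_def linear_map_def)

lemma bilinear_map_scale_right:
  "bilinear_map V W U \<beta> \<Longrightarrow> v \<in> carrier V \<Longrightarrow> w \<in> carrier W \<Longrightarrow> \<beta> v (c \<star>\<^bsub>W\<^esub> w) = c \<star>\<^bsub>U\<^esub> \<beta> v w"
  by (simp add: bilinear_map_def linear_map_def)

lemma bilinear_map_comp_linear:
  assumes "bilinear_map V W U \<beta>" "linear_map U U' h"
  shows "bilinear_map V W U' (\<lambda>v w. h (\<beta> v w))"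
  using assms by (simp add: bilinear_map_def linear_map_def)

lemma bilinear_map_pre:
  assumes "bilinear_map V W U \<beta>" "linear_map V' V f" "linear_map W' W g"
  shows "bilinear_map V' W' U (\<lambda>v w. \<beta> (f v) (g w))"
  using assms by (simp add: bilinear_map_def linear_map_def)

lemma bilinear_map_scal:
  assumes "vspace U"
  shows "bilinear_map ground U U (scal U)"
  unfolding bilinear_map_def linear_map_def using assms
  by (simp add: ground_def vspace_scale vspace_scale_add vspace_scale_add_left vspace_scale_scale
      mult.commute)

lemma bilinear_map_times: "bilinear_map ground ground ground (*)"
  using bilinear_map_scal[OF vspace_ground] by (simp add: ground_def)

lemma carrier_ground: "carrier ground = UNIV"
  by (simp add: ground_def)

text \<open>A single decomposition of \<open>t\<close> into pure tensors serves all parameters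
  \<open>y\<close> at once and turns the family into a finite sum of linear maps. This yields
  linearity of a nested Sweedler sum in the variables of its body.\<close>

lemma tlift_bilinear_par:
  assumes V: "vspace V" and W: "vspace W" and U: "vspace U"
    and f: "\<And>y. y \<in> carrier Y \<Longrightarrow> bilinear_map V W U (f y)"
    and lin: "\<And>v w. v \<in> carrier V \<Longrightarrow> w \<in> carrier W \<Longrightarrow> linear_map Y U (\<lambda>y. f y v w)"
    and Y: "vspace Y"
    and t: "t \<in> carrier (tensor V W)"
  shows "linear_map Y U (\<lambda>y. tlift V W (f y) t)"
proof -
  obtain n :: nat and v w where r: "\<forall>i<n. v i \<in> carrier V \<and> w i \<in> carrier W"
      "t = (\<Sum>i<n. v i \<otimes>\<^bsub>V,W\<^esub> w i)"
    using tensor_repr[OF V t] by blast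
  have "linear_map Y U (\<lambda>y. \<Sum>i<n. f y (v i) (w i))"
    using r(1) by (intro linear_map_sums[OF U] lin) auto
  then show ?thesis
    by (rule linear_map_cong[rotated 2]) (simp_all add: r(2) tlift_sum[OF V W U f r(1)] Y)
qed

text \<open>\<open>tlift\<close> is a definite description that sees \<open>f\<close> only at
  arguments in the carriers, so arbitrary \<open>f\<close>, \<open>g\<close> and \<open>t\<close>
  are allowed: rewriting under \<open>tlift\<close> creates no linearity obligations.\<close>

lemma tlift_cong:
  assumes "\<And>v w. v \<in> carrier V \<Longrightarrow> w \<in> carrier W \<Longrightarrow> f v w = g v w"
  shows "tlift V W f t = tlift V W g t"
proof -
  have "(\<exists>(n::nat) v w. (\<forall>i<n. v i \<in> carrier V \<and> w i \<in> carrier W) \<and>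
       t = (\<Sum>i<n. v i \<otimes>\<^bsub>V,W\<^esub> w i) \<and> u = (\<Sum>i<n. f (v i) (w i))) \<longleftrightarrow>
     (\<exists>(n::nat) v w. (\<forall>i<n. v i \<in> carrier V \<and> w i \<in> carrier W) \<and>
       t = (\<Sum>i<n. v i \<otimes>\<^bsub>V,W\<^esub> w i) \<and> u = (\<Sum>i<n. g (v i) (w i)))" for u
    using assms by (intro ex_cong1 conj_cong refl arg_cong[where f = "\<lambda>s. u = s"] sum.cong) auto
  then show ?thesis by (simp add: tlift_def)
qed

lemma linear_eq_on_tensor:
  assumes V: "vspace V"
    and f: "linear_map (tensor V W) U f" and g: "linear_map (tensor V W) U g"
    and eq: "\<And>v w. v \<in> carrier V \<Longrightarrow> w \<in> carrier W \<Longrightarrow> f (v \<otimes>\<^bsub>V,W\<^esub> w) = g (v \<otimes>\<^bsub>V,W\<^esub> w)"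
    and t: "t \<in> carrier (tensor V W)"
  shows "f t = g t"
proof -
  obtain n :: nat and v w where r: "\<forall>i<n. v i \<in> carrier V \<and> w i \<in> carrier W"
      "t = (\<Sum>i<n. v i \<otimes>\<^bsub>V,W\<^esub> w i)"
    using tensor_repr[OF V t] by blast
  have c: "\<And>i. i \<in> {..<n} \<Longrightarrow> v i \<otimes>\<^bsub>V,W\<^esub> w i \<in> carrier (tensor V W)"
    using r(1) by (simp add: ptensor_closed)
  have "f t = (\<Sum>i<n. f (v i \<otimes>\<^bsub>V,W\<^esub> w i))"
    unfolding r(2) by (rule linear_map_sum[OF vspace_tensor f]) (rule c)
  also have "\<dots> = (\<Sum>i<n. g (v i \<otimes>\<^bsub>V,W\<^esub> w i))"
    using r(1) by (intro sum.cong) (simp_all add: eq)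
  also have "\<dots> = g t"
    unfolding r(2) by (rule linear_map_sum[OF vspace_tensor g, symmetric]) (rule c)
  finally show ?thesis .
qed

section \<open>Sweedler calculus in a coalgebra\<close>

text \<open>Split off from \<open>hopf_algebra\<close> because the test coalgebras are tensor
  products for which no multiplication is set up. They inhabit the record type \<open>hopf\<close>
  all the same, so that \<open>sweedler\<close> applies to them.\<close>

locale coalgebra =
  fixes X :: "('k::field_char_0, 'a::ab_group_add) hopf" (structure)
  assumes vs: "vspace X"
    and comult_linear: "linear_map X (tensor X X) (comult X)"
    and counit_linear: "linear_map X ground (counit X)"
    and coassoc: "x \<in> carrier X \<Longrightarrow>
          sweedler X x (\<lambda>y x\<^sub>3. sweedler X y (\<lambda>x\<^sub>1 x\<^sub>2.
            x\<^sub>1 \<otimes>\<^bsub>X,tensor X X\<^esub> (x\<^sub>2 \<otimes>\<^bsub>X,X\<^esub> x\<^sub>3))) =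
          sweedler X x (\<lambda>x\<^sub>1 y. sweedler X y (\<lambda>x\<^sub>2 x\<^sub>3.
            x\<^sub>1 \<otimes>\<^bsub>X,tensor X X\<^esub> (x\<^sub>2 \<otimes>\<^bsub>X,X\<^esub> x\<^sub>3)))"
    and counit_left: "x \<in> carrier X \<Longrightarrow> sweedler X x (\<lambda>x\<^sub>1 x\<^sub>2. counit X x\<^sub>1 \<star> x\<^sub>2) = x"
    and counit_right: "x \<in> carrier X \<Longrightarrow> sweedler X x (\<lambda>x\<^sub>1 x\<^sub>2. counit X x\<^sub>2 \<star> x\<^sub>1) = x"

locale cocommutative_coalgebra = coalgebra +
  assumes cocommutative: "x \<in> carrier X \<Longrightarrow>
    comult X x = sweedler X x (\<lambda>x\<^sub>1 x\<^sub>2. x\<^sub>2 \<otimes>\<^bsub>X,X\<^esub> x\<^sub>1)"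

lemma sweedler_cong:
  assumes "\<And>x y. x \<in> carrier X \<Longrightarrow> y \<in> carrier X \<Longrightarrow> f x y = g x y"
  shows "sweedler X z f = sweedler X z g"
  unfolding sweedler_def by (rule tlift_cong) (rule assms)

context coalgebra begin

lemma comult_repr:
  assumes "z \<in> carrier X"
  obtains n :: nat and v w where
    "\<forall>i<n. v i \<in> carrier X \<and> w i \<in> carrier X" "comult X z = (\<Sum>i<n. v i \<otimes>\<^bsub>X,X\<^esub> w i)"
  using tensor_repr[OF vs linear_map_closed[OF comult_linear assms]] by blast

lemma sweedler_sum:
  assumes "vspace U" "bilinear_map X X U f"
    and "\<forall>i<(n::nat). v i \<in> carrier X \<and> w i \<in> carrier X" "comult X z = (\<Sum>i<n. v i \<otimes>\<^bsub>X,X\<^esub> w i)"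
  shows "sweedler X z f = (\<Sum>i<n. f (v i) (w i))"
  unfolding sweedler_def assms(4) by (rule tlift_sum[OF vs vs assms(1-3)])

text \<open>Together with \<open>sweedler_linear_par\<close> this settles linearity of nested
  Sweedler sums: here the variable sits in the element being split, there it sits in the
  body.\<close>

lemma sweedler_linear:
  assumes "vspace U" "bilinear_map X X U f" "linear_map Y X g"
  shows "linear_map Y U (\<lambda>y. sweedler X (g y) f)"
  unfolding sweedler_def
  by (rule linear_map_comp[OF linear_map_comp[OF tlift_linear[OF vs vs assms(1,2)] comult_linear] assms(3)])

lemma sweedler_closed:
  assumes "vspace U" "bilinear_map X X U f" "z \<in> carrier X"
  shows "sweedler X z f \<in> carrier U"
  using linear_map_closed[OF sweedler_linear[OF assms(1,2) linear_map_ident] assms(3)] .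

lemma sweedler_linear_par:
  assumes "vspace U" "vspace Y" "z \<in> carrier X"
    and "\<And>y. y \<in> carrier Y \<Longrightarrow> bilinear_map X X U (f y)"
    and "\<And>x\<^sub>1 x\<^sub>2. x\<^sub>1 \<in> carrier X \<Longrightarrow> x\<^sub>2 \<in> carrier X \<Longrightarrow> linear_map Y U (\<lambda>y. f y x\<^sub>1 x\<^sub>2)"
  shows "linear_map Y U (\<lambda>y. sweedler X z (f y))"
  unfolding sweedler_def
  by (rule tlift_bilinear_par[OF vs vs assms(1,4,5,2) linear_map_closed[OF comult_linear assms(3)]])

lemma sweedler_comp_linear:
  assumes U: "vspace U" "vspace U'" and h: "linear_map U U' h" and f: "bilinear_map X X U f"
    and z: "z \<in> carrier X"
  shows "h (sweedler X z f) = sweedler X z (\<lambda>x y. h (f x y))"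
proof -
  obtain n :: nat and v w where r: "\<forall>i<n. v i \<in> carrier X \<and> w i \<in> carrier X"
      "comult X z = (\<Sum>i<n. v i \<otimes>\<^bsub>X,X\<^esub> w i)"
    using comult_repr[OF z] by blast
  show ?thesis
    unfolding sweedler_sum[OF U(1) f r] sweedler_sum[OF U(2) bilinear_map_comp_linear[OF f h] r]
    using r(1) by (intro linear_map_sum[OF U(1) h] bilinear_map_closed[OF f]) auto
qed

lemma sweedler_counit_left:
  assumes U: "vspace U" and f: "linear_map X U f" and z: "z \<in> carrier X"
  shows "sweedler X z (\<lambda>x y. counit X x \<star>\<^bsub>U\<^esub> f y) = f z"
proof -
  have "bilinear_map X X X (\<lambda>x y. counit X x \<star> y)"
    by (rule bilinear_map_pre[OF bilinear_map_scal[OF vs] counit_linear linear_map_ident])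
  from sweedler_comp_linear[OF vs U f this z]
  have "f z = sweedler X z (\<lambda>x y. f (counit X x \<star> y))"
    using counit_left[OF z] by simp
  also have "\<dots> = sweedler X z (\<lambda>x y. counit X x \<star>\<^bsub>U\<^esub> f y)"
    by (rule sweedler_cong) (rule linear_map_scale[OF f])
  finally show ?thesis ..
qed

lemma sweedler_counit_right:
  assumes U: "vspace U" and f: "linear_map X U f" and z: "z \<in> carrier X"
  shows "sweedler X z (\<lambda>x y. counit X y \<star>\<^bsub>U\<^esub> f x) = f z"
proof -
  have "bilinear_map X X X (\<lambda>x y. counit X y \<star> x)"
    using bilinear_map_pre[OF bilinear_map_scal[OF vs] counit_linear linear_map_ident]
    by (simp add: bilinear_map_def)
  from sweedler_comp_linear[OF vs U f this z]
  have "f z = sweedler X z (\<lambda>x y. f (counit X y \<star> x))"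
    using counit_right[OF z] by simp
  also have "\<dots> = sweedler X z (\<lambda>x y. counit X y \<star>\<^bsub>U\<^esub> f x)"
    by (rule sweedler_cong) (rule linear_map_scale[OF f])
  finally show ?thesis ..
qed

text \<open>The axiom \<open>coassoc\<close> speaks only of the universal trilinear map
  \<open>a \<otimes> (b \<otimes> c)\<close>. Every trilinear \<open>F\<close> is this map followed
  by a linear \<open>\<Phi>\<close>, and \<open>\<Phi>\<close> can be pulled through the Sweedler
  sums.\<close>

lemma sweedler_coassoc:
  assumes U: "vspace U"
    and F1: "\<And>b c. b \<in> carrier X \<Longrightarrow> c \<in> carrier X \<Longrightarrow> linear_map X U (\<lambda>a. F a b c)"
    and F2: "\<And>a c. a \<in> carrier X \<Longrightarrow> c \<in> carrier X \<Longrightarrow> linear_map X U (\<lambda>b. F a b c)"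
    and F3: "\<And>a b. a \<in> carrier X \<Longrightarrow> b \<in> carrier X \<Longrightarrow> linear_map X U (\<lambda>c. F a b c)"
    and z: "z \<in> carrier X"
  shows "sweedler X z (\<lambda>y c. sweedler X y (\<lambda>a b. F a b c)) =
    sweedler X z (\<lambda>a y. sweedler X y (\<lambda>b c. F a b c))"
proof -
  let ?XX = "tensor X X" and ?XXX = "tensor X (tensor X X)"
  let ?T = "\<lambda>a b c. a \<otimes>\<^bsub>X,tensor X X\<^esub> (b \<otimes>\<^bsub>X,X\<^esub> c)"
  define \<Phi> where "\<Phi> = tlift X ?XX (\<lambda>a t. tlift X X (F a) t)"
  note vs' = vs vspace_tensor[of X X] vspace_tensor[of X ?XX]
  have bF: "bilinear_map X X U (F a)" if "a \<in> carrier X" for a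
    by (rule bilinear_mapI[OF F3[OF that] F2[OF that]])
  have b: "bilinear_map X ?XX U (\<lambda>a t. tlift X X (F a) t)"
    by (rule bilinear_mapI[OF tlift_linear[OF vs vs U bF] tlift_bilinear_par[OF vs vs U bF F1 vs]])
  have \<Phi>: "linear_map ?XXX U \<Phi>"
    unfolding \<Phi>_def by (rule tlift_linear[OF vs vs'(2) U b])
  have \<Phi>T: "\<Phi> (?T a b c) = F a b c" if "a \<in> carrier X" "b \<in> carrier X" "c \<in> carrier X" for a b c
    using that by (simp add: \<Phi>_def tlift_ptensor[OF vs vs'(2) U b] ptensor_closed
        tlift_ptensor[OF vs vs U bF])
  \<comment> \<open>Backward chaining with these rules proves multilinearity of a nested expression
    from its outermost operation inwards. Similar collections recur below as \<open>R\<close>,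
    \<open>L\<close> and \<open>RT\<close>.\<close>
  note T = bilinear_map_right[OF ptensor_bilinear bilinear_map_left[OF ptensor_bilinear]]
    bilinear_map_right[OF ptensor_bilinear bilinear_map_right[OF ptensor_bilinear]]
    bilinear_map_left[OF ptensor_bilinear] ptensor_closed linear_map_ident bilinear_mapI
    sweedler_linear[OF vspace_tensor] sweedler_linear_par[OF vspace_tensor vs]
  have "\<Phi> (sweedler X z (\<lambda>y c. sweedler X y (\<lambda>a b. ?T a b c))) =
      sweedler X z (\<lambda>y c. \<Phi> (sweedler X y (\<lambda>a b. ?T a b c)))"
    by (rule sweedler_comp_linear[OF vs'(3) U \<Phi> _ z]) (assumption | rule T)+
  also have "\<dots> = sweedler X z (\<lambda>y c. sweedler X y (\<lambda>a b. F a b c))"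
  proof (rule sweedler_cong)
    fix y c assume yc: "y \<in> carrier X" "c \<in> carrier X"
    have "\<Phi> (sweedler X y (\<lambda>a b. ?T a b c)) = sweedler X y (\<lambda>a b. \<Phi> (?T a b c))"
      using yc by - (rule sweedler_comp_linear[OF vs'(3) U \<Phi>]; (assumption | rule T)+)
    also have "\<dots> = sweedler X y (\<lambda>a b. F a b c)"
      by (rule sweedler_cong) (simp add: \<Phi>T yc)
    finally show "\<Phi> (sweedler X y (\<lambda>a b. ?T a b c)) = \<dots>" .
  qed
  finally have 1: "\<Phi> (sweedler X z (\<lambda>y c. sweedler X y (\<lambda>a b. ?T a b c))) =
    sweedler X z (\<lambda>y c. sweedler X y (\<lambda>a b. F a b c))" .
  have "\<Phi> (sweedler X z (\<lambda>a y. sweedler X y (\<lambda>b c. ?T a b c))) =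
      sweedler X z (\<lambda>a y. \<Phi> (sweedler X y (\<lambda>b c. ?T a b c)))"
    by (rule sweedler_comp_linear[OF vs'(3) U \<Phi> _ z]) (assumption | rule T)+
  also have "\<dots> = sweedler X z (\<lambda>a y. sweedler X y (\<lambda>b c. F a b c))"
  proof (rule sweedler_cong)
    fix a y assume ay: "a \<in> carrier X" "y \<in> carrier X"
    have "\<Phi> (sweedler X y (\<lambda>b c. ?T a b c)) = sweedler X y (\<lambda>b c. \<Phi> (?T a b c))"
      using ay by - (rule sweedler_comp_linear[OF vs'(3) U \<Phi>]; (assumption | rule T)+)
    also have "\<dots> = sweedler X y (\<lambda>b c. F a b c)"
      by (rule sweedler_cong) (simp add: \<Phi>T ay)
    finally show "\<Phi> (sweedler X y (\<lambda>b c. ?T a b c)) = \<dots>" .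
  qed
  finally show ?thesis
    using 1 coassoc[OF z] by simp
qed

text \<open>Once decompositions of \<open>comult X x\<close> and \<open>comult Y y\<close> are
  fixed, both sides are the same double finite sum.\<close>

lemma sweedler_fubini:
  assumes "coalgebra Y" and U: "vspace U"
    and f: "\<And>a b. a \<in> carrier X \<Longrightarrow> b \<in> carrier X \<Longrightarrow> bilinear_map Y Y U (\<lambda>c d. F a b c d)"
    and g: "\<And>c d. c \<in> carrier Y \<Longrightarrow> d \<in> carrier Y \<Longrightarrow> bilinear_map X X U (\<lambda>a b. F a b c d)"
    and x: "x \<in> carrier X" and y: "y \<in> carrier Y"
  shows "sweedler X x (\<lambda>a b. sweedler Y y (\<lambda>c d. F a b c d)) =
    sweedler Y y (\<lambda>c d. sweedler X x (\<lambda>a b. F a b c d))"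
proof -
  interpret Y: coalgebra Y by fact
  obtain n :: nat and v w where r: "\<forall>i<n. v i \<in> carrier X \<and> w i \<in> carrier X"
      "comult X x = (\<Sum>i<n. v i \<otimes>\<^bsub>X,X\<^esub> w i)"
    using comult_repr[OF x] by blast
  obtain m :: nat and v' w' where r': "\<forall>i<m. v' i \<in> carrier Y \<and> w' i \<in> carrier Y"
      "comult Y y = (\<Sum>i<m. v' i \<otimes>\<^bsub>Y,Y\<^esub> w' i)"
    using Y.comult_repr[OF y] by blast
  have L: "sweedler Y y (\<lambda>c d. F a b c d) = (\<Sum>j<m. F a b (v' j) (w' j))"
    if "a \<in> carrier X" "b \<in> carrier X" for a b
    using Y.sweedler_sum[OF U f[OF that] r'] .
  have R: "sweedler X x (\<lambda>a b. F a b c d) = (\<Sum>i<n. F (v i) (w i) c d)"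
    if "c \<in> carrier Y" "d \<in> carrier Y" for c d
    using sweedler_sum[OF U g[OF that] r] .
  have bL: "bilinear_map X X U (\<lambda>a b. \<Sum>j<m. F a b (v' j) (w' j))"
    using r'(1) g by (intro bilinear_mapI linear_map_sums[OF U])
      (auto simp: bilinear_map_def)
  have bR: "bilinear_map Y Y U (\<lambda>c d. \<Sum>i<n. F (v i) (w i) c d)"
    using r(1) f by (intro bilinear_mapI linear_map_sums[OF U])
      (auto simp: bilinear_map_def)
  have "sweedler X x (\<lambda>a b. sweedler Y y (\<lambda>c d. F a b c d)) =
      sweedler X x (\<lambda>a b. \<Sum>j<m. F a b (v' j) (w' j))"
    by (rule sweedler_cong) (rule L)
  also have "\<dots> = (\<Sum>i<n. \<Sum>j<m. F (v i) (w i) (v' j) (w' j))"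
    by (rule sweedler_sum[OF U bL r])
  also have "\<dots> = (\<Sum>j<m. \<Sum>i<n. F (v i) (w i) (v' j) (w' j))"
    by (rule sum.swap)
  also have "\<dots> = sweedler Y y (\<lambda>c d. \<Sum>i<n. F (v i) (w i) c d)"
    by (rule Y.sweedler_sum[OF U bR r', symmetric])
  also have "\<dots> = sweedler Y y (\<lambda>c d. sweedler X x (\<lambda>a b. F a b c d))"
    by (rule sweedler_cong) (simp add: R)
  finally show ?thesis .
qed

text \<open>Two bracketings of the fourfold comultiplication. On the right, \<open>b\<close> and
  \<open>c\<close> are the two halves of one element \<open>m\<close>, so that laws about two
  neighbours apply to the middle factors.\<close>

lemma sweedler_quad:
  assumes U: "vspace U"
    and F1: "\<And>b c d. b \<in> carrier X \<Longrightarrow> c \<in> carrier X \<Longrightarrow> d \<in> carrier X \<Longrightarrow> linear_map X U (\<lambda>a. F a b c d)"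
    and F2: "\<And>a c d. a \<in> carrier X \<Longrightarrow> c \<in> carrier X \<Longrightarrow> d \<in> carrier X \<Longrightarrow> linear_map X U (\<lambda>b. F a b c d)"
    and F3: "\<And>a b d. a \<in> carrier X \<Longrightarrow> b \<in> carrier X \<Longrightarrow> d \<in> carrier X \<Longrightarrow> linear_map X U (\<lambda>c. F a b c d)"
    and F4: "\<And>a b c. a \<in> carrier X \<Longrightarrow> b \<in> carrier X \<Longrightarrow> c \<in> carrier X \<Longrightarrow> linear_map X U (\<lambda>d. F a b c d)"
    and z: "z \<in> carrier X"
  shows "sweedler X z (\<lambda>p q. sweedler X p (\<lambda>a b. sweedler X q (\<lambda>c d. F a b c d))) =
    sweedler X z (\<lambda>a r. sweedler X r (\<lambda>m d. sweedler X m (\<lambda>b c. F a b c d)))"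
proof -
  note T = F1 F2 F3 F4 bilinear_mapI sweedler_linear[OF U _ linear_map_ident] sweedler_linear_par[OF U vs]
  have "sweedler X z (\<lambda>p q. sweedler X p (\<lambda>a b. sweedler X q (\<lambda>c d. F a b c d))) =
    sweedler X z (\<lambda>a r. sweedler X r (\<lambda>b q. sweedler X q (\<lambda>c d. F a b c d)))"
    by (rule sweedler_coassoc[OF U _ _ _ z]) (assumption | rule T)+
  also have "\<dots> = sweedler X z (\<lambda>a r. sweedler X r (\<lambda>m d. sweedler X m (\<lambda>b c. F a b c d)))"
    by (rule sweedler_cong, rule sweedler_coassoc[OF U, symmetric]) (assumption | rule T)+
  finally show ?thesis .
qed

end

text \<open>The axiom \<open>cocommutative\<close> is the case of the universal pairing; applying
  \<open>tlift X X f\<close> to both of its sides gives every other pairing.\<close>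

lemma (in cocommutative_coalgebra) sweedler_commute:
  assumes U: "vspace U" and f: "bilinear_map X X U f" and z: "z \<in> carrier X"
  shows "sweedler X z f = sweedler X z (\<lambda>x y. f y x)"
proof -
  have b: "bilinear_map X X (tensor X X) (\<lambda>x y. y \<otimes>\<^bsub>X,X\<^esub> x)"
    using ptensor_bilinear[of X X] by (simp add: bilinear_map_def)
  have "sweedler X z f = tlift X X f (sweedler X z (\<lambda>x y. y \<otimes>\<^bsub>X,X\<^esub> x))"
    using cocommutative[OF z] by (simp add: sweedler_def)
  also have "\<dots> = sweedler X z (\<lambda>x y. tlift X X f (y \<otimes>\<^bsub>X,X\<^esub> x))"
    by (rule sweedler_comp_linear[OF vspace_tensor U tlift_linear[OF vs vs U f] b z])
  also have "\<dots> = sweedler X z (\<lambda>x y. f y x)"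
    by (rule sweedler_cong) (rule tlift_ptensor[OF vs vs U f])
  finally show ?thesis .
qed

text \<open>\<open>sweedler_quad\<close> brings the two middle factors into a single
  comultiplication, where they may be exchanged. This is the reordering needed whenever a product of
  two points is comultiplied.\<close>

lemma (in cocommutative_coalgebra) sweedler_interchange:
  assumes U: "vspace U"
    and F1: "\<And>b c d. b \<in> carrier X \<Longrightarrow> c \<in> carrier X \<Longrightarrow> d \<in> carrier X \<Longrightarrow> linear_map X U (\<lambda>a. F a b c d)"
    and F2: "\<And>a c d. a \<in> carrier X \<Longrightarrow> c \<in> carrier X \<Longrightarrow> d \<in> carrier X \<Longrightarrow> linear_map X U (\<lambda>b. F a b c d)"
    and F3: "\<And>a b d. a \<in> carrier X \<Longrightarrow> b \<in> carrier X \<Longrightarrow> d \<in> carrier X \<Longrightarrow> linear_map X U (\<lambda>c. F a b c d)"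
    and F4: "\<And>a b c. a \<in> carrier X \<Longrightarrow> b \<in> carrier X \<Longrightarrow> c \<in> carrier X \<Longrightarrow> linear_map X U (\<lambda>d. F a b c d)"
    and z: "z \<in> carrier X"
  shows "sweedler X z (\<lambda>p q. sweedler X p (\<lambda>a b. sweedler X q (\<lambda>c d. F a b c d))) =
    sweedler X z (\<lambda>p q. sweedler X p (\<lambda>a b. sweedler X q (\<lambda>c d. F a c b d)))"
proof -
  have "sweedler X z (\<lambda>p q. sweedler X p (\<lambda>a b. sweedler X q (\<lambda>c d. F a b c d))) =
      sweedler X z (\<lambda>a r. sweedler X r (\<lambda>m d. sweedler X m (\<lambda>b c. F a b c d)))"
    by (rule sweedler_quad[OF U _ _ _ _ z]) (assumption | rule F1 F2 F3 F4)+
  also have "\<dots> = sweedler X z (\<lambda>a r. sweedler X r (\<lambda>m d. sweedler X m (\<lambda>b c. F a c b d)))"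
    by (rule sweedler_cong, rule sweedler_cong, rule sweedler_commute[OF U bilinear_mapI])
      (assumption | rule F1 F2 F3 F4)+
  also have "\<dots> = sweedler X z (\<lambda>p q. sweedler X p (\<lambda>a b. sweedler X q (\<lambda>c d. F a c b d)))"
    by (rule sweedler_quad[OF U _ _ _ _ z, symmetric]) (assumption | rule F1 F2 F3 F4)+
  finally show ?thesis .
qed

section \<open>Convolution and points of coalgebras\<close>

text \<open>
  Maps are required to vanish outside the carrier, so that maps agreeing on the carrier are equal.
\<close>

definition linear_hom ::
  "('k::field_char_0, 'a::ab_group_add, 'm) vspace_scheme \<Rightarrow>
   ('k, 'b::ab_group_add, 'n) vspace_scheme \<Rightarrow> ('a \<Rightarrow> 'b) set" where
  "linear_hom V W = {f. linear_map V W f \<and> (\<forall>z. z \<notin> carrier V \<longrightarrow> f z = 0)}"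

definition points ::
  "('k::field_char_0, 'a::ab_group_add) hopf \<Rightarrow> ('k, 'b::ab_group_add) hopf \<Rightarrow> ('a \<Rightarrow> 'b) set" where
  "points X V = {f. coalgebra_map X V f \<and> (\<forall>z. z \<notin> carrier X \<longrightarrow> f z = 0)}"

text \<open>The pairing \<open>\<beta>\<close> is arbitrary rather than a multiplication, so that
  products, module actions and the formation of pure tensors are all instances and their mixed laws
  can be treated uniformly.\<close>

definition conv ::
  "('k::field_char_0, 'x::ab_group_add) hopf \<Rightarrow> ('a \<Rightarrow> 'b \<Rightarrow> 'c::ab_group_add) \<Rightarrow>
   ('x \<Rightarrow> 'a) \<Rightarrow> ('x \<Rightarrow> 'b) \<Rightarrow> 'x \<Rightarrow> 'c" where
  "conv X \<beta> f g z = (if z \<in> carrier X then sweedler X z (\<lambda>x y. \<beta> (f x) (g y)) else 0)"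

definition conv_unit ::
  "('k::field_char_0, 'x::ab_group_add) hopf \<Rightarrow> ('k, 'a::ab_group_add) hopf \<Rightarrow> 'x \<Rightarrow> 'a" where
  "conv_unit X V z = (if z \<in> carrier X then counit X z \<star>\<^bsub>V\<^esub> \<one>\<^bsub>V\<^esub> else 0)"

definition ident :: "('k::field_char_0, 'a::ab_group_add) hopf \<Rightarrow> 'a \<Rightarrow> 'a" where
  "ident X z = (if z \<in> carrier X then z else 0)"

text \<open>The condition that the linear map on \<open>V \<otimes> W\<close> induced by
  \<open>\<beta>\<close> be a coalgebra map, expressed on pure tensors so that no coalgebra
  structure on the tensor product has to be chosen.\<close>

definition bilinear_coalgebra_map ::
  "('k::field_char_0, 'a::ab_group_add) hopf \<Rightarrow> ('k, 'b::ab_group_add) hopf \<Rightarrow>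
   ('k, 'c::ab_group_add) hopf \<Rightarrow> ('a \<Rightarrow> 'b \<Rightarrow> 'c) \<Rightarrow> bool" where
  "bilinear_coalgebra_map V W U \<beta> \<longleftrightarrow> bilinear_map V W U \<beta> \<and>
     (\<forall>v\<in>carrier V. \<forall>w\<in>carrier W.
        comult U (\<beta> v w) = sweedler V v (\<lambda>v\<^sub>1 v\<^sub>2. sweedler W w (\<lambda>w\<^sub>1 w\<^sub>2.
          \<beta> v\<^sub>1 w\<^sub>1 \<otimes>\<^bsub>U,U\<^esub> \<beta> v\<^sub>2 w\<^sub>2)) \<and>
        counit U (\<beta> v w) = counit V v * counit W w)"

lemma linear_homD: "f \<in> linear_hom V W \<Longrightarrow> linear_map V W f"
  by (simp add: linear_hom_def)

lemma linear_hom_outside: "f \<in> linear_hom V W \<Longrightarrow> z \<notin> carrier V \<Longrightarrow> f z = 0"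
  by (simp add: linear_hom_def)

lemma linear_hom_eqI:
  assumes "f \<in> linear_hom V W" "g \<in> linear_hom V W" "\<And>z. z \<in> carrier V \<Longrightarrow> f z = g z"
  shows "f = g"
  using assms by (force simp: linear_hom_def)

lemma linear_hom_comp:
  assumes "vspace V" "linear_map V W h" "f \<in> linear_hom Y V"
  shows "(\<lambda>z. h (f z)) \<in> linear_hom Y W"
  using assms linear_map_comp[OF assms(2), of Y f] linear_map_zero[OF assms(1,2)]
  by (simp add: linear_hom_def)

lemma points_linear_hom: "f \<in> points X V \<Longrightarrow> f \<in> linear_hom X V"
  by (simp add: points_def linear_hom_def coalgebra_map_def)

lemma points_linear: "f \<in> points X V \<Longrightarrow> linear_map X V f"
  by (simp add: points_def coalgebra_map_def)

lemma points_coalgebra_map: "f \<in> points X V \<Longrightarrow> coalgebra_map X V f"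
  by (simp add: points_def)

lemma coalgebra_map_counit: "coalgebra_map X V f \<Longrightarrow> z \<in> carrier X \<Longrightarrow> counit V (f z) = counit X z"
  by (simp add: coalgebra_map_def)

lemma coalgebra_map_linear: "coalgebra_map X V f \<Longrightarrow> linear_map X V f"
  by (simp add: coalgebra_map_def)

lemma ident_apply: "z \<in> carrier X \<Longrightarrow> ident X z = z"
  by (simp add: ident_def)

lemma conv_apply: "z \<in> carrier X \<Longrightarrow> conv X \<beta> f g z = sweedler X z (\<lambda>x y. \<beta> (f x) (g y))"
  by (simp add: conv_def)

lemma conv_cong:
  assumes "\<And>x y. x \<in> carrier X \<Longrightarrow> y \<in> carrier X \<Longrightarrow> \<beta> (f x) (g y) = \<beta>' (f' x) (g' y)"
  shows "conv X \<beta> f g = conv X \<beta>' f' g'"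
  unfolding conv_def using sweedler_cong[of X "\<lambda>x y. \<beta> (f x) (g y)" "\<lambda>x y. \<beta>' (f' x) (g' y)", OF assms]
  by (auto simp: fun_eq_iff)

lemma bilinear_coalgebra_mapD: "bilinear_coalgebra_map V W U \<beta> \<Longrightarrow> bilinear_map V W U \<beta>"
  by (simp add: bilinear_coalgebra_map_def)

lemma coalgebra_map_cong:
  assumes "vspace X" "coalgebra_map X Y f" and eq: "\<And>x. x \<in> carrier X \<Longrightarrow> f x = g x"
  shows "coalgebra_map X Y g"
proof -
  have "sweedler X z (\<lambda>x y. f x \<otimes>\<^bsub>Y,Y\<^esub> f y) = sweedler X z (\<lambda>x y. g x \<otimes>\<^bsub>Y,Y\<^esub> g y)" for z
    by (rule sweedler_cong) (simp add: eq)
  then show ?thesis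
    using assms(2) linear_map_cong[of X f g Y, OF eq assms(1)] by (simp add: coalgebra_map_def eq)
qed

section \<open>Convolution of linear maps\<close>

context coalgebra begin

lemma ident_linear_hom: "ident X \<in> linear_hom X X"
  unfolding linear_hom_def ident_def using vs
  by (auto intro!: linear_mapI simp: vspace_add vspace_scale)

lemma conv_bilinear:
  assumes "bilinear_map V W U \<beta>" "linear_map X V f" "linear_map X W g"
  shows "bilinear_map X X U (\<lambda>x y. \<beta> (f x) (g y))"
  by (rule bilinear_map_pre[OF assms])

lemma conv_linear_hom:
  assumes U: "vspace U" and b: "bilinear_map V W U \<beta>" "linear_map X V f" "linear_map X W g"
  shows "conv X \<beta> f g \<in> linear_hom X U"
proof -
  have "linear_map X U (conv X \<beta> f g)"
    by (rule linear_map_cong[OF _ vs sweedler_linear[OF U conv_bilinear[OF b] linear_map_ident]])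
      (simp add: conv_def)
  then show ?thesis
    by (simp add: linear_hom_def conv_def)
qed

lemma conv_linear:
  "vspace U \<Longrightarrow> bilinear_map V W U \<beta> \<Longrightarrow> linear_map X V f \<Longrightarrow> linear_map X W g \<Longrightarrow>
    linear_map X U (conv X \<beta> f g)"
  by (rule linear_homD[OF conv_linear_hom])

lemma conv_post:
  assumes U: "vspace U" and U': "vspace U'" and b: "bilinear_map V W U \<beta>"
    and h: "linear_map U U' h" and f: "linear_map X V f" and g: "linear_map X W g"
    and eq: "\<And>v w. v \<in> carrier V \<Longrightarrow> w \<in> carrier W \<Longrightarrow> h (\<beta> v w) = \<beta>' (h' v) (h'' w)"
  shows "(\<lambda>z. h (conv X \<beta> f g z)) = conv X \<beta>' (\<lambda>z. h' (f z)) (\<lambda>z. h'' (g z))"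
proof
  fix z
  show "h (conv X \<beta> f g z) = conv X \<beta>' (\<lambda>z. h' (f z)) (\<lambda>z. h'' (g z)) z"
  proof (cases "z \<in> carrier X")
    case True
    have "h (conv X \<beta> f g z) = sweedler X z (\<lambda>x y. h (\<beta> (f x) (g y)))"
      unfolding conv_apply[OF True] by (rule sweedler_comp_linear[OF U U' h conv_bilinear[OF b f g] True])
    also have "\<dots> = conv X \<beta>' (\<lambda>z. h' (f z)) (\<lambda>z. h'' (g z)) z"
      unfolding conv_apply[OF True]
      by (rule sweedler_cong) (simp add: eq linear_map_closed[OF f] linear_map_closed[OF g])
    finally show ?thesis .
  qed (simp add: conv_def linear_map_zero[OF U h])
qed

text \<open>A product of two products in the balanced fourfold form, the shape to which
  \<open>sweedler_quad\<close> and \<open>sweedler_interchange\<close> apply.\<close>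

lemma conv_conv_apply:
  assumes U: "vspace U'" "vspace U''" "vspace U"
    and b: "bilinear_map V W U' \<beta>" "bilinear_map V' W' U'' \<gamma>" "bilinear_map U' U'' U \<delta>"
    and f: "linear_map X V f" and g: "linear_map X W g" and h: "linear_map X V' h" and k: "linear_map X W' k"
    and z: "z \<in> carrier X"
  shows "conv X \<delta> (conv X \<beta> f g) (conv X \<gamma> h k) z =
    sweedler X z (\<lambda>p q. sweedler X p (\<lambda>a b. sweedler X q (\<lambda>c d. \<delta> (\<beta> (f a) (g b)) (\<gamma> (h c) (k d)))))"
  unfolding conv_apply[OF z]
proof (rule sweedler_cong)
  fix p q assume pq: "p \<in> carrier X" "q \<in> carrier X"
  note hb = conv_bilinear[OF b(1) f g] and hc = conv_bilinear[OF b(2) h k]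
  note cl = linear_map_closed[OF f] linear_map_closed[OF g]
  have qc: "conv X \<gamma> h k q \<in> carrier U''"
    by (rule linear_map_closed[OF conv_linear[OF U(2) b(2) h k] pq(2)])
  have "sweedler X p (\<lambda>a b. sweedler X q (\<lambda>c d. \<delta> (\<beta> (f a) (g b)) (\<gamma> (h c) (k d)))) =
      sweedler X p (\<lambda>a b. \<delta> (\<beta> (f a) (g b)) (conv X \<gamma> h k q))"
    unfolding conv_apply[OF pq(2)]
    by (rule sweedler_cong, rule sweedler_comp_linear[OF U(2,3) _ hc pq(2), symmetric])
      (rule bilinear_map_right[OF b(3)] linear_map_ident bilinear_map_closed[OF b(1)] cl | assumption)+
  also have "\<dots> = \<delta> (conv X \<beta> f g p) (conv X \<gamma> h k q)"
    unfolding conv_apply[OF pq(1)]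
    by (rule sweedler_comp_linear[OF U(1,3) bilinear_map_left[OF b(3) linear_map_ident qc] hb pq(1), symmetric])
  finally show "\<delta> (conv X \<beta> f g p) (conv X \<gamma> h k q) =
      sweedler X p (\<lambda>a b. sweedler X q (\<lambda>c d. \<delta> (\<beta> (f a) (g b)) (\<gamma> (h c) (k d))))" by simp
qed

lemma conv_nested_left_apply:
  assumes U: "vspace U" "vspace Q" and b: "bilinear_map V W U \<beta>" "bilinear_map U Z Q \<gamma>"
    and f: "linear_map X V f" and g: "linear_map X W g" and h: "linear_map X Z h" and z: "z \<in> carrier X"
  shows "conv X \<gamma> (conv X \<beta> f g) h z = sweedler X z (\<lambda>p c. sweedler X p (\<lambda>x y. \<gamma> (\<beta> (f x) (g y)) (h c)))"
  unfolding conv_apply[OF z]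
proof (rule sweedler_cong)
  fix p c assume pc: "p \<in> carrier X" "c \<in> carrier X"
  show "\<gamma> (conv X \<beta> f g p) (h c) = sweedler X p (\<lambda>x y. \<gamma> (\<beta> (f x) (g y)) (h c))"
    unfolding conv_apply[OF pc(1)]
    by (rule sweedler_comp_linear[OF U bilinear_map_left[OF b(2) linear_map_ident linear_map_closed[OF h pc(2)]]
          conv_bilinear[OF b(1) f g] pc(1)])
qed

lemma conv_nested_right_apply:
  assumes U: "vspace U" "vspace Q" and b: "bilinear_map W Z U \<beta>" "bilinear_map V U Q \<gamma>"
    and f: "linear_map X V f" and g: "linear_map X W g" and h: "linear_map X Z h" and z: "z \<in> carrier X"
  shows "conv X \<gamma> f (conv X \<beta> g h) z = sweedler X z (\<lambda>x r. sweedler X r (\<lambda>y c. \<gamma> (f x) (\<beta> (g y) (h c))))"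
  unfolding conv_apply[OF z]
proof (rule sweedler_cong)
  fix x r assume xr: "x \<in> carrier X" "r \<in> carrier X"
  show "\<gamma> (f x) (conv X \<beta> g h r) = sweedler X r (\<lambda>y c. \<gamma> (f x) (\<beta> (g y) (h c)))"
    unfolding conv_apply[OF xr(2)]
    by (rule sweedler_comp_linear[OF U bilinear_map_right[OF b(2) linear_map_ident linear_map_closed[OF f xr(1)]]
          conv_bilinear[OF b(1) g h] xr(2)])
qed

text \<open>Rebracketed by coassociativity so that \<open>y\<close> and \<open>c\<close> share the
  inner sum. A law relating just the second and third factor can then be applied inside while the
  first is held fixed; \<open>conv_nested_right_apply'\<close> is the mirror image.\<close>

lemma conv_nested_left_apply':
  assumes U: "vspace U" "vspace Q" and b: "bilinear_map V W U \<beta>" "bilinear_map U Z Q \<gamma>"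
    and f: "linear_map X V f" and g: "linear_map X W g" and h: "linear_map X Z h" and z: "z \<in> carrier X"
  shows "conv X \<gamma> (conv X \<beta> f g) h z = sweedler X z (\<lambda>x r. sweedler X r (\<lambda>y c. \<gamma> (\<beta> (f x) (g y)) (h c)))"
  unfolding conv_nested_left_apply[OF assms]
  by (rule sweedler_coassoc[OF U(2) _ _ _ z])
    (assumption | rule bilinear_map_right[OF b(1)] bilinear_map_left[OF b(1)]
      bilinear_map_right[OF b(2)] bilinear_map_left[OF b(2)] f g h linear_map_closed[OF f]
      linear_map_closed[OF g] linear_map_closed[OF h] bilinear_map_closed[OF b(1)])+

lemma conv_nested_right_apply':
  assumes U: "vspace U" "vspace Q" and b: "bilinear_map W Z U \<beta>" "bilinear_map V U Q \<gamma>"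
    and f: "linear_map X V f" and g: "linear_map X W g" and h: "linear_map X Z h" and z: "z \<in> carrier X"
  shows "conv X \<gamma> f (conv X \<beta> g h) z = sweedler X z (\<lambda>p c. sweedler X p (\<lambda>x y. \<gamma> (f x) (\<beta> (g y) (h c))))"
  unfolding conv_nested_right_apply[OF assms]
  by (rule sweedler_coassoc[OF U(2) _ _ _ z, symmetric])
    (assumption | rule bilinear_map_right[OF b(1)] bilinear_map_left[OF b(1)]
      bilinear_map_right[OF b(2)] bilinear_map_left[OF b(2)] f g h linear_map_closed[OF f]
      linear_map_closed[OF g] linear_map_closed[OF h] bilinear_map_closed[OF b(1)])+

text \<open>All four pairings may differ, so this one statement gives associativity of products, the
  module laws of both actions, and the compatibility of pure tensors with multiplication.\<close>

lemma conv_assoc: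
  assumes U: "vspace U" "vspace U'" "vspace Q"
    and b: "bilinear_map V W U \<beta>" "bilinear_map U Z Q \<gamma>" "bilinear_map V U' Q \<gamma>'" "bilinear_map W Z U' \<beta>'"
    and eq: "\<And>v w z. v \<in> carrier V \<Longrightarrow> w \<in> carrier W \<Longrightarrow> z \<in> carrier Z \<Longrightarrow>
      \<gamma> (\<beta> v w) z = \<gamma>' v (\<beta>' w z)"
    and f: "linear_map X V f" and g: "linear_map X W g" and h: "linear_map X Z h"
  shows "conv X \<gamma> (conv X \<beta> f g) h = conv X \<gamma>' f (conv X \<beta>' g h)"
proof
  fix z
  show "conv X \<gamma> (conv X \<beta> f g) h z = conv X \<gamma>' f (conv X \<beta>' g h) z"
  proof (cases "z \<in> carrier X")
    case z: True
    show ?thesis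
      unfolding conv_nested_left_apply[OF U(1,3) b(1,2) f g h z]
        conv_nested_right_apply'[OF U(2,3) b(4,3) f g h z]
      by (intro sweedler_cong eq linear_map_closed[OF f] linear_map_closed[OF g] linear_map_closed[OF h])
  qed (simp add: conv_def)
qed

text \<open>The left factor plays the role of the constant \<open>v\<close>. With \<open>v\<close>
  the unit of an algebra it is \<open>conv_unit\<close>, and the unit laws of convolution
  follow.\<close>

lemma conv_const_left:
  assumes U: "vspace U" and b: "bilinear_map V W U \<beta>" and v: "v \<in> carrier V" and g: "g \<in> linear_hom X W"
  shows "conv X \<beta> (\<lambda>x. if x \<in> carrier X then counit X x \<star>\<^bsub>V\<^esub> v else 0) g =
    (\<lambda>z. if z \<in> carrier X then \<beta> v (g z) else 0)"
proof
  fix z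
  have "sweedler X z (\<lambda>x y. \<beta> (if x \<in> carrier X then counit X x \<star>\<^bsub>V\<^esub> v else 0) (g y)) = \<beta> v (g z)"
    if z: "z \<in> carrier X"
  proof -
    have "sweedler X z (\<lambda>x y. \<beta> (if x \<in> carrier X then counit X x \<star>\<^bsub>V\<^esub> v else 0) (g y)) =
        sweedler X z (\<lambda>x y. counit X x \<star>\<^bsub>U\<^esub> \<beta> v (g y))"
      by (rule sweedler_cong)
        (simp add: bilinear_map_scale_left[OF b v] linear_map_closed[OF linear_homD[OF g]])
    also have "\<dots> = \<beta> v (g z)"
      by (rule sweedler_counit_left[OF U bilinear_map_right[OF b linear_homD[OF g] v] z])
    finally show ?thesis .
  qed
  then show "conv X \<beta> (\<lambda>x. if x \<in> carrier X then counit X x \<star>\<^bsub>V\<^esub> v else 0) g z =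
      (if z \<in> carrier X then \<beta> v (g z) else 0)"
    by (simp add: conv_def)
qed

lemma conv_const_right:
  assumes U: "vspace U" and b: "bilinear_map V W U \<beta>" and w: "w \<in> carrier W" and f: "f \<in> linear_hom X V"
  shows "conv X \<beta> f (\<lambda>x. if x \<in> carrier X then counit X x \<star>\<^bsub>W\<^esub> w else 0) =
    (\<lambda>z. if z \<in> carrier X then \<beta> (f z) w else 0)"
proof
  fix z
  have "sweedler X z (\<lambda>x y. \<beta> (f x) (if y \<in> carrier X then counit X y \<star>\<^bsub>W\<^esub> w else 0)) = \<beta> (f z) w"
    if z: "z \<in> carrier X"
  proof -
    have "sweedler X z (\<lambda>x y. \<beta> (f x) (if y \<in> carrier X then counit X y \<star>\<^bsub>W\<^esub> w else 0)) =
        sweedler X z (\<lambda>x y. counit X y \<star>\<^bsub>U\<^esub> \<beta> (f x) w)"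
      by (rule sweedler_cong)
        (simp add: bilinear_map_scale_right[OF b _ w] linear_map_closed[OF linear_homD[OF f]])
    also have "\<dots> = \<beta> (f z) w"
      by (rule sweedler_counit_right[OF U bilinear_map_left[OF b linear_homD[OF f] w] z])
    finally show ?thesis .
  qed
  then show "conv X \<beta> f (\<lambda>x. if x \<in> carrier X then counit X x \<star>\<^bsub>W\<^esub> w else 0) z =
      (if z \<in> carrier X then \<beta> (f z) w else 0)"
    by (simp add: conv_def)
qed

lemma conv_unit_eq: "conv_unit X V = (\<lambda>x. if x \<in> carrier X then counit X x \<star>\<^bsub>V\<^esub> \<one>\<^bsub>V\<^esub> else 0)"
  by (simp add: conv_unit_def fun_eq_iff)

section \<open>Composition with coalgebra maps\<close>

lemma coalgebra_map_sweedler: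
  assumes Y: "coalgebra Y" and f: "coalgebra_map X Y f" and U: "vspace U" and b: "bilinear_map Y Y U F"
    and z: "z \<in> carrier X"
  shows "sweedler Y (f z) F = sweedler X z (\<lambda>x y. F (f x) (f y))"
proof -
  interpret Y: coalgebra Y by fact
  note lf = coalgebra_map_linear[OF f]
  have "sweedler Y (f z) F = tlift Y Y F (sweedler X z (\<lambda>x y. f x \<otimes>\<^bsub>Y,Y\<^esub> f y))"
    using f z by (simp add: sweedler_def coalgebra_map_def)
  also have "\<dots> = sweedler X z (\<lambda>x y. tlift Y Y F (f x \<otimes>\<^bsub>Y,Y\<^esub> f y))"
    by (rule sweedler_comp_linear[OF vspace_tensor U tlift_linear[OF Y.vs Y.vs U b]
          conv_bilinear[OF ptensor_bilinear lf lf] z])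
  also have "\<dots> = sweedler X z (\<lambda>x y. F (f x) (f y))"
    by (rule sweedler_cong)
      (simp add: tlift_ptensor[OF Y.vs Y.vs U b] linear_map_closed[OF lf])
  finally show ?thesis .
qed

lemma conv_pre:
  assumes Y: "coalgebra Y" and p: "p \<in> points X Y" and U: "vspace U" and b: "bilinear_map V W U \<beta>"
    and f: "linear_map Y V f" and g: "linear_map Y W g"
  shows "(\<lambda>z. conv Y \<beta> f g (p z)) = conv X \<beta> (\<lambda>z. f (p z)) (\<lambda>z. g (p z))"
proof
  fix z
  interpret Y: coalgebra Y by fact
  show "conv Y \<beta> f g (p z) = conv X \<beta> (\<lambda>z. f (p z)) (\<lambda>z. g (p z)) z"
  proof (cases "z \<in> carrier X")
    case True
    then show ?thesis
      using coalgebra_map_sweedler[OF Y points_coalgebra_map[OF p] U Y.conv_bilinear[OF b f g] True]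
      by (simp add: conv_apply linear_map_closed[OF points_linear[OF p]])
  next
    case False
    \<comment> \<open>Outside the carrier the right side is 0 by definition, and the left side is a
      linear map evaluated at 0.\<close>
    then have "p z = 0" by (rule linear_hom_outside[OF points_linear_hom[OF p]])
    then show ?thesis
      using False linear_map_zero[OF Y.vs Y.conv_linear[OF U b f g]] by (simp add: conv_def)
  qed
qed

lemma points_comp:
  assumes Y: "coalgebra Y" and p: "p \<in> points X Y" and Z: "coalgebra Z" and h: "coalgebra_map Y Z h"
  shows "(\<lambda>z. h (p z)) \<in> points X Z"
proof -
  interpret Y: coalgebra Y by fact
  interpret Z: coalgebra Z by fact
  have lin: "(\<lambda>z. h (p z)) \<in> linear_hom X Z"
    by (rule linear_hom_comp[OF Y.vs coalgebra_map_linear[OF h] points_linear_hom[OF p]])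
  note lh = coalgebra_map_linear[OF h] and lp = points_linear[OF p]
  note cm = coalgebra_map_sweedler[OF Y points_coalgebra_map[OF p] vspace_tensor
      Y.conv_bilinear[OF ptensor_bilinear lh lh]]
  show ?thesis
    using lin h linear_map_closed[OF lp] cm coalgebra_map_counit[OF points_coalgebra_map[OF p]]
    by (simp add: points_def linear_hom_def coalgebra_map_def)
qed

text \<open>Not definitional, because \<open>sweedler\<close> passes through \<open>tlift\<close>; a
  decomposition into pure tensors makes it visible.\<close>

lemma comult_self:
  assumes z: "z \<in> carrier X"
  shows "comult X z = sweedler X z (\<lambda>x y. x \<otimes>\<^bsub>X,X\<^esub> y)"
proof -
  obtain n :: nat and v w where r: "\<forall>i<n. v i \<in> carrier X \<and> w i \<in> carrier X"
      "comult X z = (\<Sum>i<n. v i \<otimes>\<^bsub>X,X\<^esub> w i)"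
    using comult_repr[OF z] by blast
  show ?thesis
    using sweedler_sum[OF vspace_tensor ptensor_bilinear r] r(2) by simp
qed

lemma ident_points: "ident X \<in> points X X"
proof -
  have "comult X z = sweedler X z (\<lambda>x y. ident X x \<otimes>\<^bsub>X,X\<^esub> ident X y)" if z: "z \<in> carrier X" for z
    unfolding comult_self[OF z] by (rule sweedler_cong) (simp add: ident_apply)
  then show ?thesis
    using ident_linear_hom by (simp add: points_def linear_hom_def coalgebra_map_def ident_apply)
qed

end

section \<open>Products of points\<close>

context cocommutative_coalgebra begin

text \<open>Splitting the values \<open>f p\<close> and \<open>g q\<close> lists the four pieces in
  the order f, f, g, g. The interchange of the middle two regroups them as f, g, f, g.\<close>

lemma sweedler_points:
  assumes V: "coalgebra V" and W: "coalgebra W" and f: "coalgebra_map X V f" and g: "coalgebra_map X W g"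
    and U: "vspace U"
    and F1: "\<And>b c d. b \<in> carrier W \<Longrightarrow> c \<in> carrier V \<Longrightarrow> d \<in> carrier W \<Longrightarrow> linear_map V U (\<lambda>a. F a b c d)"
    and F2: "\<And>a c d. a \<in> carrier V \<Longrightarrow> c \<in> carrier V \<Longrightarrow> d \<in> carrier W \<Longrightarrow> linear_map W U (\<lambda>b. F a b c d)"
    and F3: "\<And>a b d. a \<in> carrier V \<Longrightarrow> b \<in> carrier W \<Longrightarrow> d \<in> carrier W \<Longrightarrow> linear_map V U (\<lambda>c. F a b c d)"
    and F4: "\<And>a b c. a \<in> carrier V \<Longrightarrow> b \<in> carrier W \<Longrightarrow> c \<in> carrier V \<Longrightarrow> linear_map W U (\<lambda>d. F a b c d)"
    and z: "z \<in> carrier X"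
  shows "sweedler X z (\<lambda>p q. sweedler V (f p) (\<lambda>a c. sweedler W (g q) (\<lambda>b d. F a b c d))) =
    sweedler X z (\<lambda>p q. sweedler X p (\<lambda>a b. sweedler X q (\<lambda>c d. F (f a) (g b) (f c) (g d))))"
proof -
  interpret V: coalgebra V by fact
  interpret W: coalgebra W by fact
  note lf = coalgebra_map_linear[OF f] and lg = coalgebra_map_linear[OF g]
  note cl = linear_map_closed[OF lf] linear_map_closed[OF lg]
  have "sweedler X z (\<lambda>p q. sweedler V (f p) (\<lambda>a c. sweedler W (g q) (\<lambda>b d. F a b c d))) =
      sweedler X z (\<lambda>p q. sweedler X p (\<lambda>a c. sweedler W (g q) (\<lambda>b d. F (f a) b (f c) d)))"
    by (rule sweedler_cong, rule coalgebra_map_sweedler[OF V f U bilinear_mapI])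
      (assumption | rule cl F1 F2 F3 F4 W.sweedler_linear_par[OF U V.vs] bilinear_mapI)+
  also have "\<dots> = sweedler X z (\<lambda>p q. sweedler X p (\<lambda>a c. sweedler X q (\<lambda>b d. F (f a) (g b) (f c) (g d))))"
    by (rule sweedler_cong, rule sweedler_cong, rule coalgebra_map_sweedler[OF W g U bilinear_mapI])
      (assumption | rule cl F1 F2 F3 F4 bilinear_mapI)+
  also have "\<dots> = sweedler X z (\<lambda>p q. sweedler X p (\<lambda>a b. sweedler X q (\<lambda>c d. F (f a) (g b) (f c) (g d))))"
    by (rule sweedler_interchange[OF U _ _ _ _ z])
      (assumption | rule cl linear_map_comp[OF F1 lf] linear_map_comp[OF F2 lg]
        linear_map_comp[OF F3 lf] linear_map_comp[OF F4 lg])+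
  finally show ?thesis .
qed

text \<open>The right sides of the matched pair axioms have this crosswise shape, one action on the
  first pieces and one on the second. For points they thereby become plain products without Sweedler
  indices.\<close>

lemma sweedler_points_conv:
  assumes V: "coalgebra V" and W: "coalgebra W" and f: "coalgebra_map X V f" and g: "coalgebra_map X W g"
    and U: "vspace U'" "vspace U''" "vspace U"
    and b: "bilinear_map V W U' \<beta>" "bilinear_map V W U'' \<gamma>" "bilinear_map U' U'' U \<delta>"
    and z: "z \<in> carrier X"
  shows "sweedler X z (\<lambda>p q. sweedler V (f p) (\<lambda>a c. sweedler W (g q) (\<lambda>b d. \<delta> (\<beta> a b) (\<gamma> c d)))) =
    conv X \<delta> (conv X \<beta> f g) (conv X \<gamma> f g) z"
proof -
  interpret V: coalgebra V by fact
  interpret W: coalgebra W by fact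
  note lf = coalgebra_map_linear[OF f] and lg = coalgebra_map_linear[OF g]
  note cl = linear_map_closed[OF lf] linear_map_closed[OF lg]
  have "sweedler X z (\<lambda>p q. sweedler V (f p) (\<lambda>a c. sweedler W (g q) (\<lambda>b d. \<delta> (\<beta> a b) (\<gamma> c d)))) =
     sweedler X z (\<lambda>p q. sweedler X p (\<lambda>a b. sweedler X q (\<lambda>c d. \<delta> (\<beta> (f a) (g b)) (\<gamma> (f c) (g d)))))"
    by (rule sweedler_points[OF V W f g U(3) _ _ _ _ z])
      (assumption | rule bilinear_map_left[OF b(3)] bilinear_map_right[OF b(3)] bilinear_map_left[OF b(2)]
        bilinear_map_right[OF b(2)] bilinear_map_left[OF b(1)] bilinear_map_right[OF b(1)] linear_map_ident
        bilinear_map_closed[OF b(1)] bilinear_map_closed[OF b(2)])+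
  also have "\<dots> = conv X \<delta> (conv X \<beta> f g) (conv X \<gamma> f g) z"
    by (rule conv_conv_apply[OF U b lf lg lf lg z, symmetric])
  finally show ?thesis .
qed

lemma conv_commute:
  assumes U: "vspace U" and b: "bilinear_map V W U \<beta>" and f: "linear_map X V f" and g: "linear_map X W g"
  shows "conv X \<beta> f g = conv X (\<lambda>w v. \<beta> v w) g f"
  using sweedler_commute[OF U conv_bilinear[OF b f g]] by (simp add: conv_def fun_eq_iff)

text \<open>Comultiplying \<open>\<beta> (f x) (g y)\<close> splits both factors, and
  \<open>sweedler_points_conv\<close> regroups the four pieces into two products. Cocommutativity is
  required of the source \<open>X\<close>, while \<open>V\<close>, \<open>W\<close> and
  \<open>Z\<close> are arbitrary coalgebras.\<close>

lemma conv_points: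
  assumes V: "coalgebra V" and W: "coalgebra W" and Z: "coalgebra Z" and b: "bilinear_coalgebra_map V W Z \<beta>"
    and f: "f \<in> points X V" and g: "g \<in> points X W"
  shows "conv X \<beta> f g \<in> points X Z"
proof -
  interpret V: coalgebra V by fact
  interpret W: coalgebra W by fact
  interpret Z: coalgebra Z by fact
  note b' = bilinear_coalgebra_mapD[OF b]
  note lf = points_linear[OF f] and lg = points_linear[OF g]
  note cl = linear_map_closed[OF lf] linear_map_closed[OF lg]
  have lin: "conv X \<beta> f g \<in> linear_hom X Z"
    by (rule conv_linear_hom[OF Z.vs b' lf lg])
  moreover have "comult Z (conv X \<beta> f g z) =
      sweedler X z (\<lambda>x y. conv X \<beta> f g x \<otimes>\<^bsub>Z,Z\<^esub> conv X \<beta> f g y)" if z: "z \<in> carrier X" for z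
  proof -
    have "comult Z (conv X \<beta> f g z) = sweedler X z (\<lambda>x y. comult Z (\<beta> (f x) (g y)))"
      unfolding conv_apply[OF z]
      by (rule sweedler_comp_linear[OF Z.vs vspace_tensor Z.comult_linear conv_bilinear[OF b' lf lg] z])
    also have "\<dots> = sweedler X z (\<lambda>p q. sweedler V (f p) (\<lambda>a c. sweedler W (g q) (\<lambda>b d.
        \<beta> a b \<otimes>\<^bsub>Z,Z\<^esub> \<beta> c d)))"
      using b by (intro sweedler_cong) (simp add: bilinear_coalgebra_map_def cl)
    also have "\<dots> = conv X (\<lambda>x y. x \<otimes>\<^bsub>Z,Z\<^esub> y) (conv X \<beta> f g) (conv X \<beta> f g) z"
      by (rule sweedler_points_conv[OF V W points_coalgebra_map[OF f] points_coalgebra_map[OF g]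
            Z.vs Z.vs vspace_tensor b' b' ptensor_bilinear z])
    finally show ?thesis by (simp add: conv_apply[OF z])
  qed
  moreover have "counit Z (conv X \<beta> f g z) = counit X z" if z: "z \<in> carrier X" for z
  proof -
    have "counit Z (conv X \<beta> f g z) = sweedler X z (\<lambda>x y. counit Z (\<beta> (f x) (g y)))"
      unfolding conv_apply[OF z]
      by (rule sweedler_comp_linear[OF Z.vs vspace_ground Z.counit_linear conv_bilinear[OF b' lf lg] z])
    also have "\<dots> = sweedler X z (\<lambda>x y. counit X x \<star>\<^bsub>ground\<^esub> counit X y)"
      using b by (intro sweedler_cong) (simp add: bilinear_coalgebra_map_def cl ground_def
          coalgebra_map_counit[OF points_coalgebra_map[OF f]] coalgebra_map_counit[OF points_coalgebra_map[OF g]])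
    also have "\<dots> = counit X z"
      by (rule sweedler_counit_left[OF vspace_ground counit_linear z])
    finally show ?thesis .
  qed
  ultimately show ?thesis
    by (simp add: points_def linear_hom_def coalgebra_map_def)
qed

end

section \<open>Tensor products of coalgebras\<close>

text \<open>The bilinear forms in \<open>ptensor\<close> range over the ambient spaces and see a
  space only through \<open>scal\<close>, so a change of carrier leaves pure tensors literally the
  same. This lets \<open>T\<close> stand in for the plain tensor product, and later \<open>K\<close>
  for the Hopf algebra that contains it.\<close>

lemma ptensor_scal_cong:
  assumes "scal V = scal V'" "scal W = scal W'"
  shows "v \<otimes>\<^bsub>V,W\<^esub> w = v \<otimes>\<^bsub>V',W'\<^esub> w"
  using assms by (simp add: ptensor_def bilinear_form_def)

text \<open>A four-linear \<open>E\<close> descends to a bilinear map of two tensors, in the nested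
  form in which \<open>dcp_mult\<close> is written.\<close>

lemma tensor_bilinear_ext:
  assumes V: "vspace V" "vspace W" "vspace V'" "vspace W'" and U: "vspace U"
    and E1: "\<And>b c d. b \<in> carrier W \<Longrightarrow> c \<in> carrier V' \<Longrightarrow> d \<in> carrier W' \<Longrightarrow> linear_map V U (\<lambda>a. E a b c d)"
    and E2: "\<And>a c d. a \<in> carrier V \<Longrightarrow> c \<in> carrier V' \<Longrightarrow> d \<in> carrier W' \<Longrightarrow> linear_map W U (\<lambda>b. E a b c d)"
    and E3: "\<And>a b d. a \<in> carrier V \<Longrightarrow> b \<in> carrier W \<Longrightarrow> d \<in> carrier W' \<Longrightarrow> linear_map V' U (\<lambda>c. E a b c d)"
    and E4: "\<And>a b c. a \<in> carrier V \<Longrightarrow> b \<in> carrier W \<Longrightarrow> c \<in> carrier V' \<Longrightarrow> linear_map W' U (\<lambda>d. E a b c d)"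
  defines "D \<equiv> \<lambda>s t. tlift V W (\<lambda>a b. tlift V' W' (\<lambda>c d. E a b c d) t) s"
  shows "bilinear_map (tensor V W) (tensor V' W') U D"
    and "\<And>a b c d. a \<in> carrier V \<Longrightarrow> b \<in> carrier W \<Longrightarrow> c \<in> carrier V' \<Longrightarrow> d \<in> carrier W' \<Longrightarrow>
      D (a \<otimes>\<^bsub>V,W\<^esub> b) (c \<otimes>\<^bsub>V',W'\<^esub> d) = E a b c d"
proof -
  have i: "bilinear_map V' W' U (\<lambda>c d. E a b c d)" if "a \<in> carrier V" "b \<in> carrier W" for a b
    by (rule bilinear_mapI) (rule that E3 E4 | assumption)+
  have o: "bilinear_map V W U (\<lambda>a b. tlift V' W' (\<lambda>c d. E a b c d) t)" if "t \<in> carrier (tensor V' W')" for t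
    by (rule bilinear_mapI) (rule that V U i E1 E2 tlift_bilinear_par | assumption)+
  show "bilinear_map (tensor V W) (tensor V' W') U D"
    unfolding D_def
    by (rule bilinear_mapI, rule tlift_bilinear_par)
      (rule V U i o tlift_linear vspace_tensor | assumption)+
  show "D (a \<otimes>\<^bsub>V,W\<^esub> b) (c \<otimes>\<^bsub>V',W'\<^esub> d) = E a b c d"
    if "a \<in> carrier V" "b \<in> carrier W" "c \<in> carrier V'" "d \<in> carrier W'" for a b c d
    using that by (simp add: D_def tlift_ptensor[OF V(1,2) U o] tlift_ptensor[OF V(3,4) U i] ptensor_closed)
qed

text \<open>The assumptions fix only the coalgebra part of \<open>double_cross_product\<close>.
  Hence the locale applies to \<open>A\<close> itself as well as to the test coalgebras built from
  \<open>A\<close> and from \<open>K\<close>, whatever fills the remaining fields.\<close>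

locale tensor_coalgebra = V: coalgebra V + W: coalgebra W
  for V :: "('k::field_char_0, 'a::ab_group_add) hopf"
    and W :: "('k, 'b::ab_group_add) hopf"
    and T :: "('k, ('k, 'a, 'b) tensor) hopf" +
  assumes carrier_T: "carrier T = carrier (tensor V W)"
    and scal_T: "scal T = scal (tensor V W)"
    and comult_T: "comult T = tlift V W (\<lambda>a x.
        sweedler V a (\<lambda>a\<^sub>1 a\<^sub>2. sweedler W x (\<lambda>x\<^sub>1 x\<^sub>2.
          (a\<^sub>1 \<otimes>\<^bsub>V,W\<^esub> x\<^sub>1) \<otimes>\<^bsub>tensor V W,tensor V W\<^esub> (a\<^sub>2 \<otimes>\<^bsub>V,W\<^esub> x\<^sub>2))))"
    and counit_T: "counit T = tlift V W (\<lambda>a x. counit V a * counit W x)"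
begin

abbreviation pure :: "'a \<Rightarrow> 'b \<Rightarrow> ('k, 'a, 'b) tensor" where
  "pure a x \<equiv> a \<otimes>\<^bsub>V,W\<^esub> x"

lemma vs_T: "vspace T"
  using vspace_tensor[of V W] by (simp add: vspace_def carrier_T scal_T)

lemma linear_map_T_iff: "linear_map T U f \<longleftrightarrow> linear_map (tensor V W) U f"
  by (simp add: linear_map_def carrier_T scal_T)

lemma linear_map_into_T_iff: "linear_map U T f \<longleftrightarrow> linear_map U (tensor V W) f"
  by (simp add: linear_map_def carrier_T scal_T)

lemma ptensor_T: "s \<otimes>\<^bsub>tensor V W,tensor V W\<^esub> t = s \<otimes>\<^bsub>T,T\<^esub> t"
  by (rule ptensor_scal_cong) (simp_all add: scal_T)

lemma pure_bilinear: "bilinear_map V W T (\<lambda>a x. pure a x)"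
  using ptensor_bilinear[of V W] by (simp add: bilinear_map_def linear_map_into_T_iff)

lemma pure_closed: "a \<in> carrier V \<Longrightarrow> x \<in> carrier W \<Longrightarrow> pure a x \<in> carrier T"
  by (simp add: carrier_T ptensor_closed)

lemma linear_eq_on_T:
  assumes "linear_map T U f" "linear_map T U g"
    and "\<And>v w. v \<in> carrier V \<Longrightarrow> w \<in> carrier W \<Longrightarrow> f (pure v w) = g (pure v w)"
    and "t \<in> carrier T"
  shows "f t = g t"
  using linear_eq_on_tensor[OF V.vs, of W U f g t] assms by (simp add: linear_map_T_iff carrier_T)

lemmas pure_left = bilinear_map_left[OF pure_bilinear]
lemmas pure_right = bilinear_map_right[OF pure_bilinear]

lemma sweedler_pure_bilinear:
  assumes U: "vspace U" and F: "bilinear_map T T U F"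
  shows "bilinear_map V W U (\<lambda>a x. sweedler V a (\<lambda>a\<^sub>1 a\<^sub>2. sweedler W x (\<lambda>x\<^sub>1 x\<^sub>2.
    F (pure a\<^sub>1 x\<^sub>1) (pure a\<^sub>2 x\<^sub>2))))"
  by (assumption | rule bilinear_mapI V.sweedler_linear[OF U] V.sweedler_linear_par[OF U]
      W.sweedler_linear[OF U] W.sweedler_linear_par[OF U] linear_map_ident V.vs W.vs
      bilinear_map_left[OF F] bilinear_map_right[OF F] pure_left pure_right pure_closed)+

lemma comult_pure:
  assumes "a \<in> carrier V" "x \<in> carrier W"
  shows "comult T (pure a x) = sweedler V a (\<lambda>a\<^sub>1 a\<^sub>2. sweedler W x (\<lambda>x\<^sub>1 x\<^sub>2.
    pure a\<^sub>1 x\<^sub>1 \<otimes>\<^bsub>T,T\<^esub> pure a\<^sub>2 x\<^sub>2))"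
  unfolding comult_T ptensor_T
  by (rule tlift_ptensor[OF V.vs W.vs vspace_tensor sweedler_pure_bilinear[OF vspace_tensor ptensor_bilinear] assms])

lemma comult_T_linear: "linear_map T (tensor T T) (comult T)"
  unfolding comult_T ptensor_T linear_map_T_iff
  by (rule tlift_linear[OF V.vs W.vs vspace_tensor sweedler_pure_bilinear[OF vspace_tensor ptensor_bilinear]])

lemma counit_bilinear: "bilinear_map V W ground (\<lambda>a x. counit V a * counit W x)"
  by (rule bilinear_map_pre[OF bilinear_map_times V.counit_linear W.counit_linear])

lemma counit_T_linear: "linear_map T ground (counit T)"
  unfolding counit_T linear_map_T_iff
  by (rule tlift_linear[OF V.vs W.vs vspace_ground counit_bilinear])

lemma counit_pure:
  "a \<in> carrier V \<Longrightarrow> x \<in> carrier W \<Longrightarrow> counit T (pure a x) = counit V a * counit W x"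
  unfolding counit_T by (rule tlift_ptensor[OF V.vs W.vs vspace_ground counit_bilinear])

lemma sweedler_pure:
  assumes U: "vspace U" and F: "bilinear_map T T U F" and a: "a \<in> carrier V" and x: "x \<in> carrier W"
  shows "sweedler T (pure a x) F = sweedler V a (\<lambda>a\<^sub>1 a\<^sub>2. sweedler W x (\<lambda>x\<^sub>1 x\<^sub>2.
    F (pure a\<^sub>1 x\<^sub>1) (pure a\<^sub>2 x\<^sub>2)))"
proof -
  let ?L = "tlift T T F"
  have L: "linear_map (tensor T T) U ?L"
    by (rule tlift_linear[OF vs_T vs_T U F])
  note R = bilinear_mapI V.sweedler_linear[OF vspace_tensor] V.sweedler_linear_par[OF vspace_tensor]
      W.sweedler_linear[OF vspace_tensor] W.sweedler_linear_par[OF vspace_tensor] linear_map_ident V.vs W.vs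
      bilinear_map_left[OF ptensor_bilinear] bilinear_map_right[OF ptensor_bilinear] pure_left pure_right pure_closed
  have "sweedler T (pure a x) F = ?L (sweedler V a (\<lambda>a\<^sub>1 a\<^sub>2. sweedler W x (\<lambda>x\<^sub>1 x\<^sub>2.
      pure a\<^sub>1 x\<^sub>1 \<otimes>\<^bsub>T,T\<^esub> pure a\<^sub>2 x\<^sub>2)))"
    by (simp add: sweedler_def[of T] comult_pure[OF a x])
  also have "\<dots> = sweedler V a (\<lambda>a\<^sub>1 a\<^sub>2. ?L (sweedler W x (\<lambda>x\<^sub>1 x\<^sub>2.
      pure a\<^sub>1 x\<^sub>1 \<otimes>\<^bsub>T,T\<^esub> pure a\<^sub>2 x\<^sub>2)))"
    using x by - (rule V.sweedler_comp_linear[OF vspace_tensor U L _ a]; (assumption | rule R)+)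
  also have "\<dots> = sweedler V a (\<lambda>a\<^sub>1 a\<^sub>2. sweedler W x (\<lambda>x\<^sub>1 x\<^sub>2. F (pure a\<^sub>1 x\<^sub>1) (pure a\<^sub>2 x\<^sub>2)))"
  proof (rule sweedler_cong)
    fix a1 a2 assume a12: "a1 \<in> carrier V" "a2 \<in> carrier V"
    have "?L (sweedler W x (\<lambda>x\<^sub>1 x\<^sub>2. pure a1 x\<^sub>1 \<otimes>\<^bsub>T,T\<^esub> pure a2 x\<^sub>2)) =
        sweedler W x (\<lambda>x\<^sub>1 x\<^sub>2. ?L (pure a1 x\<^sub>1 \<otimes>\<^bsub>T,T\<^esub> pure a2 x\<^sub>2))"
      using a12 by - (rule W.sweedler_comp_linear[OF vspace_tensor U L _ x]; (assumption | rule R)+)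
    also have "\<dots> = sweedler W x (\<lambda>x\<^sub>1 x\<^sub>2. F (pure a1 x\<^sub>1) (pure a2 x\<^sub>2))"
      by (rule sweedler_cong) (simp add: tlift_ptensor[OF vs_T vs_T U F] pure_closed a12)
    finally show "?L (sweedler W x (\<lambda>x\<^sub>1 x\<^sub>2. pure a1 x\<^sub>1 \<otimes>\<^bsub>T,T\<^esub> pure a2 x\<^sub>2)) = \<dots>" .
  qed
  finally show ?thesis .
qed

text \<open>This and the next lemma repeat the general rules for \<open>T\<close>, since they are
  needed in order to show that \<open>T\<close> is a coalgebra.\<close>

lemma T_sweedler_linear:
  assumes "vspace U" "bilinear_map T T U f" "linear_map Y T g"
  shows "linear_map Y U (\<lambda>y. sweedler T (g y) f)"
  unfolding sweedler_def
  by (rule linear_map_comp[OF linear_map_comp[OF tlift_linear[OF vs_T vs_T assms(1,2)] comult_T_linear] assms(3)])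

lemma T_sweedler_linear_par:
  assumes "vspace U" "vspace Y" "z \<in> carrier T"
    and "\<And>y. y \<in> carrier Y \<Longrightarrow> bilinear_map T T U (f y)"
    and "\<And>x\<^sub>1 x\<^sub>2. x\<^sub>1 \<in> carrier T \<Longrightarrow> x\<^sub>2 \<in> carrier T \<Longrightarrow> linear_map Y U (\<lambda>y. f y x\<^sub>1 x\<^sub>2)"
  shows "linear_map Y U (\<lambda>y. sweedler T z (f y))"
  unfolding sweedler_def
  by (rule tlift_bilinear_par[OF vs_T vs_T assms(1,4,5,2) linear_map_closed[OF comult_T_linear assms(3)]])

text \<open>Splitting a pure tensor twice gives sums that alternate between \<open>V\<close> and
  \<open>W\<close>. \<open>sweedler_fubini\<close> sorts them, after which coassociativity of each
  factor applies separately.\<close>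

lemma sweedler_coassoc_pure:
  assumes U: "vspace U"
    and F1: "\<And>b c. b \<in> carrier T \<Longrightarrow> c \<in> carrier T \<Longrightarrow> linear_map T U (\<lambda>a. F a b c)"
    and F2: "\<And>a c. a \<in> carrier T \<Longrightarrow> c \<in> carrier T \<Longrightarrow> linear_map T U (\<lambda>b. F a b c)"
    and F3: "\<And>a b. a \<in> carrier T \<Longrightarrow> b \<in> carrier T \<Longrightarrow> linear_map T U (\<lambda>c. F a b c)"
    and v: "v \<in> carrier V" and w: "w \<in> carrier W"
  shows "sweedler T (pure v w) (\<lambda>y c. sweedler T y (\<lambda>a b. F a b c)) =
    sweedler T (pure v w) (\<lambda>a y. sweedler T y (\<lambda>b c. F a b c))"
proof -
  define G where "G v1 v2 v3 w1 w2 w3 = F (pure v1 w1) (pure v2 w2) (pure v3 w3)" for v1 v2 v3 w1 w2 w3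
  note pl = pure_left[OF linear_map_ident] and pr = pure_right[OF linear_map_ident]
  note L = linear_map_comp[OF F1 pl] linear_map_comp[OF F2 pl] linear_map_comp[OF F3 pl]
      linear_map_comp[OF F1 pr] linear_map_comp[OF F2 pr] linear_map_comp[OF F3 pr]
  have G: "v2 \<in> carrier V \<Longrightarrow> v3 \<in> carrier V \<Longrightarrow> w1 \<in> carrier W \<Longrightarrow> w2 \<in> carrier W \<Longrightarrow> w3 \<in> carrier W \<Longrightarrow>
      linear_map V U (\<lambda>v1. G v1 v2 v3 w1 w2 w3)"
    "v1 \<in> carrier V \<Longrightarrow> v3 \<in> carrier V \<Longrightarrow> w1 \<in> carrier W \<Longrightarrow> w2 \<in> carrier W \<Longrightarrow> w3 \<in> carrier W \<Longrightarrow>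
      linear_map V U (\<lambda>v2. G v1 v2 v3 w1 w2 w3)"
    "v1 \<in> carrier V \<Longrightarrow> v2 \<in> carrier V \<Longrightarrow> w1 \<in> carrier W \<Longrightarrow> w2 \<in> carrier W \<Longrightarrow> w3 \<in> carrier W \<Longrightarrow>
      linear_map V U (\<lambda>v3. G v1 v2 v3 w1 w2 w3)"
    "v1 \<in> carrier V \<Longrightarrow> v2 \<in> carrier V \<Longrightarrow> v3 \<in> carrier V \<Longrightarrow> w2 \<in> carrier W \<Longrightarrow> w3 \<in> carrier W \<Longrightarrow>
      linear_map W U (\<lambda>w1. G v1 v2 v3 w1 w2 w3)"
    "v1 \<in> carrier V \<Longrightarrow> v2 \<in> carrier V \<Longrightarrow> v3 \<in> carrier V \<Longrightarrow> w1 \<in> carrier W \<Longrightarrow> w3 \<in> carrier W \<Longrightarrow>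
      linear_map W U (\<lambda>w2. G v1 v2 v3 w1 w2 w3)"
    "v1 \<in> carrier V \<Longrightarrow> v2 \<in> carrier V \<Longrightarrow> v3 \<in> carrier V \<Longrightarrow> w1 \<in> carrier W \<Longrightarrow> w2 \<in> carrier W \<Longrightarrow>
      linear_map W U (\<lambda>w3. G v1 v2 v3 w1 w2 w3)"
    for v1 v2 v3 w1 w2 w3
    unfolding G_def by (rule L pure_closed | assumption)+
  note R = bilinear_mapI G V.sweedler_linear[OF U] V.sweedler_linear_par[OF U]
      W.sweedler_linear[OF U] W.sweedler_linear_par[OF U] linear_map_ident V.vs W.vs V.coalgebra_axioms
  note RT = bilinear_mapI F1 F2 F3 T_sweedler_linear[OF U] T_sweedler_linear_par[OF U] linear_map_ident vs_T
  have "sweedler T (pure v w) (\<lambda>y c. sweedler T y (\<lambda>a b. F a b c)) =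
      sweedler V v (\<lambda>p v3. sweedler W w (\<lambda>q w3. sweedler T (pure p q) (\<lambda>a b. F a b (pure v3 w3))))"
    by (rule sweedler_pure[OF U _ v w]) (assumption | rule RT)+
  also have "\<dots> = sweedler V v (\<lambda>p v3. sweedler W w (\<lambda>q w3. sweedler V p (\<lambda>v1 v2. sweedler W q (\<lambda>w1 w2.
      G v1 v2 v3 w1 w2 w3))))"
    unfolding G_def by (intro sweedler_cong sweedler_pure[OF U]) (assumption | rule RT pure_closed)+
  also have "\<dots> = sweedler V v (\<lambda>p v3. sweedler V p (\<lambda>v1 v2. sweedler W w (\<lambda>q w3. sweedler W q (\<lambda>w1 w2.
      G v1 v2 v3 w1 w2 w3))))"
    using w by - (rule sweedler_cong, rule W.sweedler_fubini[OF V.coalgebra_axioms U]; (assumption | rule R)+)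
  also have "\<dots> = sweedler V v (\<lambda>v1 p. sweedler V p (\<lambda>v2 v3. sweedler W w (\<lambda>q w3. sweedler W q (\<lambda>w1 w2.
      G v1 v2 v3 w1 w2 w3))))"
    using w by - (rule V.sweedler_coassoc[OF U _ _ _ v]; (assumption | rule R)+)
  also have "\<dots> = sweedler V v (\<lambda>v1 p. sweedler V p (\<lambda>v2 v3. sweedler W w (\<lambda>w1 q. sweedler W q (\<lambda>w2 w3.
      G v1 v2 v3 w1 w2 w3))))"
    using w by - (rule sweedler_cong, rule sweedler_cong, rule W.sweedler_coassoc[OF U]; (assumption | rule R)+)
  also have "\<dots> = sweedler V v (\<lambda>v1 p. sweedler W w (\<lambda>w1 q. sweedler V p (\<lambda>v2 v3. sweedler W q (\<lambda>w2 w3.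
      G v1 v2 v3 w1 w2 w3))))"
    using w by - (rule sweedler_cong, rule W.sweedler_fubini[OF V.coalgebra_axioms U, symmetric]; (assumption | rule R)+)
  also have "\<dots> = sweedler V v (\<lambda>v1 p. sweedler W w (\<lambda>w1 q. sweedler T (pure p q) (\<lambda>b c. F (pure v1 w1) b c)))"
    unfolding G_def by (intro sweedler_cong sweedler_pure[OF U, symmetric]) (assumption | rule RT pure_closed)+
  also have "\<dots> = sweedler T (pure v w) (\<lambda>a y. sweedler T y (\<lambda>b c. F a b c))"
    by (rule sweedler_pure[OF U _ v w, symmetric]) (assumption | rule RT)+
  finally show ?thesis .
qed

lemma T_counit_left: "t \<in> carrier T \<Longrightarrow> sweedler T t (\<lambda>x y. counit T x \<star>\<^bsub>T\<^esub> y) = t"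
proof (rule linear_eq_on_T[where U = T and f = "\<lambda>t. sweedler T t (\<lambda>x y. counit T x \<star>\<^bsub>T\<^esub> y)" and g = "\<lambda>t. t"])
  have b: "bilinear_map T T T (\<lambda>x y. counit T x \<star>\<^bsub>T\<^esub> y)"
    by (rule bilinear_map_pre[OF bilinear_map_scal[OF vs_T] counit_T_linear linear_map_ident])
  show "linear_map T T (\<lambda>t. sweedler T t (\<lambda>x y. counit T x \<star>\<^bsub>T\<^esub> y))"
    by (rule T_sweedler_linear[OF vs_T b linear_map_ident])
  fix a x assume a: "a \<in> carrier V" and x: "x \<in> carrier W"
  have "sweedler T (pure a x) (\<lambda>x y. counit T x \<star>\<^bsub>T\<^esub> y) =
      sweedler V a (\<lambda>a1 a2. sweedler W x (\<lambda>x1 x2. counit W x1 \<star>\<^bsub>T\<^esub> (counit V a1 \<star>\<^bsub>T\<^esub> pure a2 x2)))"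
    unfolding sweedler_pure[OF vs_T b a x]
    by (intro sweedler_cong) (simp add: counit_pure vspace_scale_scale[OF vs_T] mult.commute)
  also have "\<dots> = sweedler V a (\<lambda>a1 a2. counit V a1 \<star>\<^bsub>T\<^esub> pure a2 x)"
    by (intro sweedler_cong W.sweedler_counit_left[OF vs_T _ x])
      (rule bilinear_map_right[OF bilinear_map_scal[OF vs_T]] pure_right linear_map_ident UNIV_I
        | assumption | simp add: carrier_ground)+
  also have "\<dots> = pure a x"
    by (rule V.sweedler_counit_left[OF vs_T pure_left[OF linear_map_ident x] a])
  finally show "sweedler T (pure a x) (\<lambda>x y. counit T x \<star>\<^bsub>T\<^esub> y) = pure a x" .
qed (rule linear_map_ident)

lemma T_counit_right: "t \<in> carrier T \<Longrightarrow> sweedler T t (\<lambda>x y. counit T y \<star>\<^bsub>T\<^esub> x) = t"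
proof (rule linear_eq_on_T[where U = T and f = "\<lambda>t. sweedler T t (\<lambda>x y. counit T y \<star>\<^bsub>T\<^esub> x)" and g = "\<lambda>t. t"])
  have b: "bilinear_map T T T (\<lambda>x y. counit T y \<star>\<^bsub>T\<^esub> x)"
    using bilinear_map_pre[OF bilinear_map_scal[OF vs_T] counit_T_linear linear_map_ident]
    by (simp add: bilinear_map_def)
  show "linear_map T T (\<lambda>t. sweedler T t (\<lambda>x y. counit T y \<star>\<^bsub>T\<^esub> x))"
    by (rule T_sweedler_linear[OF vs_T b linear_map_ident])
  fix a x assume a: "a \<in> carrier V" and x: "x \<in> carrier W"
  have "sweedler T (pure a x) (\<lambda>x y. counit T y \<star>\<^bsub>T\<^esub> x) =
      sweedler V a (\<lambda>a1 a2. sweedler W x (\<lambda>x1 x2. counit W x2 \<star>\<^bsub>T\<^esub> (counit V a2 \<star>\<^bsub>T\<^esub> pure a1 x1)))"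
    unfolding sweedler_pure[OF vs_T b a x]
    by (intro sweedler_cong) (simp add: counit_pure vspace_scale_scale[OF vs_T] mult.commute)
  also have "\<dots> = sweedler V a (\<lambda>a1 a2. counit V a2 \<star>\<^bsub>T\<^esub> pure a1 x)"
    by (intro sweedler_cong W.sweedler_counit_right[OF vs_T _ x])
      (rule bilinear_map_right[OF bilinear_map_scal[OF vs_T]] pure_right linear_map_ident UNIV_I
        | assumption | simp add: carrier_ground)+
  also have "\<dots> = pure a x"
    by (rule V.sweedler_counit_right[OF vs_T pure_left[OF linear_map_ident x] a])
  finally show "sweedler T (pure a x) (\<lambda>x y. counit T y \<star>\<^bsub>T\<^esub> x) = pure a x" .
qed (rule linear_map_ident)

text \<open>Both sides of coassociativity are linear in \<open>t\<close>, which reduces the axiom to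
  the case of pure tensors.\<close>

sublocale T: coalgebra T
proof
  fix t assume t: "t \<in> carrier T"
  let ?C = "\<lambda>a b c. a \<otimes>\<^bsub>T,tensor T T\<^esub> (b \<otimes>\<^bsub>T,T\<^esub> c)"
  note L = bilinear_map_left[OF ptensor_bilinear] bilinear_map_right[OF ptensor_bilinear] ptensor_closed
    linear_map_ident
  note RT = bilinear_mapI L T_sweedler_linear[OF vspace_tensor] T_sweedler_linear_par[OF vspace_tensor] vs_T
  show "sweedler T t (\<lambda>y c. sweedler T y (\<lambda>a b. ?C a b c)) = sweedler T t (\<lambda>a y. sweedler T y (\<lambda>b c. ?C a b c))"
  proof (rule linear_eq_on_T[where U = "tensor T (tensor T T)"
        and f = "\<lambda>t. sweedler T t (\<lambda>y c. sweedler T y (\<lambda>a b. ?C a b c))"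
        and g = "\<lambda>t. sweedler T t (\<lambda>a y. sweedler T y (\<lambda>b c. ?C a b c))"])
    show "linear_map T (tensor T (tensor T T)) (\<lambda>t. sweedler T t (\<lambda>y c. sweedler T y (\<lambda>a b. ?C a b c)))"
      by (rule T_sweedler_linear[OF vspace_tensor]) (assumption | rule RT)+
    show "linear_map T (tensor T (tensor T T)) (\<lambda>t. sweedler T t (\<lambda>a y. sweedler T y (\<lambda>b c. ?C a b c)))"
      by (rule T_sweedler_linear[OF vspace_tensor]) (assumption | rule RT)+
    show "sweedler T (pure v w) (\<lambda>y c. sweedler T y (\<lambda>a b. ?C a b c)) =
        sweedler T (pure v w) (\<lambda>a y. sweedler T y (\<lambda>b c. ?C a b c))"
      if "v \<in> carrier V" "w \<in> carrier W" for v w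
      by (rule sweedler_coassoc_pure[OF vspace_tensor _ _ _ that]) (assumption | rule L)+
  qed (rule t)
qed (rule vs_T comult_T_linear counit_T_linear T_counit_left T_counit_right; assumption?)+

lemma pure_bilinear_coalgebra_map: "bilinear_coalgebra_map V W T (\<lambda>a x. pure a x)"
  by (simp add: bilinear_coalgebra_map_def pure_bilinear comult_pure counit_pure)

text \<open>The map \<open>id \<otimes> \<epsilon>\<close>, and next to it
  \<open>\<epsilon> \<otimes> id\<close>. For cocommutative coalgebras the tensor product is the
  categorical product with these two projections: \<open>conv_points\<close> pairs two points, and
  \<open>points_decompose\<close> recovers a point from its components.\<close>

definition fst_part :: "('k, 'a, 'b) tensor \<Rightarrow> 'a" where
  "fst_part t = (if t \<in> carrier T then tlift V W (\<lambda>a x. counit W x \<star>\<^bsub>V\<^esub> a) t else 0)"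

definition snd_part :: "('k, 'a, 'b) tensor \<Rightarrow> 'b" where
  "snd_part t = (if t \<in> carrier T then tlift V W (\<lambda>a x. counit V a \<star>\<^bsub>W\<^esub> x) t else 0)"

lemma fst_bilinear: "bilinear_map V W V (\<lambda>a x. counit W x \<star>\<^bsub>V\<^esub> a)"
  using bilinear_map_pre[OF bilinear_map_scal[OF V.vs] W.counit_linear linear_map_ident]
  by (simp add: bilinear_map_def)

lemma snd_bilinear: "bilinear_map V W W (\<lambda>a x. counit V a \<star>\<^bsub>W\<^esub> x)"
  by (rule bilinear_map_pre[OF bilinear_map_scal[OF W.vs] V.counit_linear linear_map_ident])

lemma fst_part_pure: "a \<in> carrier V \<Longrightarrow> x \<in> carrier W \<Longrightarrow> fst_part (pure a x) = counit W x \<star>\<^bsub>V\<^esub> a"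
  using tlift_ptensor[OF V.vs W.vs V.vs fst_bilinear] by (simp add: fst_part_def pure_closed)

lemma snd_part_pure: "a \<in> carrier V \<Longrightarrow> x \<in> carrier W \<Longrightarrow> snd_part (pure a x) = counit V a \<star>\<^bsub>W\<^esub> x"
  using tlift_ptensor[OF V.vs W.vs W.vs snd_bilinear] by (simp add: snd_part_def pure_closed)

lemma fst_part_linear_hom: "fst_part \<in> linear_hom T V"
proof -
  have "linear_map T V fst_part"
    by (rule linear_map_cong[OF _ vs_T])
      (use tlift_linear[OF V.vs W.vs V.vs fst_bilinear] in \<open>simp_all add: linear_map_T_iff fst_part_def\<close>)
  then show ?thesis by (simp add: linear_hom_def fst_part_def)
qed

lemma snd_part_linear_hom: "snd_part \<in> linear_hom T W"
proof -
  have "linear_map T W snd_part"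
    by (rule linear_map_cong[OF _ vs_T])
      (use tlift_linear[OF V.vs W.vs W.vs snd_bilinear] in \<open>simp_all add: linear_map_T_iff snd_part_def\<close>)
  then show ?thesis by (simp add: linear_hom_def snd_part_def)
qed

text \<open>Splitting the second factor leaves the counits
  \<open>\<epsilon>(x\<^sub>1) \<epsilon>(x\<^sub>2)\<close>, which collapse to
  \<open>\<epsilon>(x)\<close>.\<close>

lemma fst_part_points: "fst_part \<in> points T V"
proof -
  note lf = linear_homD[OF fst_part_linear_hom]
  have b: "bilinear_map T T (tensor V V) (\<lambda>x y. fst_part x \<otimes>\<^bsub>V,V\<^esub> fst_part y)"
    by (rule bilinear_map_pre[OF ptensor_bilinear lf lf])
  have sc: "bilinear_map ground (tensor V V) (tensor V V) (scal (tensor V V))"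
    by (rule bilinear_map_scal[OF vspace_tensor])
  have "comult V (fst_part t) = sweedler T t (\<lambda>x y. fst_part x \<otimes>\<^bsub>V,V\<^esub> fst_part y)" if t: "t \<in> carrier T" for t
  proof (rule linear_eq_on_T[OF _ _ _ t])
    show "linear_map T (tensor V V) (\<lambda>t. comult V (fst_part t))"
      by (rule linear_map_comp[OF V.comult_linear lf])
    show "linear_map T (tensor V V) (\<lambda>t. sweedler T t (\<lambda>x y. fst_part x \<otimes>\<^bsub>V,V\<^esub> fst_part y))"
      by (rule T_sweedler_linear[OF vspace_tensor b linear_map_ident])
    fix a x assume a: "a \<in> carrier V" and x: "x \<in> carrier W"
    have "sweedler T (pure a x) (\<lambda>x y. fst_part x \<otimes>\<^bsub>V,V\<^esub> fst_part y) = sweedler V a (\<lambda>a1 a2. sweedler W x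
        (\<lambda>x1 x2. counit W x1 \<star>\<^bsub>tensor V V\<^esub> (counit W x2 \<star>\<^bsub>tensor V V\<^esub> (a1 \<otimes>\<^bsub>V,V\<^esub> a2))))"
      unfolding sweedler_pure[OF vspace_tensor b a x]
      by (intro sweedler_cong)
        (simp add: fst_part_pure scal_ptensor(1)[symmetric] scal_ptensor(2)[symmetric]
          vspace_scale_scale[OF vspace_tensor] mult.commute)
    also have "\<dots> = sweedler V a (\<lambda>a1 a2. counit W x \<star>\<^bsub>tensor V V\<^esub> (a1 \<otimes>\<^bsub>V,V\<^esub> a2))"
      by (intro sweedler_cong W.sweedler_counit_left[OF vspace_tensor _ x])
        (rule bilinear_map_left[OF sc W.counit_linear] ptensor_closed | assumption)+
    also have "\<dots> = counit W x \<star>\<^bsub>tensor V V\<^esub> comult V a"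
      unfolding V.comult_self[OF a]
      by (rule V.sweedler_comp_linear[OF vspace_tensor vspace_tensor
            bilinear_map_right[OF sc linear_map_ident] ptensor_bilinear a, symmetric])
        (simp add: carrier_ground)
    also have "\<dots> = comult V (fst_part (pure a x))"
      by (simp add: fst_part_pure a x linear_map_scale[OF V.comult_linear a])
    finally show "comult V (fst_part (pure a x)) = sweedler T (pure a x) (\<lambda>x y. fst_part x \<otimes>\<^bsub>V,V\<^esub> fst_part y)" ..
  qed
  moreover have "counit V (fst_part t) = counit T t" if t: "t \<in> carrier T" for t
  proof (rule linear_eq_on_T[OF linear_map_comp[OF V.counit_linear lf] counit_T_linear _ t])
    show "counit V (fst_part (pure a x)) = counit T (pure a x)" if "a \<in> carrier V" "x \<in> carrier W" for a x
      using that linear_map_scale[OF V.counit_linear that(1)]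
      by (simp add: fst_part_pure counit_pure ground_def)
  qed
  ultimately show ?thesis
    using fst_part_linear_hom by (simp add: points_def linear_hom_def coalgebra_map_def)
qed

lemma snd_part_points: "snd_part \<in> points T W"
proof -
  note lf = linear_homD[OF snd_part_linear_hom]
  have b: "bilinear_map T T (tensor W W) (\<lambda>x y. snd_part x \<otimes>\<^bsub>W,W\<^esub> snd_part y)"
    by (rule bilinear_map_pre[OF ptensor_bilinear lf lf])
  have sc: "bilinear_map ground (tensor W W) (tensor W W) (scal (tensor W W))"
    by (rule bilinear_map_scal[OF vspace_tensor])
  have "comult W (snd_part t) = sweedler T t (\<lambda>x y. snd_part x \<otimes>\<^bsub>W,W\<^esub> snd_part y)" if t: "t \<in> carrier T" for t
  proof (rule linear_eq_on_T[OF _ _ _ t])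
    show "linear_map T (tensor W W) (\<lambda>t. comult W (snd_part t))"
      by (rule linear_map_comp[OF W.comult_linear lf])
    show "linear_map T (tensor W W) (\<lambda>t. sweedler T t (\<lambda>x y. snd_part x \<otimes>\<^bsub>W,W\<^esub> snd_part y))"
      by (rule T_sweedler_linear[OF vspace_tensor b linear_map_ident])
    fix a x assume a: "a \<in> carrier V" and x: "x \<in> carrier W"
    have "sweedler T (pure a x) (\<lambda>x y. snd_part x \<otimes>\<^bsub>W,W\<^esub> snd_part y) = sweedler V a (\<lambda>a1 a2. sweedler W x
        (\<lambda>x1 x2. counit V a1 \<star>\<^bsub>tensor W W\<^esub> (counit V a2 \<star>\<^bsub>tensor W W\<^esub> (x1 \<otimes>\<^bsub>W,W\<^esub> x2))))"
      unfolding sweedler_pure[OF vspace_tensor b a x]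
      by (intro sweedler_cong)
        (simp add: snd_part_pure scal_ptensor(1)[symmetric] scal_ptensor(2)[symmetric]
          vspace_scale_scale[OF vspace_tensor] mult.commute)
    also have "\<dots> = sweedler V a (\<lambda>a1 a2. counit V a1 \<star>\<^bsub>tensor W W\<^esub> (counit V a2 \<star>\<^bsub>tensor W W\<^esub> comult W x))"
    proof (rule sweedler_cong)
      fix a1 a2
      have l: "linear_map (tensor W W) (tensor W W)
          (\<lambda>t. counit V a1 \<star>\<^bsub>tensor W W\<^esub> (counit V a2 \<star>\<^bsub>tensor W W\<^esub> t))"
        by (rule bilinear_map_right[OF sc bilinear_map_right[OF sc linear_map_ident]])
          (simp_all add: carrier_ground)
      show "sweedler W x (\<lambda>x1 x2. counit V a1 \<star>\<^bsub>tensor W W\<^esub> (counit V a2 \<star>\<^bsub>tensor W W\<^esub> (x1 \<otimes>\<^bsub>W,W\<^esub> x2))) =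
          counit V a1 \<star>\<^bsub>tensor W W\<^esub> (counit V a2 \<star>\<^bsub>tensor W W\<^esub> comult W x)"
        using W.sweedler_comp_linear[OF vspace_tensor vspace_tensor l ptensor_bilinear x]
        by (simp only: W.comult_self[OF x, symmetric])
    qed
    also have "\<dots> = counit V a \<star>\<^bsub>tensor W W\<^esub> comult W x"
      by (rule V.sweedler_counit_left[OF vspace_tensor bilinear_map_left[OF sc V.counit_linear] a])
        (rule linear_map_closed[OF W.comult_linear x])
    also have "\<dots> = comult W (snd_part (pure a x))"
      by (simp add: snd_part_pure a x linear_map_scale[OF W.comult_linear x])
    finally show "comult W (snd_part (pure a x)) = sweedler T (pure a x) (\<lambda>x y. snd_part x \<otimes>\<^bsub>W,W\<^esub> snd_part y)" ..
  qed
  moreover have "counit W (snd_part t) = counit T t" if t: "t \<in> carrier T" for t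
  proof (rule linear_eq_on_T[OF linear_map_comp[OF W.counit_linear lf] counit_T_linear _ t])
    show "counit W (snd_part (pure a x)) = counit T (pure a x)" if "a \<in> carrier V" "x \<in> carrier W" for a x
      using that linear_map_scale[OF W.counit_linear that(2)]
      by (simp add: snd_part_pure counit_pure ground_def)
  qed
  ultimately show ?thesis
    using snd_part_linear_hom by (simp add: points_def linear_hom_def coalgebra_map_def)
qed

text \<open>On a pure tensor the counits land crosswise, on \<open>x\<^sub>1\<close> and on
  \<open>a\<^sub>2\<close>, and collapsing both sums leaves \<open>a \<otimes> x\<close>.\<close>

lemma conv_parts: "conv T (\<lambda>a x. pure a x) fst_part snd_part = ident T"
proof (rule linear_hom_eqI[OF _ T.ident_linear_hom])
  note lf = linear_homD[OF fst_part_linear_hom] and ls = linear_homD[OF snd_part_linear_hom]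
  have b: "bilinear_map T T T (\<lambda>s t. pure (fst_part s) (snd_part t))"
    by (rule bilinear_map_pre[OF pure_bilinear lf ls])
  show hom: "conv T (\<lambda>a x. pure a x) fst_part snd_part \<in> linear_hom T T"
    by (rule T.conv_linear_hom[OF vs_T pure_bilinear lf ls])
  fix t assume t: "t \<in> carrier T"
  show "conv T (\<lambda>a x. pure a x) fst_part snd_part t = ident T t"
  proof (rule linear_eq_on_T[OF linear_homD[OF hom] linear_homD[OF T.ident_linear_hom] _ t])
    fix a x assume a: "a \<in> carrier V" and x: "x \<in> carrier W"
    have "conv T (\<lambda>a x. pure a x) fst_part snd_part (pure a x) =
        sweedler V a (\<lambda>a1 a2. sweedler W x (\<lambda>x1 x2. counit W x1 \<star>\<^bsub>T\<^esub> (counit V a2 \<star>\<^bsub>T\<^esub> pure a1 x2)))"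
      unfolding conv_apply[OF pure_closed[OF a x]] sweedler_pure[OF vs_T b a x]
      by (intro sweedler_cong)
        (simp add: fst_part_pure snd_part_pure scal_T scal_ptensor(1)[symmetric] scal_ptensor(2)[symmetric]
          vspace_scale_scale[OF vspace_tensor] mult.commute)
    also have "\<dots> = sweedler V a (\<lambda>a1 a2. counit V a2 \<star>\<^bsub>T\<^esub> pure a1 x)"
      by (intro sweedler_cong W.sweedler_counit_left[OF vs_T _ x])
        (rule bilinear_map_right[OF bilinear_map_scal[OF vs_T]] pure_right linear_map_ident
          | assumption | simp add: carrier_ground)+
    also have "\<dots> = pure a x"
      by (rule V.sweedler_counit_right[OF vs_T pure_left[OF linear_map_ident x] a])
    finally show "conv T (\<lambda>a x. pure a x) fst_part snd_part (pure a x) = ident T (pure a x)"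
      by (simp add: ident_apply pure_closed a x)
  qed
qed

text \<open>The passage from points back to elements: an identity between products of the
  projections becomes, at a pure tensor, an identity between arbitrary elements. The proof applies
  the linear map induced by the pairing to \<open>conv_parts\<close>.\<close>

lemma conv_parts_eval:
  assumes U: "vspace U" and b: "bilinear_map V' W' U \<beta>" and f: "linear_map V V' f" and g: "linear_map W W' g"
    and a: "a \<in> carrier V" and x: "x \<in> carrier W"
  shows "conv T \<beta> (\<lambda>t. f (fst_part t)) (\<lambda>t. g (snd_part t)) (pure a x) = \<beta> (f a) (g x)"
proof -
  let ?h = "tlift V W (\<lambda>a x. \<beta> (f a) (g x))"
  note b' = bilinear_map_pre[OF b f g]
  have h: "linear_map T U ?h"
    unfolding linear_map_T_iff by (rule tlift_linear[OF V.vs W.vs U b'])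
  have "(\<lambda>t. ?h (conv T (\<lambda>a x. pure a x) fst_part snd_part t)) = conv T \<beta> (\<lambda>t. f (fst_part t)) (\<lambda>t. g (snd_part t))"
    by (rule T.conv_post[OF vs_T U pure_bilinear h linear_homD[OF fst_part_linear_hom]
          linear_homD[OF snd_part_linear_hom]]) (rule tlift_ptensor[OF V.vs W.vs U b'])
  from fun_cong[OF this, of "pure a x"] show ?thesis
    using tlift_ptensor[OF V.vs W.vs U b' a x] by (simp add: conv_parts ident_apply pure_closed a x)
qed

text \<open>The first variable occurs on both sides of the second, so only \<open>a\<close> remains
  split; the counit coming from the last \<open>fst_part\<close> absorbs the splitting of
  \<open>x\<close>. This is the shape of the right side of the Rota-Baxter identity.\<close>

lemma conv_fst_snd_fst_eval:
  assumes U: "vspace U'" "vspace U"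
    and b: "bilinear_map V' W' U' \<beta>" "bilinear_map U' Z U \<gamma>"
    and f: "linear_map V V' f" and g: "linear_map W W' g" and h: "linear_map V Z h"
    and a: "a \<in> carrier V" and x: "x \<in> carrier W"
  shows "conv T \<gamma> (conv T \<beta> (\<lambda>t. f (fst_part t)) (\<lambda>t. g (snd_part t))) (\<lambda>t. h (fst_part t)) (pure a x) =
    sweedler V a (\<lambda>a\<^sub>1 a\<^sub>2. \<gamma> (\<beta> (f a\<^sub>1) (g x)) (h a\<^sub>2))"
proof -
  note lf = linear_map_comp[OF f points_linear[OF fst_part_points]]
    and lg = linear_map_comp[OF g points_linear[OF snd_part_points]]
    and lh = linear_map_comp[OF h points_linear[OF fst_part_points]]
  let ?F = "conv T \<beta> (\<lambda>t. f (fst_part t)) (\<lambda>t. g (snd_part t))"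
  have lF: "linear_map T U' ?F"
    by (rule T.conv_linear[OF U(1) b(1) lf lg])
  have ev: "?F (pure v w) = \<beta> (f v) (g w)" if "v \<in> carrier V" "w \<in> carrier W" for v w
    by (rule conv_parts_eval[OF U(1) b(1) f g that])
  have "conv T \<gamma> ?F (\<lambda>t. h (fst_part t)) (pure a x) =
      sweedler V a (\<lambda>a\<^sub>1 a\<^sub>2. sweedler W x (\<lambda>x\<^sub>1 x\<^sub>2. \<gamma> (?F (pure a\<^sub>1 x\<^sub>1)) (h (fst_part (pure a\<^sub>2 x\<^sub>2)))))"
    unfolding conv_apply[OF pure_closed[OF a x]]
    by (rule sweedler_pure[OF U(2) T.conv_bilinear[OF b(2) lF lh] a x])
  also have "\<dots> = sweedler V a (\<lambda>a\<^sub>1 a\<^sub>2. sweedler W x (\<lambda>x\<^sub>1 x\<^sub>2.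
      counit W x\<^sub>2 \<star>\<^bsub>U\<^esub> \<gamma> (\<beta> (f a\<^sub>1) (g x\<^sub>1)) (h a\<^sub>2)))"
    by (intro sweedler_cong)
      (simp add: ev fst_part_pure linear_map_scale[OF h] bilinear_map_scale_right[OF b(2)]
        bilinear_map_closed[OF b(1)] linear_map_closed[OF f] linear_map_closed[OF g] linear_map_closed[OF h])
  also have "\<dots> = sweedler V a (\<lambda>a\<^sub>1 a\<^sub>2. \<gamma> (\<beta> (f a\<^sub>1) (g x)) (h a\<^sub>2))"
    using x by - (rule sweedler_cong, rule W.sweedler_counit_right[OF U(2)];
      (assumption | rule bilinear_map_left[OF b(2)] bilinear_map_right[OF b(1)] g linear_map_closed[OF f]
        linear_map_closed[OF h])+)
  finally show ?thesis .
qed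

text \<open>The identity \<open>conv_parts\<close> composed with \<open>f\<close>, since convolution
  commutes with composition by a point.\<close>

lemma points_decompose:
  assumes X: "coalgebra X" and f: "f \<in> points X T"
  shows "conv X (\<lambda>a x. pure a x) (\<lambda>z. fst_part (f z)) (\<lambda>z. snd_part (f z)) = f"
proof -
  interpret X: coalgebra X by fact
  have 1: "(\<lambda>z. conv T (\<lambda>a x. pure a x) fst_part snd_part (f z)) =
      conv X (\<lambda>a x. pure a x) (\<lambda>z. fst_part (f z)) (\<lambda>z. snd_part (f z))"
    by (rule X.conv_pre[OF T.coalgebra_axioms f vs_T pure_bilinear linear_homD[OF fst_part_linear_hom]
          linear_homD[OF snd_part_linear_hom]])
  have 2: "ident T (f z) = f z" for z
  proof (cases "z \<in> carrier X")
    case True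
    then show ?thesis by (rule ident_apply[OF linear_map_closed[OF points_linear[OF f]]])
  next
    case False
    then have "f z = 0" by (rule linear_hom_outside[OF points_linear_hom[OF f]])
    then show ?thesis by (simp only: ident_def if_cancel)
  qed
  show ?thesis
    using 1 unfolding conv_parts 2 by (rule sym)
qed

lemma fst_part_conv:
  assumes X: "coalgebra X" and f: "f \<in> points X V" and g: "g \<in> points X W"
  shows "(\<lambda>z. fst_part (conv X (\<lambda>a x. pure a x) f g z)) = f"
proof
  fix z
  interpret X: coalgebra X by fact
  show "fst_part (conv X (\<lambda>a x. pure a x) f g z) = f z"
  proof (cases "z \<in> carrier X")
    case z: True
    have "fst_part (conv X (\<lambda>a x. pure a x) f g z) = sweedler X z (\<lambda>x y. fst_part (pure (f x) (g y)))"
      unfolding conv_apply[OF z]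
      by (rule X.sweedler_comp_linear[OF vs_T V.vs linear_homD[OF fst_part_linear_hom]
            X.conv_bilinear[OF pure_bilinear points_linear[OF f] points_linear[OF g]] z])
    also have "\<dots> = sweedler X z (\<lambda>x y. counit X y \<star>\<^bsub>V\<^esub> f x)"
      by (rule sweedler_cong) (simp add: fst_part_pure linear_map_closed[OF points_linear[OF f]]
          linear_map_closed[OF points_linear[OF g]] coalgebra_map_counit[OF points_coalgebra_map[OF g]])
    also have "\<dots> = f z"
      by (rule X.sweedler_counit_right[OF V.vs points_linear[OF f] z])
    finally show ?thesis .
  qed (simp add: conv_def linear_map_zero[OF vs_T linear_homD[OF fst_part_linear_hom]]
      linear_hom_outside[OF points_linear_hom[OF f]])
qed

end

locale cocommutative_tensor_coalgebra = tensor_coalgebra +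
  V: cocommutative_coalgebra V + W: cocommutative_coalgebra W
begin

text \<open>The flip acts on the splittings of the two factors independently and is carried out one
  factor at a time.\<close>

sublocale T: cocommutative_coalgebra T
proof
  fix t assume t: "t \<in> carrier T"
  have b: "bilinear_map T T (tensor T T) (\<lambda>x y. y \<otimes>\<^bsub>T,T\<^esub> x)"
    using ptensor_bilinear[of T T] by (simp add: bilinear_map_def)
  note R = bilinear_mapI V.sweedler_linear[OF vspace_tensor] V.sweedler_linear_par[OF vspace_tensor]
      W.sweedler_linear[OF vspace_tensor] W.sweedler_linear_par[OF vspace_tensor] linear_map_ident V.vs W.vs
      bilinear_map_left[OF ptensor_bilinear] bilinear_map_right[OF ptensor_bilinear] pure_left pure_right pure_closed
  show "comult T t = sweedler T t (\<lambda>x y. y \<otimes>\<^bsub>T,T\<^esub> x)"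
  proof (rule linear_eq_on_T[OF comult_T_linear T_sweedler_linear[OF vspace_tensor b linear_map_ident] _ t])
    fix a x assume a: "a \<in> carrier V" and x: "x \<in> carrier W"
    have "comult T (pure a x) = sweedler V a (\<lambda>a1 a2. sweedler W x (\<lambda>x1 x2. pure a2 x1 \<otimes>\<^bsub>T,T\<^esub> pure a1 x2))"
      unfolding comult_pure[OF a x]
      using a x by - (rule V.sweedler_commute[OF vspace_tensor]; (assumption | rule R)+)
    also have "\<dots> = sweedler V a (\<lambda>a1 a2. sweedler W x (\<lambda>x1 x2. pure a2 x2 \<otimes>\<^bsub>T,T\<^esub> pure a1 x1))"
      using x by - (rule sweedler_cong, rule W.sweedler_commute[OF vspace_tensor]; (assumption | rule R)+)
    also have "\<dots> = sweedler T (pure a x) (\<lambda>x y. y \<otimes>\<^bsub>T,T\<^esub> x)"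
      by (rule sweedler_pure[OF vspace_tensor b a x, symmetric])
    finally show "comult T (pure a x) = sweedler T (pure a x) (\<lambda>x y. y \<otimes>\<^bsub>T,T\<^esub> x)" .
  qed
qed

end

section \<open>Convolution with values in a Hopf algebra\<close>

text \<open>Separated from \<open>hopf_algebra\<close> because the convolution monoid with values in
  the double cross product is already needed for the proof that its antipode is one.\<close>

locale unital_algebra =
  fixes H :: "('k::field_char_0, 'a::ab_group_add) hopf" (structure)
  assumes vspace: "vspace H"
    and mult_bilinear: "bilinear_map H H H (mult H)"
    and one_closed: "\<one> \<in> carrier H"
    and mult_assoc: "\<lbrakk>x \<in> carrier H; y \<in> carrier H; z \<in> carrier H\<rbrakk>
          \<Longrightarrow> (x \<bullet> y) \<bullet> z = x \<bullet> (y \<bullet> z)"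
    and one_mult: "x \<in> carrier H \<Longrightarrow> \<one> \<bullet> x = x"
    and mult_one: "x \<in> carrier H \<Longrightarrow> x \<bullet> \<one> = x"
begin

lemma conv_mult_linear_hom:
  "coalgebra X \<Longrightarrow> linear_map X H f \<Longrightarrow> linear_map X H g \<Longrightarrow> conv X (mult H) f g \<in> linear_hom X H"
  by (rule coalgebra.conv_linear_hom[OF _ vspace mult_bilinear])

lemma conv_mult_linear:
  "coalgebra X \<Longrightarrow> linear_map X H f \<Longrightarrow> linear_map X H g \<Longrightarrow> linear_map X H (conv X (mult H) f g)"
  by (rule linear_homD[OF conv_mult_linear_hom])

lemma conv_mult_assoc:
  "coalgebra X \<Longrightarrow> linear_map X H f \<Longrightarrow> linear_map X H g \<Longrightarrow> linear_map X H h \<Longrightarrow>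
    conv X (mult H) (conv X (mult H) f g) h = conv X (mult H) f (conv X (mult H) g h)"
  by (rule coalgebra.conv_assoc[OF _ vspace vspace vspace mult_bilinear mult_bilinear mult_bilinear mult_bilinear])
    (simp_all add: mult_assoc)

lemma conv_mult_unit_left:
  assumes "coalgebra X" "f \<in> linear_hom X H"
  shows "conv X (mult H) (conv_unit X H) f = f"
proof -
  interpret X: coalgebra X by fact
  show ?thesis
    unfolding X.conv_unit_eq X.conv_const_left[OF vspace mult_bilinear one_closed assms(2)]
    using one_mult linear_map_closed[OF linear_homD[OF assms(2)]] linear_hom_outside[OF assms(2)]
    by (auto simp: fun_eq_iff)
qed

lemma conv_mult_unit_right:
  assumes "coalgebra X" "f \<in> linear_hom X H"
  shows "conv X (mult H) f (conv_unit X H) = f"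
proof -
  interpret X: coalgebra X by fact
  show ?thesis
    unfolding X.conv_unit_eq X.conv_const_right[OF vspace mult_bilinear one_closed assms(2)]
    using mult_one linear_map_closed[OF linear_homD[OF assms(2)]] linear_hom_outside[OF assms(2)]
    by (auto simp: fun_eq_iff)
qed

lemma conv_inverse_unique:
  assumes X: "coalgebra X" and "f \<in> linear_hom X H" "g \<in> linear_hom X H" "h \<in> linear_hom X H"
    and "conv X (mult H) g f = conv_unit X H" "conv X (mult H) f h = conv_unit X H"
  shows "g = h"
  using conv_mult_assoc[OF X assms(3,2,4)[THEN linear_homD]] assms
    conv_mult_unit_left[OF X assms(4)] conv_mult_unit_right[OF X assms(3)] by simp

end

sublocale hopf_algebra \<subseteq> alg: unital_algebra H
  by unfold_locales (fact vspace mult_bilinear one_closed mult_assoc one_mult mult_one)+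

sublocale hopf_algebra \<subseteq> coalg: coalgebra H
  by unfold_locales (fact vspace comult_linear counit_linear coassoc counit_left counit_right)+

sublocale cocommutative_hopf_algebra \<subseteq> coalg: cocommutative_coalgebra H
  by unfold_locales (fact cocommutative)

context hopf_algebra begin

lemma mult_bilinear_coalgebra_map: "bilinear_coalgebra_map H H H (mult H)"
  by (simp add: bilinear_coalgebra_map_def mult_bilinear comult_mult counit_mult)

text \<open>The antipode axiom is the case of the identity map; composing it with the point
  \<open>f\<close> gives the general one. The inverse enters as a linear map, so cancellations take
  place in the convolution monoid of linear maps.\<close>

lemma conv_antipode_left:
  assumes X: "coalgebra X" and f: "f \<in> points X H"
  shows "conv X (mult H) (\<lambda>z. antipode H (f z)) f = conv_unit X H"
proof -
  interpret X: coalgebra X by fact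
  have 1: "(\<lambda>z. conv H (mult H) (antipode H) (\<lambda>x. x) (f z)) = conv X (mult H) (\<lambda>z. antipode H (f z)) f"
    by (rule X.conv_pre[OF coalg.coalgebra_axioms f vspace mult_bilinear antipode_linear linear_map_ident])
  have 2: "conv H (mult H) (antipode H) (\<lambda>x. x) (f z) = conv_unit X H z" for z
  proof (cases "z \<in> carrier X")
    case True
    then show ?thesis
      using antipode_left linear_map_closed[OF points_linear[OF f]] coalgebra_map_counit[OF points_coalgebra_map[OF f]]
      by (simp add: conv_apply conv_unit_def)
  next
    case False
    then show ?thesis
      using linear_hom_outside[OF points_linear_hom[OF f] False]
        linear_map_zero[OF vspace coalg.conv_linear[OF vspace mult_bilinear antipode_linear linear_map_ident]]
      by (simp add: conv_unit_def)
  qed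
  show ?thesis using 1 unfolding 2 by (rule sym)
qed

lemma conv_antipode_right:
  assumes X: "coalgebra X" and f: "f \<in> points X H"
  shows "conv X (mult H) f (\<lambda>z. antipode H (f z)) = conv_unit X H"
proof -
  interpret X: coalgebra X by fact
  have 1: "(\<lambda>z. conv H (mult H) (\<lambda>x. x) (antipode H) (f z)) = conv X (mult H) f (\<lambda>z. antipode H (f z))"
    by (rule X.conv_pre[OF coalg.coalgebra_axioms f vspace mult_bilinear linear_map_ident antipode_linear])
  have 2: "conv H (mult H) (\<lambda>x. x) (antipode H) (f z) = conv_unit X H z" for z
  proof (cases "z \<in> carrier X")
    case True
    then show ?thesis
      using antipode_right linear_map_closed[OF points_linear[OF f]] coalgebra_map_counit[OF points_coalgebra_map[OF f]]
      by (simp add: conv_apply conv_unit_def)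
  next
    case False
    then show ?thesis
      using linear_hom_outside[OF points_linear_hom[OF f] False]
        linear_map_zero[OF vspace coalg.conv_linear[OF vspace mult_bilinear linear_map_ident antipode_linear]]
      by (simp add: conv_unit_def)
  qed
  show ?thesis using 1 unfolding 2 by (rule sym)
qed

lemma sweedler_one:
  assumes "vspace U" "bilinear_map H H U F"
  shows "sweedler H \<one> F = F \<one> \<one>"
  unfolding sweedler_def comult_one
  by (rule tlift_ptensor[OF vspace vspace assms one_closed one_closed])

end

section \<open>The double cross product is a Hopf algebra\<close>

locale cocommutative_matched_pair = matched_pair H H' left right +
  H: cocommutative_hopf_algebra H + H': cocommutative_hopf_algebra H'
  for H :: "('k::field_char_0, 'a::ab_group_add) hopf"
    and H' :: "('k, 'b::ab_group_add) hopf"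
    and left :: "'a \<Rightarrow> 'b \<Rightarrow> 'b"
    and right :: "'a \<Rightarrow> 'b \<Rightarrow> 'a"
begin

abbreviation A :: "('k, ('k, 'b, 'a) tensor) hopf" where
  "A \<equiv> double_cross_product H H' left right"

abbreviation dcp :: "('k, 'b, 'a) tensor \<Rightarrow> ('k, 'b, 'a) tensor \<Rightarrow> ('k, 'b, 'a) tensor" where
  "dcp \<equiv> dcp_mult H H' left right"

lemma A_simps: "mult A = dcp" "\<one>\<^bsub>A\<^esub> = \<one>\<^bsub>H'\<^esub> \<otimes>\<^bsub>H',H\<^esub> \<one>\<^bsub>H\<^esub>"
  "antipode A = tlift H' H (\<lambda>a x. dcp (\<one>\<^bsub>H'\<^esub> \<otimes>\<^bsub>H',H\<^esub> antipode H x) (antipode H' a \<otimes>\<^bsub>H',H\<^esub> \<one>\<^bsub>H\<^esub>))"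
  by (simp_all add: double_cross_product_def)

sublocale TA: cocommutative_tensor_coalgebra H' H A
  by unfold_locales (simp_all add: double_cross_product_def)

abbreviation pair :: "('k, 'x::ab_group_add) hopf \<Rightarrow> ('x \<Rightarrow> 'b) \<Rightarrow> ('x \<Rightarrow> 'a) \<Rightarrow> 'x \<Rightarrow> ('k, 'b, 'a) tensor" where
  "pair X \<equiv> conv X (\<lambda>a x. TA.pure a x)"

lemma left_bilinear_coalgebra_map: "bilinear_coalgebra_map H H' H' left"
  by (simp add: bilinear_coalgebra_map_def left_bilinear left_comult left_counit)

lemma right_bilinear_coalgebra_map: "bilinear_coalgebra_map H H' H right"
  by (simp add: bilinear_coalgebra_map_def right_bilinear right_comult right_counit)

lemmas bilin_rules =
  bilinear_map_left[OF left_bilinear] bilinear_map_right[OF left_bilinear]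
  bilinear_map_left[OF right_bilinear] bilinear_map_right[OF right_bilinear]
  bilinear_map_left[OF H.mult_bilinear] bilinear_map_right[OF H.mult_bilinear]
  bilinear_map_left[OF H'.mult_bilinear] bilinear_map_right[OF H'.mult_bilinear]
  TA.pure_left TA.pure_right

lemmas closed_rules =
  bilinear_map_closed[OF left_bilinear] bilinear_map_closed[OF right_bilinear]
  bilinear_map_closed[OF H.mult_bilinear] bilinear_map_closed[OF H'.mult_bilinear]
  TA.pure_closed H.one_closed H'.one_closed

text \<open>\<open>E\<close> is the four-linear expression behind \<open>dcp_mult\<close>; its
  linearity in each slot is what \<open>tensor_bilinear_ext\<close> needs to make the product well
  defined on tensors.\<close>

lemma dcp_bilinear: "bilinear_map A A A dcp"
  and dcp_pure: "\<And>a x b y. a \<in> carrier H' \<Longrightarrow> x \<in> carrier H \<Longrightarrow> b \<in> carrier H' \<Longrightarrow> y \<in> carrier H \<Longrightarrow>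
    dcp (TA.pure a x) (TA.pure b y) = sweedler H x (\<lambda>x\<^sub>1 x\<^sub>2. sweedler H' b (\<lambda>b\<^sub>1 b\<^sub>2.
      TA.pure (a \<bullet>\<^bsub>H'\<^esub> left x\<^sub>1 b\<^sub>1) (right x\<^sub>2 b\<^sub>2 \<bullet>\<^bsub>H\<^esub> y)))"
proof -
  define E where "E a x b y = sweedler H x (\<lambda>x\<^sub>1 x\<^sub>2. sweedler H' b (\<lambda>b\<^sub>1 b\<^sub>2.
      TA.pure (a \<bullet>\<^bsub>H'\<^esub> left x\<^sub>1 b\<^sub>1) (right x\<^sub>2 b\<^sub>2 \<bullet>\<^bsub>H\<^esub> y)))" for a x b y
  note R = bilin_rules closed_rules bilinear_mapI linear_map_ident H.vspace H'.vspace
    H.coalg.sweedler_linear[OF TA.vs_T] H.coalg.sweedler_linear_par[OF TA.vs_T]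
    H'.coalg.sweedler_linear[OF TA.vs_T] H'.coalg.sweedler_linear_par[OF TA.vs_T]
  have 1: "linear_map H' A (\<lambda>a. E a x b y)" if "x \<in> carrier H" "b \<in> carrier H'" "y \<in> carrier H" for x b y
    using that unfolding E_def by - (assumption | rule R)+
  have 2: "linear_map H A (\<lambda>x. E a x b y)" if "a \<in> carrier H'" "b \<in> carrier H'" "y \<in> carrier H" for a b y
    using that unfolding E_def by - (assumption | rule R)+
  have 3: "linear_map H' A (\<lambda>b. E a x b y)" if "a \<in> carrier H'" "x \<in> carrier H" "y \<in> carrier H" for a x y
    using that unfolding E_def by - (assumption | rule R)+
  have 4: "linear_map H A (\<lambda>y. E a x b y)" if "a \<in> carrier H'" "x \<in> carrier H" "b \<in> carrier H'" for a x b
    using that unfolding E_def by - (assumption | rule R)+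
  have eq: "dcp = (\<lambda>s t. tlift H' H (\<lambda>a x. tlift H' H (\<lambda>b y. E a x b y) t) s)"
    by (simp add: dcp_mult_def E_def fun_eq_iff)
  note ext = tensor_bilinear_ext[OF H'.vspace H.vspace H'.vspace H.vspace TA.vs_T 1 2 3 4]
  have "bilinear_map (tensor H' H) (tensor H' H) A dcp"
    unfolding eq by (rule ext(1))
  then show "bilinear_map A A A dcp"
    by (simp add: bilinear_map_def TA.linear_map_T_iff TA.carrier_T)
  show "dcp (TA.pure a x) (TA.pure b y) = sweedler H x (\<lambda>x\<^sub>1 x\<^sub>2. sweedler H' b (\<lambda>b\<^sub>1 b\<^sub>2.
      TA.pure (a \<bullet>\<^bsub>H'\<^esub> left x\<^sub>1 b\<^sub>1) (right x\<^sub>2 b\<^sub>2 \<bullet>\<^bsub>H\<^esub> y)))"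
    if "a \<in> carrier H'" "x \<in> carrier H" "b \<in> carrier H'" "y \<in> carrier H" for a x b y
    unfolding eq E_def[symmetric] using that by - (rule ext(2))
qed

lemmas dcp_closed = bilinear_map_closed[OF dcp_bilinear]

section \<open>Products of points of the double cross product\<close>

lemma conv_dcp:
  assumes X: "cocommutative_coalgebra X"
    and a: "a \<in> points X H'" and x: "x \<in> points X H" and b: "b \<in> points X H'" and y: "y \<in> points X H"
  shows "conv X dcp (pair X a x) (pair X b y) =
    pair X (conv X (mult H') a (conv X left x b)) (conv X (mult H) (conv X right x b) y)"
proof
  fix z
  interpret X: cocommutative_coalgebra X by fact
  note la = points_linear[OF a] and lx = points_linear[OF x] and lb = points_linear[OF b] and ly = points_linear[OF y]
  note cl = linear_map_closed[OF la] linear_map_closed[OF lx] linear_map_closed[OF lb] linear_map_closed[OF ly]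
  let ?L = "conv X left x b" and ?R = "conv X right x b"
  have lL: "linear_map X H' ?L" and lR: "linear_map X H ?R"
    by (rule X.conv_linear[OF H'.vspace left_bilinear lx lb] X.conv_linear[OF H.vspace right_bilinear lx lb])+
  note clLR = linear_map_closed[OF lL] linear_map_closed[OF lR]
  show "conv X dcp (pair X a x) (pair X b y) z =
    pair X (conv X (mult H') a ?L) (conv X (mult H) ?R y) z"
  proof (cases "z \<in> carrier X")
    case z: True
    have "conv X dcp (pair X a x) (pair X b y) z = sweedler X z (\<lambda>p q. sweedler X p (\<lambda>s t. sweedler X q (\<lambda>u v.
        dcp (TA.pure (a s) (x t)) (TA.pure (b u) (y v)))))"
      by (rule X.conv_conv_apply[OF TA.vs_T TA.vs_T TA.vs_T TA.pure_bilinear TA.pure_bilinear dcp_bilinear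
            la lx lb ly z])
    \<comment> \<open>Only \<open>x\<close> and \<open>b\<close> interact in the product, so the
      bracketing is chosen to make their inputs the two halves of one element
      \<open>m\<close>.\<close>
    also have "\<dots> = sweedler X z (\<lambda>s r. sweedler X r (\<lambda>m v. sweedler X m (\<lambda>t u.
        dcp (TA.pure (a s) (x t)) (TA.pure (b u) (y v)))))"
      by (rule X.sweedler_quad[OF TA.vs_T _ _ _ _ z])
        (assumption | rule bilinear_map_left[OF dcp_bilinear] bilinear_map_right[OF dcp_bilinear]
          TA.pure_left TA.pure_right TA.pure_closed cl la lb lx ly)+
    also have "\<dots> = sweedler X z (\<lambda>s r. sweedler X r (\<lambda>m v. sweedler X m (\<lambda>t u.
        TA.pure (a s \<bullet>\<^bsub>H'\<^esub> ?L t) (?R u \<bullet>\<^bsub>H\<^esub> y v))))"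
    proof (rule sweedler_cong, rule sweedler_cong)
      fix s r m v assume c: "s \<in> carrier X" "r \<in> carrier X" "m \<in> carrier X" "v \<in> carrier X"
      have d: "bilinear_map H' H A (\<lambda>h k. TA.pure (a s \<bullet>\<^bsub>H'\<^esub> h) (k \<bullet>\<^bsub>H\<^esub> y v))"
        using c by - (assumption | rule bilinear_mapI bilin_rules closed_rules linear_map_ident cl)+
      have "sweedler X m (\<lambda>t u. dcp (TA.pure (a s) (x t)) (TA.pure (b u) (y v))) =
          sweedler X m (\<lambda>t u. sweedler H (x t) (\<lambda>x\<^sub>1 x\<^sub>2. sweedler H' (b u) (\<lambda>b\<^sub>1 b\<^sub>2.
            TA.pure (a s \<bullet>\<^bsub>H'\<^esub> left x\<^sub>1 b\<^sub>1) (right x\<^sub>2 b\<^sub>2 \<bullet>\<^bsub>H\<^esub> y v))))"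
        using c by (intro sweedler_cong dcp_pure cl)
      \<comment> \<open>After regrouping, the pieces of \<open>x t\<close> and \<open>b u\<close>
        meet once in each action, which gives the points \<open>?L\<close> and
        \<open>?R\<close>.\<close>
      also have "\<dots> = conv X (\<lambda>h k. TA.pure (a s \<bullet>\<^bsub>H'\<^esub> h) (k \<bullet>\<^bsub>H\<^esub> y v)) ?L ?R m"
        by (rule X.sweedler_points_conv[OF H.coalg.coalgebra_axioms H'.coalg.coalgebra_axioms
              points_coalgebra_map[OF x] points_coalgebra_map[OF b] H'.vspace H.vspace TA.vs_T
              left_bilinear right_bilinear d c(3)])
      also have "\<dots> = sweedler X m (\<lambda>t u. TA.pure (a s \<bullet>\<^bsub>H'\<^esub> ?L t) (?R u \<bullet>\<^bsub>H\<^esub> y v))"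
        by (rule conv_apply[OF c(3)])
      finally show "sweedler X m (\<lambda>t u. dcp (TA.pure (a s) (x t)) (TA.pure (b u) (y v))) = \<dots>" .
    qed
    also have "\<dots> = sweedler X z (\<lambda>p q. sweedler X p (\<lambda>s t. sweedler X q (\<lambda>u v.
        TA.pure (a s \<bullet>\<^bsub>H'\<^esub> ?L t) (?R u \<bullet>\<^bsub>H\<^esub> y v))))"
      by (rule X.sweedler_quad[OF TA.vs_T _ _ _ _ z, symmetric])
        (assumption | rule bilin_rules closed_rules cl clLR la lb lx ly lL lR)+
    also have "\<dots> = pair X (conv X (mult H') a ?L) (conv X (mult H) ?R y) z"
      by (rule X.conv_conv_apply[OF H'.vspace H.vspace TA.vs_T H'.mult_bilinear H.mult_bilinear TA.pure_bilinear
            la lL lR ly z, symmetric])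
    finally show ?thesis .
  qed (simp add: conv_def)
qed

text \<open>For points this is the law
  \<open>x \<rhd> (a b) = (x \<rhd> a) ((x \<lhd> a) \<rhd> b)\<close> of a matched pair of groups.
  The inner sum pairs \<open>x\<close> with \<open>a\<close>, as the axiom does, while
  \<open>b\<close> stays outside.\<close>

lemma conv_left_mult:
  assumes X: "cocommutative_coalgebra X"
    and x: "x \<in> points X H" and a: "a \<in> points X H'" and b: "b \<in> points X H'"
  shows "conv X left x (conv X (mult H') a b) =
    conv X (mult H') (conv X left x a) (conv X left (conv X right x a) b)"
proof
  fix z
  interpret X: cocommutative_coalgebra X by fact
  note la = points_linear[OF a] and lx = points_linear[OF x] and lb = points_linear[OF b]
  note cl = linear_map_closed[OF la] linear_map_closed[OF lx] linear_map_closed[OF lb]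
  let ?L = "conv X left x a" and ?R = "conv X right x a"
  have lL: "linear_map X H' ?L" and lR: "linear_map X H ?R"
    by (rule X.conv_linear[OF H'.vspace left_bilinear lx la] X.conv_linear[OF H.vspace right_bilinear lx la])+
  show "conv X left x (conv X (mult H') a b) z = conv X (mult H') ?L (conv X left ?R b) z"
  proof (cases "z \<in> carrier X")
    case z: True
    show ?thesis
      unfolding X.conv_nested_right_apply'[OF H'.vspace H'.vspace H'.mult_bilinear left_bilinear lx la lb z]
        X.conv_nested_right_apply'[OF H'.vspace H'.vspace left_bilinear H'.mult_bilinear lL lR lb z]
    proof (rule sweedler_cong)
      fix p c assume c: "p \<in> carrier X" "c \<in> carrier X"
      have d: "bilinear_map H' H H' (\<lambda>h k. h \<bullet>\<^bsub>H'\<^esub> left k (b c))"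
        using c by - (assumption | rule bilinear_mapI bilin_rules closed_rules linear_map_ident cl)+
      have "sweedler X p (\<lambda>s t. left (x s) (a t \<bullet>\<^bsub>H'\<^esub> b c)) =
        sweedler X p (\<lambda>s t. sweedler H (x s) (\<lambda>x\<^sub>1 x\<^sub>2. sweedler H' (a t) (\<lambda>a\<^sub>1 a\<^sub>2.
          left x\<^sub>1 a\<^sub>1 \<bullet>\<^bsub>H'\<^esub> left (right x\<^sub>2 a\<^sub>2) (b c))))"
        using c by (intro sweedler_cong left_on_mult cl)
      also have "\<dots> = conv X (\<lambda>h k. h \<bullet>\<^bsub>H'\<^esub> left k (b c)) ?L ?R p"
        by (rule X.sweedler_points_conv[OF H.coalg.coalgebra_axioms H'.coalg.coalgebra_axioms
              points_coalgebra_map[OF x] points_coalgebra_map[OF a] H'.vspace H.vspace H'.vspace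
              left_bilinear right_bilinear d c(1)])
      also have "\<dots> = sweedler X p (\<lambda>s t. ?L s \<bullet>\<^bsub>H'\<^esub> left (?R t) (b c))"
        by (rule conv_apply[OF c(1)])
      finally show "sweedler X p (\<lambda>s t. left (x s) (a t \<bullet>\<^bsub>H'\<^esub> b c)) = \<dots>" .
    qed
  qed (simp add: conv_def)
qed

text \<open>Mirror image of \<open>conv_left_mult\<close>: now \<open>x\<close> stays outside and
  the inner sum pairs \<open>y\<close> with \<open>a\<close>.\<close>

lemma conv_right_mult:
  assumes X: "cocommutative_coalgebra X"
    and x: "x \<in> points X H" and y: "y \<in> points X H" and a: "a \<in> points X H'"
  shows "conv X right (conv X (mult H) x y) a =
    conv X (mult H) (conv X right x (conv X left y a)) (conv X right y a)"
proof
  fix z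
  interpret X: cocommutative_coalgebra X by fact
  note la = points_linear[OF a] and lx = points_linear[OF x] and ly = points_linear[OF y]
  note cl = linear_map_closed[OF la] linear_map_closed[OF lx] linear_map_closed[OF ly]
  let ?L = "conv X left y a" and ?R = "conv X right y a"
  have lL: "linear_map X H' ?L" and lR: "linear_map X H ?R"
    by (rule X.conv_linear[OF H'.vspace left_bilinear ly la] X.conv_linear[OF H.vspace right_bilinear ly la])+
  show "conv X right (conv X (mult H) x y) a z = conv X (mult H) (conv X right x ?L) ?R z"
  proof (cases "z \<in> carrier X")
    case z: True
    show ?thesis
      unfolding X.conv_nested_left_apply'[OF H.vspace H.vspace H.mult_bilinear right_bilinear lx ly la z]
        X.conv_nested_left_apply'[OF H.vspace H.vspace right_bilinear H.mult_bilinear lx lL lR z]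
    proof (rule sweedler_cong)
      fix c p assume c: "c \<in> carrier X" "p \<in> carrier X"
      have d: "bilinear_map H' H H (\<lambda>h k. right (x c) h \<bullet>\<^bsub>H\<^esub> k)"
        using c by - (assumption | rule bilinear_mapI bilin_rules closed_rules linear_map_ident cl)+
      have "sweedler X p (\<lambda>s t. right (x c \<bullet>\<^bsub>H\<^esub> y s) (a t)) =
        sweedler X p (\<lambda>s t. sweedler H (y s) (\<lambda>y\<^sub>1 y\<^sub>2. sweedler H' (a t) (\<lambda>a\<^sub>1 a\<^sub>2.
          right (x c) (left y\<^sub>1 a\<^sub>1) \<bullet>\<^bsub>H\<^esub> right y\<^sub>2 a\<^sub>2)))"
        using c by (intro sweedler_cong right_on_mult cl)
      also have "\<dots> = conv X (\<lambda>h k. right (x c) h \<bullet>\<^bsub>H\<^esub> k) ?L ?R p"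
        by (rule X.sweedler_points_conv[OF H.coalg.coalgebra_axioms H'.coalg.coalgebra_axioms
              points_coalgebra_map[OF y] points_coalgebra_map[OF a] H'.vspace H.vspace H.vspace
              left_bilinear right_bilinear d c(2)])
      also have "\<dots> = sweedler X p (\<lambda>s t. right (x c) (?L s) \<bullet>\<^bsub>H\<^esub> ?R t)"
        by (rule conv_apply[OF c(2)])
      finally show "sweedler X p (\<lambda>s t. right (x c \<bullet>\<^bsub>H\<^esub> y s) (a t)) = \<dots>" .
    qed
  qed (simp add: conv_def)
qed

lemma pair_points:
  "cocommutative_coalgebra X \<Longrightarrow> a \<in> points X H' \<Longrightarrow> x \<in> points X H \<Longrightarrow> pair X a x \<in> points X A"
  by (rule cocommutative_coalgebra.conv_points[OF _ H'.coalg.coalgebra_axioms H.coalg.coalgebra_axioms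
        TA.T.coalgebra_axioms TA.pure_bilinear_coalgebra_map])

lemma points_pairE:
  assumes "cocommutative_coalgebra X" "f \<in> points X A"
  obtains a x where "a \<in> points X H'" "x \<in> points X H" "f = pair X a x"
proof -
  interpret X: cocommutative_coalgebra X by fact
  show thesis
    using that[OF X.points_comp[OF TA.T.coalgebra_axioms assms(2) H'.coalg.coalgebra_axioms
          points_coalgebra_map[OF TA.fst_part_points]]
        X.points_comp[OF TA.T.coalgebra_axioms assms(2) H.coalg.coalgebra_axioms
          points_coalgebra_map[OF TA.snd_part_points]]]
      TA.points_decompose[OF X.coalgebra_axioms assms(2), symmetric] by blast
qed

lemma conv_action_points:
  assumes X: "cocommutative_coalgebra X"
  shows "a \<in> points X H' \<Longrightarrow> b \<in> points X H' \<Longrightarrow> conv X (mult H') a b \<in> points X H'"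
    and "x \<in> points X H \<Longrightarrow> y \<in> points X H \<Longrightarrow> conv X (mult H) x y \<in> points X H"
    and "x \<in> points X H \<Longrightarrow> b \<in> points X H' \<Longrightarrow> conv X left x b \<in> points X H'"
    and "x \<in> points X H \<Longrightarrow> b \<in> points X H' \<Longrightarrow> conv X right x b \<in> points X H"
proof -
  note c = cocommutative_coalgebra.conv_points[OF X] and cH = H.coalg.coalgebra_axioms
    and cH' = H'.coalg.coalgebra_axioms
  show "a \<in> points X H' \<Longrightarrow> b \<in> points X H' \<Longrightarrow> conv X (mult H') a b \<in> points X H'"
    by (rule c[OF cH' cH' cH' H'.mult_bilinear_coalgebra_map])
  show "x \<in> points X H \<Longrightarrow> y \<in> points X H \<Longrightarrow> conv X (mult H) x y \<in> points X H"
    by (rule c[OF cH cH cH H.mult_bilinear_coalgebra_map])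
  show "x \<in> points X H \<Longrightarrow> b \<in> points X H' \<Longrightarrow> conv X left x b \<in> points X H'"
    by (rule c[OF cH cH' cH' left_bilinear_coalgebra_map])
  show "x \<in> points X H \<Longrightarrow> b \<in> points X H' \<Longrightarrow> conv X right x b \<in> points X H"
    by (rule c[OF cH cH' cH right_bilinear_coalgebra_map])
qed

text \<open>Closure is read off in coordinates, before \<open>dcp\<close> is known to respect
  comultiplication; that fact is derived from this lemma later on.\<close>

lemma conv_dcp_points:
  assumes X: "cocommutative_coalgebra X" and f: "f \<in> points X A" and g: "g \<in> points X A"
  shows "conv X dcp f g \<in> points X A"
proof -
  obtain a x where f': "a \<in> points X H'" "x \<in> points X H" "f = pair X a x"
    by (rule points_pairE[OF X f])
  obtain b y where g': "b \<in> points X H'" "y \<in> points X H" "g = pair X b y"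
    by (rule points_pairE[OF X g])
  show ?thesis
    unfolding f'(3) g'(3) conv_dcp[OF X f'(1,2) g'(1,2)]
    by (intro pair_points conv_action_points X f' g')
qed

lemma conv_dcp_assoc:
  assumes X: "cocommutative_coalgebra X" and f: "f \<in> points X A" and g: "g \<in> points X A" and h: "h \<in> points X A"
  shows "conv X dcp (conv X dcp f g) h = conv X dcp f (conv X dcp g h)"
proof -
  interpret X: cocommutative_coalgebra X by fact
  obtain a x where f': "a \<in> points X H'" "x \<in> points X H" "f = pair X a x"
    by (rule points_pairE[OF X f])
  obtain b y where g': "b \<in> points X H'" "y \<in> points X H" "g = pair X b y"
    by (rule points_pairE[OF X g])
  obtain c w where h': "c \<in> points X H'" "w \<in> points X H" "h = pair X c w"
    by (rule points_pairE[OF X h])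
  note pts = f'(1,2) g'(1,2) h'(1,2) conv_action_points[OF X]
  let ?m = "conv X (mult H)" and ?m' = "conv X (mult H')" and ?L = "conv X left" and ?R = "conv X right"
  have left_act: "?L (?m x y) c = ?L x (?L y c)"
    if "x \<in> points X H" "y \<in> points X H" "c \<in> points X H'" for x y c
    by (rule X.conv_assoc[OF H.vspace H'.vspace H'.vspace H.mult_bilinear left_bilinear left_bilinear left_bilinear
          left_mult that[THEN points_linear]])
  have right_act: "?R (?R x a) c = ?R x (?m' a c)"
    if "x \<in> points X H" "a \<in> points X H'" "c \<in> points X H'" for x a c
    by (rule X.conv_assoc[OF H.vspace H'.vspace H.vspace right_bilinear right_bilinear right_bilinear H'.mult_bilinear
          right_mult[symmetric] that[THEN points_linear]])
  \<comment> \<open>The components in \<open>H'\<close>: both sides are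
    \<open>(a (x \<rhd> b)) ((x \<lhd> b) \<rhd> (y \<rhd> c))\<close>.\<close>
  have "?m' (?m' a (?L x b)) (?L (?m (?R x b) y) c) = ?m' a (?L x (?m' b (?L y c)))"
    by (simp add: left_act conv_left_mult[OF X] H'.alg.conv_mult_assoc[OF X.coalgebra_axioms] points_linear pts)
  \<comment> \<open>The components in \<open>H\<close>: both sides are
    \<open>(x \<lhd> (b (y \<rhd> c))) (y \<lhd> c) w\<close>.\<close>
  moreover have "?m (?R (?m (?R x b) y) c) w = ?m (?R x (?m' b (?L y c))) (?m (?R y c) w)"
    by (simp add: right_act conv_right_mult[OF X] H.alg.conv_mult_assoc[OF X.coalgebra_axioms] points_linear pts)
  ultimately show ?thesis
    unfolding f'(3) g'(3) h'(3) by (simp add: conv_dcp[OF X] pts)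
qed

section \<open>The embeddings of the two factors, and the unit\<close>

abbreviation \<iota> :: "'b \<Rightarrow> ('k, 'b, 'a) tensor" where "\<iota> a \<equiv> TA.pure a \<one>\<^bsub>H\<^esub>"
abbreviation \<kappa> :: "'a \<Rightarrow> ('k, 'b, 'a) tensor" where "\<kappa> x \<equiv> TA.pure \<one>\<^bsub>H'\<^esub> x"

lemma \<iota>_linear: "linear_map H' A \<iota>"
  by (rule TA.pure_left[OF linear_map_ident H.one_closed])

lemma \<kappa>_linear: "linear_map H A \<kappa>"
  by (rule TA.pure_right[OF linear_map_ident H'.one_closed])

text \<open>The unit of \<open>H\<close> splits as \<open>\<one> \<otimes> \<one>\<close> and acts
  trivially on the left, while \<open>\<one> \<lhd> b\<^sub>2 = \<epsilon>(b\<^sub>2) \<one>\<close>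
  makes the sum over \<open>b\<close> collapse.\<close>

lemma dcp_\<iota>_pure:
  assumes a: "a \<in> carrier H'" and b: "b \<in> carrier H'" and y: "y \<in> carrier H"
  shows "dcp (\<iota> a) (TA.pure b y) = TA.pure (a \<bullet>\<^bsub>H'\<^esub> b) y"
proof -
  note one = H.one_closed
  note R = bilin_rules closed_rules bilinear_mapI linear_map_ident H.vspace H'.vspace
    H'.coalg.sweedler_linear[OF TA.vs_T] H'.coalg.sweedler_linear_par[OF TA.vs_T]
  have "dcp (\<iota> a) (TA.pure b y) = sweedler H' b (\<lambda>b\<^sub>1 b\<^sub>2.
      TA.pure (a \<bullet>\<^bsub>H'\<^esub> left \<one>\<^bsub>H\<^esub> b\<^sub>1) (right \<one>\<^bsub>H\<^esub> b\<^sub>2 \<bullet>\<^bsub>H\<^esub> y))"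
    unfolding dcp_pure[OF a one b y]
    using a b y by - (rule H.sweedler_one[OF TA.vs_T]; (assumption | rule R)+)
  also have "\<dots> = sweedler H' b (\<lambda>b\<^sub>1 b\<^sub>2. counit H' b\<^sub>2 \<star>\<^bsub>A\<^esub> TA.pure (a \<bullet>\<^bsub>H'\<^esub> b\<^sub>1) y)"
    by (rule sweedler_cong)
      (simp add: left_one right_on_one bilinear_map_scale_left[OF H.mult_bilinear one y] H.one_mult y
        bilinear_map_scale_right[OF TA.pure_bilinear _ y] bilinear_map_closed[OF H'.mult_bilinear a])
  also have "\<dots> = TA.pure (a \<bullet>\<^bsub>H'\<^esub> b) y"
    using a b y by - (rule H'.coalg.sweedler_counit_right[OF TA.vs_T]; (assumption | rule R)+)
  finally show ?thesis .
qed

lemma dcp_pure_\<kappa>: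
  assumes a: "a \<in> carrier H'" and x: "x \<in> carrier H" and y: "y \<in> carrier H"
  shows "dcp (TA.pure a x) (\<kappa> y) = TA.pure a (x \<bullet>\<^bsub>H\<^esub> y)"
proof -
  note one = H'.one_closed
  note R = bilin_rules closed_rules bilinear_mapI linear_map_ident H.vspace H'.vspace
  have "dcp (TA.pure a x) (\<kappa> y) = sweedler H x (\<lambda>x\<^sub>1 x\<^sub>2.
      TA.pure (a \<bullet>\<^bsub>H'\<^esub> left x\<^sub>1 \<one>\<^bsub>H'\<^esub>) (right x\<^sub>2 \<one>\<^bsub>H'\<^esub> \<bullet>\<^bsub>H\<^esub> y))"
    unfolding dcp_pure[OF a x one y]
    using a x y by - (rule sweedler_cong, rule H'.sweedler_one[OF TA.vs_T]; (assumption | rule R)+)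
  also have "\<dots> = sweedler H x (\<lambda>x\<^sub>1 x\<^sub>2. counit H x\<^sub>1 \<star>\<^bsub>A\<^esub> TA.pure a (x\<^sub>2 \<bullet>\<^bsub>H\<^esub> y))"
    by (rule sweedler_cong)
      (simp add: right_one left_on_one bilinear_map_scale_right[OF H'.mult_bilinear a one] H'.mult_one a
        bilinear_map_scale_left[OF TA.pure_bilinear a] bilinear_map_closed[OF H.mult_bilinear _ y])
  also have "\<dots> = TA.pure a (x \<bullet>\<^bsub>H\<^esub> y)"
    using a x y by - (rule H.coalg.sweedler_counit_left[OF TA.vs_T]; (assumption | rule R)+)
  finally show ?thesis .
qed

lemma one_A_closed: "\<one>\<^bsub>A\<^esub> \<in> carrier A"
  unfolding A_simps by (intro TA.pure_closed H.one_closed H'.one_closed)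

lemma dcp_one_left: "t \<in> carrier A \<Longrightarrow> dcp \<one>\<^bsub>A\<^esub> t = t"
proof -
  have l: "linear_map A A (\<lambda>t. dcp \<one>\<^bsub>A\<^esub> t)"
    by (rule bilinear_map_right[OF dcp_bilinear linear_map_ident one_A_closed])
  show "t \<in> carrier A \<Longrightarrow> dcp \<one>\<^bsub>A\<^esub> t = t"
    by (rule TA.linear_eq_on_T[OF l linear_map_ident])
      (simp_all add: A_simps dcp_\<iota>_pure H'.one_closed H'.one_mult)
qed

lemma dcp_one_right: "t \<in> carrier A \<Longrightarrow> dcp t \<one>\<^bsub>A\<^esub> = t"
proof -
  have l: "linear_map A A (\<lambda>t. dcp t \<one>\<^bsub>A\<^esub>)"
    by (rule bilinear_map_left[OF dcp_bilinear linear_map_ident one_A_closed])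
  show "t \<in> carrier A \<Longrightarrow> dcp t \<one>\<^bsub>A\<^esub> = t"
    by (rule TA.linear_eq_on_T[OF l linear_map_ident])
      (simp_all add: A_simps dcp_pure_\<kappa> H.one_closed H.mult_one)
qed

text \<open>Only the coalgebra structure of \<open>A \<otimes> A\<close> is needed, so the actions are left undefined.\<close>

abbreviation AA :: "('k, ('k, ('k, 'b, 'a) tensor, ('k, 'b, 'a) tensor) tensor) hopf" where
  "AA \<equiv> double_cross_product A A undefined undefined"

sublocale TAA: cocommutative_tensor_coalgebra A A AA
  by unfold_locales (simp_all add: double_cross_product_def[of A A])

text \<open>Both identities for \<open>dcp\<close> below are identities between points of \<open>A \<otimes> A\<close> or
  \<open>(A \<otimes> A) \<otimes> A\<close>, namely between products of the projections.\<close>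

lemma dcp_bilinear_coalgebra_map: "bilinear_coalgebra_map A A A dcp"
proof -
  define \<phi> where "\<phi> = conv AA dcp TAA.fst_part TAA.snd_part"
  have \<phi>: "\<phi> \<in> points AA A"
    unfolding \<phi>_def
    by (rule conv_dcp_points[OF TAA.T.cocommutative_coalgebra_axioms TAA.fst_part_points TAA.snd_part_points])
  have \<phi>_pure: "\<phi> (TAA.pure s t) = dcp s t" if "s \<in> carrier A" "t \<in> carrier A" for s t
    unfolding \<phi>_def
    using TAA.conv_parts_eval[OF TA.vs_T dcp_bilinear linear_map_ident linear_map_ident that] .
  note l = points_linear[OF \<phi>]
  have b: "bilinear_map AA AA (tensor A A) (\<lambda>x y. \<phi> x \<otimes>\<^bsub>A,A\<^esub> \<phi> y)"
    by (rule bilinear_map_pre[OF ptensor_bilinear l l])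
  have "comult A (dcp s t) = sweedler A s (\<lambda>s\<^sub>1 s\<^sub>2. sweedler A t (\<lambda>t\<^sub>1 t\<^sub>2. dcp s\<^sub>1 t\<^sub>1 \<otimes>\<^bsub>A,A\<^esub> dcp s\<^sub>2 t\<^sub>2))"
    if st: "s \<in> carrier A" "t \<in> carrier A" for s t
  proof -
    have "comult A (dcp s t) = sweedler AA (TAA.pure s t) (\<lambda>x y. \<phi> x \<otimes>\<^bsub>A,A\<^esub> \<phi> y)"
      using points_coalgebra_map[OF \<phi>] TAA.pure_closed[OF st]
      by (simp add: coalgebra_map_def \<phi>_pure[OF st, symmetric])
    also have "\<dots> = sweedler A s (\<lambda>s\<^sub>1 s\<^sub>2. sweedler A t (\<lambda>t\<^sub>1 t\<^sub>2. dcp s\<^sub>1 t\<^sub>1 \<otimes>\<^bsub>A,A\<^esub> dcp s\<^sub>2 t\<^sub>2))"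
      unfolding TAA.sweedler_pure[OF vspace_tensor b st]
      by (intro sweedler_cong) (simp add: \<phi>_pure)
    finally show ?thesis .
  qed
  moreover have "counit A (dcp s t) = counit A s * counit A t" if st: "s \<in> carrier A" "t \<in> carrier A" for s t
    using coalgebra_map_counit[OF points_coalgebra_map[OF \<phi>] TAA.pure_closed[OF st]]
    by (simp add: \<phi>_pure st TAA.counit_pure)
  ultimately show ?thesis
    by (simp add: bilinear_coalgebra_map_def dcp_bilinear)
qed

lemma dcp_assoc:
  assumes s: "s \<in> carrier A" and t: "t \<in> carrier A" and r: "r \<in> carrier A"
  shows "dcp (dcp s t) r = dcp s (dcp t r)"
proof -
  define X where "X = double_cross_product A AA undefined undefined"
  interpret TX: cocommutative_tensor_coalgebra AA A X
    by unfold_locales (simp_all add: X_def double_cross_product_def[of A AA])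
  note X = TX.T.coalgebra_axioms
  define p1 where "p1 = (\<lambda>z. TAA.fst_part (TX.fst_part z))"
  define p2 where "p2 = (\<lambda>z. TAA.snd_part (TX.fst_part z))"
  let ?p3 = "TX.snd_part"
  note cAA = TAA.T.coalgebra_axioms and cA = TA.T.coalgebra_axioms
  have p1: "p1 \<in> points X A"
    unfolding p1_def
    by (rule TX.T.points_comp[OF cAA TX.fst_part_points cA points_coalgebra_map[OF TAA.fst_part_points]])
  have p2: "p2 \<in> points X A"
    unfolding p2_def
    by (rule TX.T.points_comp[OF cAA TX.fst_part_points cA points_coalgebra_map[OF TAA.snd_part_points]])
  note lf = points_linear[OF TAA.fst_part_points] and ls = points_linear[OF TAA.snd_part_points]
  have l: "linear_map AA A (conv AA dcp TAA.fst_part TAA.snd_part)"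
    by (rule TAA.T.conv_linear[OF TA.vs_T dcp_bilinear lf ls])
  define z where "z = TX.pure (TAA.pure s t) r"
  note st = TAA.pure_closed[OF s t]
  \<comment> \<open>The first two projections factor through \<open>A \<otimes> A\<close>, so their
    product is a map on \<open>A \<otimes> A\<close> applied to the first part.\<close>
  have "conv X dcp p1 p2 = (\<lambda>z. conv AA dcp TAA.fst_part TAA.snd_part (TX.fst_part z))"
    unfolding p1_def p2_def
    by (rule TX.T.conv_pre[OF cAA TX.fst_part_points TA.vs_T dcp_bilinear lf ls, symmetric])
  then have "conv X dcp (conv X dcp p1 p2) ?p3 z = dcp (conv AA dcp TAA.fst_part TAA.snd_part (TAA.pure s t)) r"
    using TX.conv_parts_eval[OF TA.vs_T dcp_bilinear l linear_map_ident st r] by (simp add: z_def)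
  also have "\<dots> = dcp (dcp s t) r"
    using TAA.conv_parts_eval[OF TA.vs_T dcp_bilinear linear_map_ident linear_map_ident s t] by simp
  finally have 1: "conv X dcp (conv X dcp p1 p2) ?p3 z = dcp (dcp s t) r" .
  \<comment> \<open>\<open>X\<close> is bracketed as \<open>(A \<otimes> A) \<otimes> A\<close>,
    whereas \<open>dcp s (dcp t r)\<close> is bracketed to the right. \<open>\<Gamma>\<close> turns
    this product into a pairing of \<open>A \<otimes> A\<close> with \<open>A\<close>, so that it
    too can be evaluated on \<open>X\<close>.\<close>
  define \<Gamma> where "\<Gamma> \<tau> r = tlift A A (\<lambda>s t. dcp s (dcp t r)) \<tau>" for \<tau> r
  have bG: "bilinear_map A A A (\<lambda>s t. dcp s (dcp t r))" if "r \<in> carrier A" for r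
    using that by - (assumption | rule bilinear_mapI bilinear_map_left[OF dcp_bilinear]
        bilinear_map_right[OF dcp_bilinear] linear_map_ident dcp_closed)+
  have \<Gamma>: "bilinear_map AA A A \<Gamma>"
    unfolding \<Gamma>_def
    by (rule bilinear_mapI, rule tlift_bilinear_par[OF TA.vs_T TA.vs_T TA.vs_T bG])
      (assumption | rule bilinear_map_right[OF dcp_bilinear] linear_map_ident TA.vs_T bG
        | simp add: TAA.linear_map_T_iff TAA.carrier_T tlift_linear[OF TA.vs_T TA.vs_T TA.vs_T bG])+
  have \<Gamma>_pure: "\<Gamma> (TAA.pure s t) r = dcp s (dcp t r)"
    if "s \<in> carrier A" "t \<in> carrier A" "r \<in> carrier A" for s t r
    unfolding \<Gamma>_def by (rule tlift_ptensor[OF TA.vs_T TA.vs_T TA.vs_T bG[OF that(3)] that(1,2)])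
  have "conv X (\<lambda>s t. TAA.pure s t) p1 p2 = TX.fst_part"
    unfolding p1_def p2_def by (rule TAA.points_decompose[OF X TX.fst_part_points])
  moreover have "conv X \<Gamma> (conv X (\<lambda>s t. TAA.pure s t) p1 p2) ?p3 = conv X dcp p1 (conv X dcp p2 ?p3)"
    by (rule TX.T.conv_assoc[OF TAA.vs_T TA.vs_T TA.vs_T TAA.pure_bilinear \<Gamma> dcp_bilinear dcp_bilinear])
      (simp_all add: \<Gamma>_pure points_linear p1 p2 TX.snd_part_points)
  ultimately have "conv X dcp p1 (conv X dcp p2 ?p3) z = dcp s (dcp t r)"
    using TX.conv_parts_eval[OF TA.vs_T \<Gamma> linear_map_ident linear_map_ident st r]
    by (simp add: z_def \<Gamma>_pure s t r)
  then show ?thesis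
    using 1 conv_dcp_assoc[OF TX.T.cocommutative_coalgebra_axioms p1 p2 TX.snd_part_points] by simp
qed

sublocale A_alg: unital_algebra A
  by unfold_locales
    (simp_all add: TA.vs_T A_simps(1) dcp_bilinear one_A_closed dcp_assoc dcp_one_left dcp_one_right)

section \<open>The antipode of the double cross product\<close>

lemma \<iota>_unit: "(\<lambda>z. \<iota> (conv_unit A H' z)) = conv_unit A A"
  using linear_map_zero[OF H'.vspace \<iota>_linear]
  by (simp add: conv_unit_def fun_eq_iff linear_map_scale[OF \<iota>_linear H'.one_closed] A_simps(2))

lemma \<kappa>_unit: "(\<lambda>z. \<kappa> (conv_unit A H z)) = conv_unit A A"
  using linear_map_zero[OF H.vspace \<kappa>_linear]
  by (simp add: conv_unit_def fun_eq_iff linear_map_scale[OF \<kappa>_linear H.one_closed] A_simps(2))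

text \<open>The antipode is defined on pure tensors; exhibiting it as a convolution of two maps
  allows the inverse laws to be computed in the convolution monoid.\<close>

lemma antipode_A:
  defines "p \<equiv> TA.fst_part" and "q \<equiv> TA.snd_part"
  shows "linear_map A A (antipode A)"
    and "\<And>t. t \<in> carrier A \<Longrightarrow>
      antipode A t = conv A dcp (\<lambda>z. \<kappa> (antipode H (q z))) (\<lambda>z. \<iota> (antipode H' (p z))) t"
proof -
  note lp = points_linear[OF TA.fst_part_points, folded p_def]
    and lq = points_linear[OF TA.snd_part_points, folded q_def]
  note l\<kappa> = linear_map_comp[OF \<kappa>_linear H.antipode_linear] and l\<iota> = linear_map_comp[OF \<iota>_linear H'.antipode_linear]
  have opp: "bilinear_map A A A (\<lambda>s t. dcp t s)"
    using dcp_bilinear by (simp add: bilinear_map_def)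
  have b: "bilinear_map H' H A (\<lambda>a x. dcp (\<kappa> (antipode H x)) (\<iota> (antipode H' a)))"
    by (rule bilinear_map_pre[OF opp l\<iota> l\<kappa>])
  show lin: "linear_map A A (antipode A)"
    unfolding A_simps(3) TA.linear_map_T_iff by (rule tlift_linear[OF H'.vspace H.vspace TA.vs_T b])
  fix t assume t: "t \<in> carrier A"
  \<comment> \<open>\<open>conv_parts_eval\<close> has the first projection in the left slot, but
    the antipode multiplies its factors in the opposite order. Cocommutativity of \<open>A\<close>
    trades the order for the opposite pairing.\<close>
  have eq: "conv A dcp (\<lambda>z. \<kappa> (antipode H (q z))) (\<lambda>z. \<iota> (antipode H' (p z))) =
      conv A (\<lambda>s t. dcp t s) (\<lambda>z. \<iota> (antipode H' (p z))) (\<lambda>z. \<kappa> (antipode H (q z)))"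
    by (rule TA.T.conv_commute[OF TA.vs_T dcp_bilinear linear_map_comp[OF l\<kappa> lq] linear_map_comp[OF l\<iota> lp]])
  show "antipode A t = conv A dcp (\<lambda>z. \<kappa> (antipode H (q z))) (\<lambda>z. \<iota> (antipode H' (p z))) t"
  proof (rule TA.linear_eq_on_T[OF lin TA.T.conv_linear[OF TA.vs_T dcp_bilinear linear_map_comp[OF l\<kappa> lq] linear_map_comp[OF l\<iota> lp]] _ t])
    fix a x assume "a \<in> carrier H'" "x \<in> carrier H"
    then show "antipode A (TA.pure a x) =
        conv A dcp (\<lambda>z. \<kappa> (antipode H (q z))) (\<lambda>z. \<iota> (antipode H' (p z))) (TA.pure a x)"
      unfolding eq unfolding p_def q_def A_simps(3)
      using tlift_ptensor[OF H'.vspace H.vspace TA.vs_T b]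
        TA.conv_parts_eval[OF TA.vs_T opp l\<iota> l\<kappa>] by simp
  qed
qed

lemma conv_\<iota>:
  assumes "coalgebra X" "linear_map X H' a" "linear_map X H' b"
  shows "conv X dcp (\<lambda>z. \<iota> (a z)) (\<lambda>z. \<iota> (b z)) = (\<lambda>z. \<iota> (conv X (mult H') a b z))"
  by (rule coalgebra.conv_post[OF assms(1) H'.vspace TA.vs_T H'.mult_bilinear \<iota>_linear assms(2,3), symmetric])
    (simp add: dcp_\<iota>_pure H.one_closed)

lemma conv_\<kappa>:
  assumes "coalgebra X" "linear_map X H a" "linear_map X H b"
  shows "conv X dcp (\<lambda>z. \<kappa> (a z)) (\<lambda>z. \<kappa> (b z)) = (\<lambda>z. \<kappa> (conv X (mult H) a b z))"
  by (rule coalgebra.conv_post[OF assms(1) H.vspace TA.vs_T H.mult_bilinear \<kappa>_linear assms(2,3), symmetric])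
    (simp add: dcp_pure_\<kappa> H'.one_closed)

lemma conv_\<iota>_\<kappa>:
  assumes "coalgebra X" "linear_map X H' a" "linear_map X H x"
  shows "conv X dcp (\<lambda>z. \<iota> (a z)) (\<lambda>z. \<kappa> (x z)) = pair X a x"
  by (rule conv_cong)
    (simp add: dcp_\<iota>_pure H'.one_closed H'.mult_one linear_map_closed[OF assms(2)] linear_map_closed[OF assms(3)])

text \<open>The identity of \<open>A\<close> is the product of \<open>\<iota> \<circ> fst_part\<close> and \<open>\<kappa> \<circ> snd_part\<close>, and the antipode is
  the product of their inverses in the opposite order.\<close>

lemma conv_antipode_A:
  shows "conv A dcp (antipode A) (ident A) = conv_unit A A"
    and "conv A dcp (ident A) (antipode A) = conv_unit A A"
proof -
  let ?p = TA.fst_part and ?q = TA.snd_part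
  define p' where "p' = (\<lambda>z. antipode H' (?p z))"
  define q' where "q' = (\<lambda>z. antipode H (?q z))"
  note X = TA.T.coalgebra_axioms
  note lp = points_linear[OF TA.fst_part_points] and lq = points_linear[OF TA.snd_part_points]
  have lp': "linear_map A H' p'" and lq': "linear_map A H q'"
    unfolding p'_def q'_def
    by (rule linear_map_comp[OF H'.antipode_linear lp] linear_map_comp[OF H.antipode_linear lq])+
  note li = linear_map_comp[OF \<iota>_linear lp] linear_map_comp[OF \<iota>_linear lp']
    linear_map_comp[OF \<kappa>_linear lq] linear_map_comp[OF \<kappa>_linear lq']
  note hom = linear_hom_comp[OF H'.vspace \<iota>_linear points_linear_hom[OF TA.fst_part_points]]
    linear_hom_comp[OF H.vspace \<kappa>_linear points_linear_hom[OF TA.snd_part_points]]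
  have "p' \<in> linear_hom A H'" "q' \<in> linear_hom A H"
    unfolding p'_def q'_def
    by (rule linear_hom_comp[OF H'.vspace H'.antipode_linear points_linear_hom[OF TA.fst_part_points]]
        linear_hom_comp[OF H.vspace H.antipode_linear points_linear_hom[OF TA.snd_part_points]])+
  note hom' = linear_hom_comp[OF H'.vspace \<iota>_linear this(1)] linear_hom_comp[OF H.vspace \<kappa>_linear this(2)]
  let ?I = "\<lambda>z. \<iota> (?p z)" and ?K = "\<lambda>z. \<kappa> (?q z)" and ?I' = "\<lambda>z. \<iota> (p' z)" and ?K' = "\<lambda>z. \<kappa> (q' z)"
  note assoc = A_alg.conv_mult_assoc[OF X, unfolded A_simps(1)]
    and lin = A_alg.conv_mult_linear[OF X, unfolded A_simps(1)]
    and unit = A_alg.conv_mult_unit_left[OF X, unfolded A_simps(1)] A_alg.conv_mult_unit_right[OF X, unfolded A_simps(1)]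
  have id: "ident A = conv A dcp ?I ?K"
    by (simp add: conv_\<iota>_\<kappa>[OF X lp lq] TA.conv_parts)
  have S: "conv A dcp (antipode A) f = conv A dcp (conv A dcp ?K' ?I') f"
    "conv A dcp f (antipode A) = conv A dcp f (conv A dcp ?K' ?I')" for f
    by (rule conv_cong; simp add: antipode_A(2) p'_def q'_def)+
  have inv: "conv A dcp ?I' ?I = conv_unit A A" "conv A dcp ?I ?I' = conv_unit A A"
    using H'.conv_antipode_left[OF X TA.fst_part_points, folded p'_def]
      H'.conv_antipode_right[OF X TA.fst_part_points, folded p'_def]
    by (simp_all add: conv_\<iota>[OF X] lp lp' \<iota>_unit)
  have inv': "conv A dcp ?K' ?K = conv_unit A A" "conv A dcp ?K ?K' = conv_unit A A"
    using H.conv_antipode_left[OF X TA.snd_part_points, folded q'_def]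
      H.conv_antipode_right[OF X TA.snd_part_points, folded q'_def]
    by (simp_all add: conv_\<kappa>[OF X] lq lq' \<kappa>_unit)
  have "conv A dcp (conv A dcp ?K' ?I') (conv A dcp ?I ?K) = conv A dcp ?K' (conv A dcp (conv A dcp ?I' ?I) ?K)"
    by (simp add: assoc lin li)
  then show "conv A dcp (antipode A) (ident A) = conv_unit A A"
    by (simp add: S id inv inv' unit hom)
  have "conv A dcp (conv A dcp ?I ?K) (conv A dcp ?K' ?I') = conv A dcp ?I (conv A dcp (conv A dcp ?K ?K') ?I')"
    by (simp add: assoc lin li)
  then show "conv A dcp (ident A) (antipode A) = conv_unit A A"
    by (simp add: S id inv inv' unit hom')
qed

sublocale A: cocommutative_hopf_algebra A
proof
  fix x assume x: "x \<in> carrier A"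
  show "sweedler A x (\<lambda>x\<^sub>1 x\<^sub>2. antipode A x\<^sub>1 \<bullet>\<^bsub>A\<^esub> x\<^sub>2) = counit A x \<star>\<^bsub>A\<^esub> \<one>\<^bsub>A\<^esub>"
  proof -
    have "sweedler A x (\<lambda>x\<^sub>1 x\<^sub>2. antipode A x\<^sub>1 \<bullet>\<^bsub>A\<^esub> x\<^sub>2) = conv A dcp (antipode A) (ident A) x"
      unfolding conv_apply[OF x] A_simps(1) by (rule sweedler_cong) (simp add: ident_apply)
    then show ?thesis using x by (simp add: conv_antipode_A conv_unit_def)
  qed
  show "sweedler A x (\<lambda>x\<^sub>1 x\<^sub>2. x\<^sub>1 \<bullet>\<^bsub>A\<^esub> antipode A x\<^sub>2) = counit A x \<star>\<^bsub>A\<^esub> \<one>\<^bsub>A\<^esub>"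
  proof -
    have "sweedler A x (\<lambda>x\<^sub>1 x\<^sub>2. x\<^sub>1 \<bullet>\<^bsub>A\<^esub> antipode A x\<^sub>2) = conv A dcp (ident A) (antipode A) x"
      unfolding conv_apply[OF x] A_simps(1) by (rule sweedler_cong) (simp add: ident_apply)
    then show ?thesis using x by (simp add: conv_antipode_A conv_unit_def)
  qed
  show "comult A x = sweedler A x (\<lambda>x\<^sub>1 x\<^sub>2. x\<^sub>2 \<otimes>\<^bsub>A,A\<^esub> x\<^sub>1)"
    by (rule TA.T.cocommutative[OF x])
  show "sweedler A x (\<lambda>y x\<^sub>3. sweedler A y (\<lambda>x\<^sub>1 x\<^sub>2. x\<^sub>1 \<otimes>\<^bsub>A,tensor A A\<^esub> (x\<^sub>2 \<otimes>\<^bsub>A,A\<^esub> x\<^sub>3))) =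
        sweedler A x (\<lambda>x\<^sub>1 y. sweedler A y (\<lambda>x\<^sub>2 x\<^sub>3. x\<^sub>1 \<otimes>\<^bsub>A,tensor A A\<^esub> (x\<^sub>2 \<otimes>\<^bsub>A,A\<^esub> x\<^sub>3)))"
    by (rule TA.T.coassoc[OF x])
  show "sweedler A x (\<lambda>x\<^sub>1 x\<^sub>2. counit A x\<^sub>1 \<star>\<^bsub>A\<^esub> x\<^sub>2) = x" "sweedler A x (\<lambda>x\<^sub>1 x\<^sub>2. counit A x\<^sub>2 \<star>\<^bsub>A\<^esub> x\<^sub>1) = x"
    by (rule TA.T.counit_left[OF x] TA.T.counit_right[OF x])+
  fix y assume y: "y \<in> carrier A"
  show "comult A (x \<bullet>\<^bsub>A\<^esub> y) = sweedler A x (\<lambda>x\<^sub>1 x\<^sub>2. sweedler A y (\<lambda>y\<^sub>1 y\<^sub>2.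
      (x\<^sub>1 \<bullet>\<^bsub>A\<^esub> y\<^sub>1) \<otimes>\<^bsub>A,A\<^esub> (x\<^sub>2 \<bullet>\<^bsub>A\<^esub> y\<^sub>2)))" "counit A (x \<bullet>\<^bsub>A\<^esub> y) = counit A x * counit A y"
    using dcp_bilinear_coalgebra_map x y by (simp_all add: bilinear_coalgebra_map_def A_simps(1))
next
  note one = H'.one_closed H.one_closed
  note L = bilinear_map_left[OF ptensor_bilinear] bilinear_map_right[OF ptensor_bilinear]
    TA.pure_left TA.pure_right TA.pure_closed H.coalg.sweedler_linear[OF vspace_tensor]
    H.coalg.sweedler_linear_par[OF vspace_tensor] linear_map_ident bilinear_mapI H'.vspace H.vspace
  have "comult A \<one>\<^bsub>A\<^esub> = sweedler H \<one>\<^bsub>H\<^esub> (\<lambda>x\<^sub>1 x\<^sub>2. \<kappa> x\<^sub>1 \<otimes>\<^bsub>A,A\<^esub> \<kappa> x\<^sub>2)"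
    unfolding A_simps(2) TA.comult_pure[OF one]
    using one by - (rule H'.sweedler_one[OF vspace_tensor]; (assumption | rule L)+)
  also have "\<dots> = \<one>\<^bsub>A\<^esub> \<otimes>\<^bsub>A,A\<^esub> \<one>\<^bsub>A\<^esub>"
    unfolding A_simps(2) using one by - (rule H.sweedler_one[OF vspace_tensor]; (assumption | rule L)+)
  finally show "comult A \<one>\<^bsub>A\<^esub> = \<one>\<^bsub>A\<^esub> \<otimes>\<^bsub>A,A\<^esub> \<one>\<^bsub>A\<^esub>" .
  show "counit A \<one>\<^bsub>A\<^esub> = 1"
    by (simp add: A_simps(2) TA.counit_pure one H.counit_one H'.counit_one)
qed (fact TA.comult_T_linear TA.counit_T_linear antipode_A(1) A_alg.vspace A_alg.mult_bilinear A_alg.one_closed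
    A_alg.mult_assoc A_alg.one_mult A_alg.mult_one)+

end

section \<open>The image of a Hopf algebra endomorphism\<close>

text \<open>Serves both \<open>B\<close> and \<open>B'\<close>: the former for the Hopf algebra on
  its image, and both for multiplicativity along convolution.\<close>

locale hopf_endomorphism = cocommutative_hopf_algebra +
  fixes B
  assumes hom: "hopf_hom H H B"
begin

abbreviation K where "K \<equiv> hopf_image H B"

lemma K_simps: "carrier K = B ` carrier H" "scal K = scal H" "mult K = mult H" "\<one>\<^bsub>K\<^esub> = \<one>"
  "comult K = comult H" "counit K = counit H" "antipode K = antipode H"
  by (simp_all add: hopf_image_def)

lemma B_coalgebra_map: "coalgebra_map H H B"
  using hom by (simp add: hopf_hom_def)

lemmas B_linear = coalgebra_map_linear[OF B_coalgebra_map]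
lemmas B_closed = linear_map_closed[OF B_linear]

lemma B_mult: "x \<in> carrier H \<Longrightarrow> y \<in> carrier H \<Longrightarrow> B (x \<bullet> y) = B x \<bullet> B y"
  using hom by (simp add: hopf_hom_def)

lemma B_one: "B \<one> = \<one>"
  using hom by (simp add: hopf_hom_def)

lemma K_subset: "x \<in> carrier K \<Longrightarrow> x \<in> carrier H"
  using B_closed by (auto simp: K_simps)

lemma B_in_K: "x \<in> carrier H \<Longrightarrow> B x \<in> carrier K"
  by (simp add: K_simps)

lemma B_conv:
  assumes "coalgebra X" "linear_map X H f" "linear_map X H g"
  shows "(\<lambda>z. B (conv X (mult H) f g z)) = conv X (mult H) (\<lambda>z. B (f z)) (\<lambda>z. B (g z))"
  by (rule coalgebra.conv_post[OF assms(1) vspace vspace mult_bilinear B_linear assms(2,3)]) (rule B_mult)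

lemma B_conv_unit: "(\<lambda>z. B (conv_unit X H z)) = conv_unit X H"
  using linear_map_zero[OF vspace B_linear]
  by (simp add: conv_unit_def fun_eq_iff linear_map_scale[OF B_linear one_closed] B_one)

lemma B_points: "coalgebra X \<Longrightarrow> f \<in> points X H \<Longrightarrow> (\<lambda>z. B (f z)) \<in> points X H"
  using coalgebra.points_comp[OF _ coalg.coalgebra_axioms _ coalg.coalgebra_axioms B_coalgebra_map] .

text \<open>Both sides are convolution inverse to \<open>B\<close>.\<close>

lemma antipode_B:
  assumes x: "x \<in> carrier H"
  shows "antipode H (B x) = B (antipode H x)"
proof -
  note X = coalg.coalgebra_axioms and id = coalg.ident_points
  have pB: "(\<lambda>z. B (ident H z)) \<in> points H H"
    by (rule B_points[OF X id])
  have "(\<lambda>z. antipode H (B (ident H z))) = (\<lambda>z. B (antipode H (ident H z)))"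
  proof (rule alg.conv_inverse_unique[OF X points_linear_hom[OF pB]])
    show "(\<lambda>z. antipode H (B (ident H z))) \<in> linear_hom H H"
      by (rule linear_hom_comp[OF vspace antipode_linear points_linear_hom[OF pB]])
    show "(\<lambda>z. B (antipode H (ident H z))) \<in> linear_hom H H"
      by (rule linear_hom_comp[OF vspace B_linear linear_hom_comp[OF vspace antipode_linear points_linear_hom[OF id]]])
    show "conv H (mult H) (\<lambda>z. antipode H (B (ident H z))) (\<lambda>z. B (ident H z)) = conv_unit H H"
      by (rule conv_antipode_left[OF X pB])
    show "conv H (mult H) (\<lambda>z. B (ident H z)) (\<lambda>z. B (antipode H (ident H z))) = conv_unit H H"
      using B_conv[OF X points_linear[OF id] linear_map_comp[OF antipode_linear points_linear[OF id]]]
      by (simp add: conv_antipode_right[OF X id] B_conv_unit)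
  qed
  from fun_cong[OF this, of x] show ?thesis by (simp add: ident_apply x)
qed

lemma K_vspace: "vspace K"
  unfolding vspace_def
proof (intro conjI)
  show "vector_space (scal K)"
    using vspace_vector_space[OF vspace] by (simp add: K_simps)
  have "B x + B y \<in> B ` carrier H" if "x \<in> carrier H" "y \<in> carrier H" for x y
    using that by (simp add: linear_map_add[OF B_linear, symmetric] vspace_add[OF vspace])
  moreover have "c \<star> B x \<in> B ` carrier H" if "x \<in> carrier H" for c x
    using that by (simp add: linear_map_scale[OF B_linear, symmetric] vspace_scale[OF vspace])
  moreover have "0 \<in> B ` carrier H"
    using linear_map_zero[OF vspace B_linear] vspace_zero[OF vspace] by (metis image_eqI)
  ultimately show "module.subspace (scal K) (carrier K)"
    using vspace_vector_space[OF vspace]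
    by (subst module.subspace_def) (auto simp: K_simps module_iff_vector_space)
qed

lemma ptensor_K: "x \<otimes>\<^bsub>K,K\<^esub> y = x \<otimes>\<^bsub>H,H\<^esub> y"
  by (rule ptensor_scal_cong) (simp_all add: K_simps)

lemma ptensor3_K: "x \<otimes>\<^bsub>K,tensor K K\<^esub> y = x \<otimes>\<^bsub>H,tensor H H\<^esub> y"
  by (rule ptensor_scal_cong) (simp_all add: K_simps tensor_def)

text \<open>\<open>\<Delta>(B y) = B y\<^sub>1 \<otimes> B y\<^sub>2\<close> has all its terms in
  the image of \<open>B\<close>; this is why the comultiplication restricts to
  \<open>K\<close>.\<close>

lemma comult_K_repr:
  assumes x: "x \<in> carrier K"
  obtains n :: nat and v w where
    "\<forall>i<n. v i \<in> carrier K \<and> w i \<in> carrier K" "comult H x = (\<Sum>i<n. v i \<otimes>\<^bsub>H,H\<^esub> w i)"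
proof -
  obtain y where y: "y \<in> carrier H" "x = B y"
    using x by (auto simp: K_simps)
  obtain n :: nat and v w where r: "\<forall>i<n. v i \<in> carrier H \<and> w i \<in> carrier H"
      "comult H y = (\<Sum>i<n. v i \<otimes>\<^bsub>H,H\<^esub> w i)"
    using coalg.comult_repr[OF y(1)] by blast
  have "comult H x = sweedler H y (\<lambda>y\<^sub>1 y\<^sub>2. B y\<^sub>1 \<otimes>\<^bsub>H,H\<^esub> B y\<^sub>2)"
    using B_coalgebra_map y by (simp add: coalgebra_map_def)
  also have "\<dots> = (\<Sum>i<n. B (v i) \<otimes>\<^bsub>H,H\<^esub> B (w i))"
    by (rule coalg.sweedler_sum[OF vspace_tensor coalg.conv_bilinear[OF ptensor_bilinear B_linear B_linear] r])
  finally show thesis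
    using that[of n "\<lambda>i. B (v i)" "\<lambda>i. B (w i)"] r(1) by (simp add: B_in_K)
qed

lemma bilinear_map_K: "bilinear_map H H U F \<Longrightarrow> bilinear_map K K U F"
  using K_subset by (simp add: bilinear_map_def linear_map_def K_simps(2))

text \<open>The two sides are definite descriptions over decompositions with terms in
  \<open>K\<close> and in \<open>H\<close> respectively. The decomposition from
  \<open>comult_K_repr\<close> is of both kinds and therefore evaluates both.\<close>

lemma sweedler_K:
  assumes U: "vspace U" and F: "bilinear_map H H U F" and x: "x \<in> carrier K"
  shows "sweedler K x F = sweedler H x F"
proof -
  obtain n :: nat and v w where r: "\<forall>i<n. v i \<in> carrier K \<and> w i \<in> carrier K"
      "comult H x = (\<Sum>i<n. v i \<otimes>\<^bsub>H,H\<^esub> w i)"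
    using comult_K_repr[OF x] by blast
  have r': "\<forall>i<n. v i \<in> carrier H \<and> w i \<in> carrier H"
    using r(1) K_subset by blast
  have "comult K x = (\<Sum>i<n. v i \<otimes>\<^bsub>K,K\<^esub> w i)"
    by (simp only: K_simps(5) r(2) ptensor_K)
  then show ?thesis
    using tlift_sum[OF K_vspace K_vspace U bilinear_map_K[OF F] r(1)] coalg.sweedler_sum[OF U F r' r(2)]
    by (simp add: sweedler_def)
qed

lemma sweedler_K_K:
  assumes U: "vspace U" and x: "x \<in> carrier K"
    and F1: "\<And>b c. b \<in> carrier H \<Longrightarrow> c \<in> carrier H \<Longrightarrow> linear_map H U (\<lambda>a. F a b c)"
    and F2: "\<And>a c. a \<in> carrier H \<Longrightarrow> c \<in> carrier H \<Longrightarrow> linear_map H U (\<lambda>b. F a b c)"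
    and F3: "\<And>a b. a \<in> carrier H \<Longrightarrow> b \<in> carrier H \<Longrightarrow> linear_map H U (\<lambda>c. F a b c)"
  shows "sweedler K x (\<lambda>y c. sweedler K y (\<lambda>a b. F a b c)) = sweedler H x (\<lambda>y c. sweedler H y (\<lambda>a b. F a b c))"
    and "sweedler K x (\<lambda>a y. sweedler K y (\<lambda>b c. F a b c)) = sweedler H x (\<lambda>a y. sweedler H y (\<lambda>b c. F a b c))"
proof -
  note R = F1 F2 F3 bilinear_mapI coalg.sweedler_linear[OF U] coalg.sweedler_linear_par[OF U vspace] linear_map_ident
    K_subset
  have "sweedler K x (\<lambda>y c. sweedler K y (\<lambda>a b. F a b c)) = sweedler K x (\<lambda>y c. sweedler H y (\<lambda>a b. F a b c))"
    by (rule sweedler_cong, rule sweedler_K[OF U]) (assumption | rule R)+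
  also have "\<dots> = sweedler H x (\<lambda>y c. sweedler H y (\<lambda>a b. F a b c))"
    using x by - (rule sweedler_K[OF U]; (assumption | rule R)+)
  finally show "sweedler K x (\<lambda>y c. sweedler K y (\<lambda>a b. F a b c)) = \<dots>" .
  have "sweedler K x (\<lambda>a y. sweedler K y (\<lambda>b c. F a b c)) = sweedler K x (\<lambda>a y. sweedler H y (\<lambda>b c. F a b c))"
    by (rule sweedler_cong, rule sweedler_K[OF U]) (assumption | rule R)+
  also have "\<dots> = sweedler H x (\<lambda>a y. sweedler H y (\<lambda>b c. F a b c))"
    using x by - (rule sweedler_K[OF U]; (assumption | rule R)+)
  finally show "sweedler K x (\<lambda>a y. sweedler K y (\<lambda>b c. F a b c)) = \<dots>" .
qed

lemma K_mult_closed: "x \<in> carrier K \<Longrightarrow> y \<in> carrier K \<Longrightarrow> x \<bullet> y \<in> carrier K"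
  using bilinear_map_closed[OF mult_bilinear] by (auto simp: K_simps B_mult[symmetric])

lemma K_antipode_closed: "x \<in> carrier K \<Longrightarrow> antipode H x \<in> carrier K"
  using linear_map_closed[OF antipode_linear] by (auto simp: K_simps antipode_B)

lemma linear_map_K:
  "linear_map H U f \<Longrightarrow> (\<And>x. x \<in> carrier K \<Longrightarrow> f x \<in> carrier U') \<Longrightarrow> scal U' = scal U \<Longrightarrow> linear_map K U' f"
  using K_subset by (simp add: linear_map_def K_simps(2))

text \<open>The Sweedler identities are those of \<open>H\<close>, transferred by
  \<open>sweedler_K\<close>; closure holds because \<open>B\<close> commutes with product, unit,
  antipode and comultiplication.\<close>

lemma cocommutative_hopf_algebra_K: "cocommutative_hopf_algebra K"
proof
  note sub = K_subset
  note L = bilinear_map_left[OF ptensor_bilinear] bilinear_map_right[OF ptensor_bilinear] ptensor_closed linear_map_ident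
  show "vspace K" by (rule K_vspace)
  show "bilinear_map K K K (mult K)"
    using mult_bilinear sub K_mult_closed by (simp add: bilinear_map_def linear_map_def K_simps(2,3))
  show one: "\<one>\<^bsub>K\<^esub> \<in> carrier K"
    using B_in_K[OF one_closed] by (simp add: B_one K_simps(4))
  show "linear_map K (tensor K K) (comult K)"
    unfolding K_simps(5)
  proof (rule linear_map_K[OF comult_linear])
    fix x assume "x \<in> carrier K"
    then obtain n :: nat and v w where r: "\<forall>i<n. v i \<in> carrier K \<and> w i \<in> carrier K"
        "comult H x = (\<Sum>i<n. v i \<otimes>\<^bsub>H,H\<^esub> w i)"
      by (rule comult_K_repr)
    show "comult H x \<in> carrier (tensor K K)"
      unfolding r(2) ptensor_K[symmetric] using r(1)
      by (intro vspace_sum[OF vspace_tensor] ptensor_closed) auto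
  qed (simp add: tensor_def)
  show "linear_map K ground (counit K)"
    unfolding K_simps(6) by (rule linear_map_K[OF counit_linear]) (simp_all add: carrier_ground)
  show "linear_map K K (antipode K)"
    unfolding K_simps(7) by (rule linear_map_K[OF antipode_linear K_antipode_closed]) (simp_all add: K_simps(2))
  show "comult K \<one>\<^bsub>K\<^esub> = \<one>\<^bsub>K\<^esub> \<otimes>\<^bsub>K,K\<^esub> \<one>\<^bsub>K\<^esub>"
    unfolding ptensor_K by (simp add: K_simps comult_one)
  show "counit K \<one>\<^bsub>K\<^esub> = 1"
    by (simp add: K_simps counit_one)
  fix x assume x: "x \<in> carrier K"
  note sw = sweedler_K[OF _ _ x]
  show "sweedler K x (\<lambda>y x\<^sub>3. sweedler K y (\<lambda>x\<^sub>1 x\<^sub>2. x\<^sub>1 \<otimes>\<^bsub>K,tensor K K\<^esub> (x\<^sub>2 \<otimes>\<^bsub>K,K\<^esub> x\<^sub>3))) =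
      sweedler K x (\<lambda>x\<^sub>1 y. sweedler K y (\<lambda>x\<^sub>2 x\<^sub>3. x\<^sub>1 \<otimes>\<^bsub>K,tensor K K\<^esub> (x\<^sub>2 \<otimes>\<^bsub>K,K\<^esub> x\<^sub>3)))"
    unfolding ptensor_K ptensor3_K
    by (subst sweedler_K_K[OF vspace_tensor[of H "tensor H H"] x];
        (subst sweedler_K_K[OF vspace_tensor[of H "tensor H H"] x])?;
        (rule coassoc[OF sub[OF x]] | (assumption | rule L)+)?)
  show "sweedler K x (\<lambda>x\<^sub>1 x\<^sub>2. counit K x\<^sub>1 \<star>\<^bsub>K\<^esub> x\<^sub>2) = x"
    unfolding K_simps
    using sw[OF vspace bilinear_map_pre[OF bilinear_map_scal[OF vspace] counit_linear linear_map_ident]]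
      counit_left[OF sub[OF x]] by simp
  have "bilinear_map H H H (\<lambda>x\<^sub>1 x\<^sub>2. counit H x\<^sub>2 \<star> x\<^sub>1)"
    using bilinear_map_pre[OF bilinear_map_scal[OF vspace] counit_linear linear_map_ident] by (simp add: bilinear_map_def)
  from sw[OF vspace this] show "sweedler K x (\<lambda>x\<^sub>1 x\<^sub>2. counit K x\<^sub>2 \<star>\<^bsub>K\<^esub> x\<^sub>1) = x"
    unfolding K_simps using counit_right[OF sub[OF x]] by simp
  show "sweedler K x (\<lambda>x\<^sub>1 x\<^sub>2. antipode K x\<^sub>1 \<bullet>\<^bsub>K\<^esub> x\<^sub>2) = counit K x \<star>\<^bsub>K\<^esub> \<one>\<^bsub>K\<^esub>"
    unfolding K_simps
    using sw[OF vspace bilinear_map_pre[OF mult_bilinear antipode_linear linear_map_ident]]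
      antipode_left[OF sub[OF x]] by simp
  show "sweedler K x (\<lambda>x\<^sub>1 x\<^sub>2. x\<^sub>1 \<bullet>\<^bsub>K\<^esub> antipode K x\<^sub>2) = counit K x \<star>\<^bsub>K\<^esub> \<one>\<^bsub>K\<^esub>"
    unfolding K_simps
    using sw[OF vspace bilinear_map_pre[OF mult_bilinear linear_map_ident antipode_linear]]
      antipode_right[OF sub[OF x]] by simp
  have "bilinear_map H H (tensor H H) (\<lambda>x\<^sub>1 x\<^sub>2. x\<^sub>2 \<otimes>\<^bsub>H,H\<^esub> x\<^sub>1)"
    using ptensor_bilinear[of H H] by (simp add: bilinear_map_def)
  from sw[OF vspace_tensor this] show "comult K x = sweedler K x (\<lambda>x\<^sub>1 x\<^sub>2. x\<^sub>2 \<otimes>\<^bsub>K,K\<^esub> x\<^sub>1)"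
    unfolding ptensor_K using cocommutative[OF sub[OF x]] by (simp add: K_simps)
  show "\<one>\<^bsub>K\<^esub> \<bullet>\<^bsub>K\<^esub> x = x" "x \<bullet>\<^bsub>K\<^esub> \<one>\<^bsub>K\<^esub> = x"
    using one_mult[OF sub[OF x]] mult_one[OF sub[OF x]] by (simp_all add: K_simps)
  fix y assume y: "y \<in> carrier K"
  show "counit K (x \<bullet>\<^bsub>K\<^esub> y) = counit K x * counit K y"
    using counit_mult[OF sub[OF x] sub[OF y]] by (simp add: K_simps)
  note R = bilinear_mapI L coalg.sweedler_linear[OF vspace_tensor] coalg.sweedler_linear_par[OF vspace_tensor vspace]
    bilinear_map_left[OF mult_bilinear] bilinear_map_right[OF mult_bilinear] bilinear_map_closed[OF mult_bilinear]
    sub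
  have "comult K (x \<bullet>\<^bsub>K\<^esub> y) = sweedler H x (\<lambda>x\<^sub>1 x\<^sub>2. sweedler H y (\<lambda>y\<^sub>1 y\<^sub>2. (x\<^sub>1 \<bullet> y\<^sub>1) \<otimes>\<^bsub>H,H\<^esub> (x\<^sub>2 \<bullet> y\<^sub>2)))"
    using comult_mult[OF sub[OF x] sub[OF y]] by (simp add: K_simps)
  also have "\<dots> = sweedler K x (\<lambda>x\<^sub>1 x\<^sub>2. sweedler H y (\<lambda>y\<^sub>1 y\<^sub>2. (x\<^sub>1 \<bullet> y\<^sub>1) \<otimes>\<^bsub>H,H\<^esub> (x\<^sub>2 \<bullet> y\<^sub>2)))"
    using x sub[OF y] by - (rule sweedler_K[OF vspace_tensor, symmetric]; (assumption | rule R)+)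
  also have "\<dots> = sweedler K x (\<lambda>x\<^sub>1 x\<^sub>2. sweedler K y (\<lambda>y\<^sub>1 y\<^sub>2. (x\<^sub>1 \<bullet> y\<^sub>1) \<otimes>\<^bsub>H,H\<^esub> (x\<^sub>2 \<bullet> y\<^sub>2)))"
    using y by - (rule sweedler_cong, rule sweedler_K[OF vspace_tensor, symmetric]; (assumption | rule R)+)
  finally show "comult K (x \<bullet>\<^bsub>K\<^esub> y) = sweedler K x (\<lambda>x\<^sub>1 x\<^sub>2. sweedler K y (\<lambda>y\<^sub>1 y\<^sub>2.
      (x\<^sub>1 \<bullet>\<^bsub>K\<^esub> y\<^sub>1) \<otimes>\<^bsub>K,K\<^esub> (x\<^sub>2 \<bullet>\<^bsub>K\<^esub> y\<^sub>2)))"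
    unfolding ptensor_K K_simps(3) .
  fix z assume z: "z \<in> carrier K"
  show "x \<bullet>\<^bsub>K\<^esub> y \<bullet>\<^bsub>K\<^esub> z = x \<bullet>\<^bsub>K\<^esub> (y \<bullet>\<^bsub>K\<^esub> z)"
    using mult_assoc[OF sub[OF x] sub[OF y] sub[OF z]] by (simp add: K_simps)
qed

lemma coalgebra_map_K:
  assumes f: "coalgebra_map H H f" and im: "\<And>x. x \<in> carrier K \<Longrightarrow> f x \<in> carrier K"
  shows "coalgebra_map K K f"
proof -
  note l = coalgebra_map_linear[OF f]
  have "comult K (f x) = sweedler K x (\<lambda>x\<^sub>1 x\<^sub>2. f x\<^sub>1 \<otimes>\<^bsub>K,K\<^esub> f x\<^sub>2)" if x: "x \<in> carrier K" for x
    unfolding ptensor_K sweedler_K[OF vspace_tensor coalg.conv_bilinear[OF ptensor_bilinear l l] x]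
    using f K_subset[OF x] by (simp add: coalgebra_map_def K_simps(5))
  then show ?thesis
    using linear_map_K[OF l im] f K_subset by (simp add: coalgebra_map_def K_simps(2,6))
qed

text \<open>\<open>K\<close> shares its operations and its ambient tensors with \<open>H\<close>, so
  the inclusion is the identity on elements and on pure tensors.\<close>

lemma points_K: "f \<in> points X K \<Longrightarrow> f \<in> points X H"
  by (auto simp: points_def coalgebra_map_def linear_map_def K_simps(2,5,6) K_subset ptensor_K)

end

section \<open>The Rota-Baxter identity\<close>

context cocommutative_matched_pair begin

text \<open>Both maps send \<open>a \<otimes> x\<close> to
  \<open>\<epsilon>(x) a \<otimes> \<one>\<close>. The right side exhibits the operation as a
  composite of coalgebra maps.\<close>

lemma first_part_eq: "t \<in> carrier A \<Longrightarrow> first_part H H' t = \<iota> (TA.fst_part t)"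
proof -
  have b: "bilinear_map H' H A (\<lambda>a x. TA.pure a (counit H x \<star>\<^bsub>H\<^esub> \<one>\<^bsub>H\<^esub>))"
    by (rule bilinear_map_pre[OF TA.pure_bilinear linear_map_ident
          bilinear_map_left[OF bilinear_map_scal[OF H.vspace] H.counit_linear H.one_closed]])
  have l: "linear_map A A (first_part H H')"
    unfolding first_part_def TA.linear_map_T_iff by (rule tlift_linear[OF H'.vspace H.vspace TA.vs_T b])
  have l': "linear_map A A (\<lambda>t. \<iota> (TA.fst_part t))"
    by (rule linear_map_comp[OF \<iota>_linear points_linear[OF TA.fst_part_points]])
  show "t \<in> carrier A \<Longrightarrow> first_part H H' t = \<iota> (TA.fst_part t)"
  proof (rule TA.linear_eq_on_T[OF l l'])
    fix a x assume "a \<in> carrier H'" "x \<in> carrier H"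
    then show "first_part H H' (TA.pure a x) = \<iota> (TA.fst_part (TA.pure a x))"
      using tlift_ptensor[OF H'.vspace H.vspace TA.vs_T b]
      by (simp add: first_part_def TA.fst_part_pure bilinear_map_scale_left[OF TA.pure_bilinear]
          bilinear_map_scale_right[OF TA.pure_bilinear] H.one_closed)
  qed
qed

text \<open>\<open>part1\<close> and \<open>part2\<close> are \<open>P\<close> and \<open>Q\<close>
  of the overview, taken with values in \<open>A\<close> so that \<open>B\<close> and
  \<open>B'\<close> can be applied to them.\<close>

definition part1 :: "('k, 'b, 'a) tensor \<Rightarrow> ('k, 'b, 'a) tensor" where
  "part1 t = \<iota> (TA.fst_part t)"

definition part2 :: "('k, 'b, 'a) tensor \<Rightarrow> ('k, 'b, 'a) tensor" where
  "part2 t = \<kappa> (TA.snd_part t)"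

text \<open>The unit of \<open>H\<close> is grouplike, so splitting
  \<open>a \<otimes> \<one>\<close> splits only \<open>a\<close>.\<close>

lemma \<iota>_coalgebra_map: "coalgebra_map H' A \<iota>"
proof -
  note L = bilinear_map_left[OF ptensor_bilinear] bilinear_map_right[OF ptensor_bilinear]
    TA.pure_left TA.pure_right TA.pure_closed linear_map_ident bilinear_mapI
  have "comult A (\<iota> a) = sweedler H' a (\<lambda>a\<^sub>1 a\<^sub>2. \<iota> a\<^sub>1 \<otimes>\<^bsub>A,A\<^esub> \<iota> a\<^sub>2)" if a: "a \<in> carrier H'" for a
    unfolding TA.comult_pure[OF a H.one_closed]
    by (rule sweedler_cong, rule H.sweedler_one[OF vspace_tensor]) (assumption | rule L)+
  then show ?thesis
    by (simp add: coalgebra_map_def \<iota>_linear TA.counit_pure H.one_closed H.counit_one)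
qed

lemma \<kappa>_coalgebra_map: "coalgebra_map H A \<kappa>"
proof -
  note L = bilinear_map_left[OF ptensor_bilinear] bilinear_map_right[OF ptensor_bilinear]
    TA.pure_left TA.pure_right TA.pure_closed linear_map_ident bilinear_mapI
    H.coalg.sweedler_linear[OF vspace_tensor] H.coalg.sweedler_linear_par[OF vspace_tensor] H'.vspace
  have "comult A (\<kappa> x) = sweedler H x (\<lambda>x\<^sub>1 x\<^sub>2. \<kappa> x\<^sub>1 \<otimes>\<^bsub>A,A\<^esub> \<kappa> x\<^sub>2)" if x: "x \<in> carrier H" for x
    unfolding TA.comult_pure[OF H'.one_closed x]
    using x by - (rule H'.sweedler_one[OF vspace_tensor]; (assumption | rule L)+)
  then show ?thesis
    by (simp add: coalgebra_map_def \<kappa>_linear TA.counit_pure H'.one_closed H'.counit_one)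
qed

lemma part1_points: "part1 \<in> points A A"
  unfolding part1_def[abs_def]
  by (rule TA.T.points_comp[OF H'.coalg.coalgebra_axioms TA.fst_part_points TA.T.coalgebra_axioms \<iota>_coalgebra_map])

lemma part2_points: "part2 \<in> points A A"
  unfolding part2_def[abs_def]
  by (rule TA.T.points_comp[OF H.coalg.coalgebra_axioms TA.snd_part_points TA.T.coalgebra_axioms \<kappa>_coalgebra_map])

lemma conv_parts12:
  assumes X: "cocommutative_coalgebra X" and f: "f \<in> points X A"
  shows "conv X dcp (\<lambda>z. part1 (f z)) (\<lambda>z. part2 (f z)) = f"
proof -
  interpret X: cocommutative_coalgebra X by fact
  note lp = linear_map_comp[OF points_linear[OF TA.fst_part_points] points_linear[OF f]]
    linear_map_comp[OF points_linear[OF TA.snd_part_points] points_linear[OF f]]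
  show ?thesis
    unfolding part1_def part2_def conv_\<iota>_\<kappa>[OF X.coalgebra_axioms lp]
    by (rule TA.points_decompose[OF X.coalgebra_axioms f])
qed

text \<open>The first part respects left multiplication from \<open>H'\<close> and is blind to right
  multiplication from \<open>H\<close>. In coordinates each of these changes a single entry of
  \<open>(b, y)\<close>, giving \<open>(a b, y)\<close> and \<open>(b, y x)\<close>.\<close>

lemma part1_conv:
  assumes X: "cocommutative_coalgebra X" and f: "f \<in> points X A" and g: "g \<in> points X A"
  shows "(\<lambda>z. part1 (conv X dcp (\<lambda>z. part1 (f z)) g z)) =
      conv X dcp (\<lambda>z. part1 (f z)) (\<lambda>z. part1 (g z))"
    and "(\<lambda>z. part1 (conv X dcp g (\<lambda>z. part2 (f z)) z)) = (\<lambda>z. part1 (g z))"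
proof -
  interpret X: cocommutative_coalgebra X by fact
  note cX = X.coalgebra_axioms
  define a where "a = (\<lambda>z. TA.fst_part (f z))"
  define x where "x = (\<lambda>z. TA.snd_part (f z))"
  have la: "linear_map X H' a" and lx: "linear_map X H x"
    unfolding a_def x_def
    by (rule linear_map_comp[OF points_linear[OF TA.fst_part_points] points_linear[OF f]]
        linear_map_comp[OF points_linear[OF TA.snd_part_points] points_linear[OF f]])+
  have ax: "a \<in> points X H'" "x \<in> points X H"
    unfolding a_def x_def
    by (rule X.points_comp[OF TA.T.coalgebra_axioms f H'.coalg.coalgebra_axioms
          points_coalgebra_map[OF TA.fst_part_points]]
        X.points_comp[OF TA.T.coalgebra_axioms f H.coalg.coalgebra_axioms
          points_coalgebra_map[OF TA.snd_part_points]])+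
  obtain b y where g': "b \<in> points X H'" "y \<in> points X H" "g = pair X b y"
    by (rule points_pairE[OF X g])
  note lb = points_linear[OF g'(1)] and ly = points_linear[OF g'(2)]
  have fst: "part1 (pair X c w z) = \<iota> (c z)" if "c \<in> points X H'" "w \<in> points X H" for c w z
    using fun_cong[OF TA.fst_part_conv[OF cX that]] by (simp add: part1_def)
  have b\<iota>: "bilinear_map H' A A (\<lambda>v t. dcp (\<iota> v) t)" and b\<kappa>: "bilinear_map A H A (\<lambda>t v. dcp t (\<kappa> v))"
    by (rule bilinear_map_pre[OF dcp_bilinear \<iota>_linear linear_map_ident]
        bilinear_map_pre[OF dcp_bilinear linear_map_ident \<kappa>_linear])+
  \<comment> \<open>Left multiplication by elements of \<open>H'\<close> is read as a pairing of
    \<open>H'\<close> with \<open>A\<close>, so that \<open>conv_assoc\<close> moves it into the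
    first entry of the pair.\<close>
  have "conv X dcp (\<lambda>z. part1 (f z)) g = conv X (\<lambda>v t. dcp (\<iota> v) t) a (pair X b y)"
    unfolding g'(3) by (rule conv_cong) (simp add: part1_def a_def)
  also have "\<dots> = pair X (conv X (mult H') a b) y"
    by (rule X.conv_assoc[OF H'.vspace TA.vs_T TA.vs_T H'.mult_bilinear TA.pure_bilinear b\<iota> TA.pure_bilinear _ la lb ly,
          symmetric]) (rule dcp_\<iota>_pure[symmetric])
  finally have 1: "conv X dcp (\<lambda>z. part1 (f z)) g = \<dots>" .
  have "conv X dcp (\<lambda>z. part1 (f z)) (\<lambda>z. part1 (g z)) = conv X dcp (\<lambda>z. \<iota> (a z)) (\<lambda>z. \<iota> (b z))"
    by (rule conv_cong) (simp add: g'(3) fst[OF g'(1,2)] part1_def[of "f _"] a_def)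
  then show "(\<lambda>z. part1 (conv X dcp (\<lambda>z. part1 (f z)) g z)) =
      conv X dcp (\<lambda>z. part1 (f z)) (\<lambda>z. part1 (g z))"
    unfolding 1 by (simp add: fst[OF conv_action_points(1)[OF X ax(1) g'(1)] g'(2)] conv_\<iota>[OF cX la lb])
  have "conv X dcp g (\<lambda>z. part2 (f z)) = conv X (\<lambda>t v. dcp t (\<kappa> v)) (pair X b y) x"
    unfolding g'(3) by (rule conv_cong) (simp add: part2_def x_def)
  also have "\<dots> = pair X b (conv X (mult H) y x)"
    by (rule X.conv_assoc[OF TA.vs_T H.vspace TA.vs_T TA.pure_bilinear b\<kappa> TA.pure_bilinear H.mult_bilinear _ lb ly lx])
      (rule dcp_pure_\<kappa>)
  finally have 2: "conv X dcp g (\<lambda>z. part2 (f z)) = \<dots>" .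
  show "(\<lambda>z. part1 (conv X dcp g (\<lambda>z. part2 (f z)) z)) = (\<lambda>z. part1 (g z))"
    unfolding 2 unfolding g'(3)
    by (simp only: fst[OF g'(1) conv_action_points(2)[OF X g'(2) ax(2)]] fst[OF g'(1,2)])
qed

end

section \<open>Projection homomorphism pairs\<close>

locale projection_pair = cocommutative_matched_pair +
  fixes B B'
  assumes proj: "projection_hom_pair H H' left right B B'"
begin

sublocale E: hopf_endomorphism A B
  by unfold_locales (use proj in \<open>simp add: projection_hom_pair_def Let_def\<close>)

sublocale E': hopf_endomorphism A B'
  by unfold_locales (use proj in \<open>simp add: projection_hom_pair_def Let_def\<close>)

text \<open>Idempotence of \<open>B\<close> enters here.\<close>

lemma B_on_K: "x \<in> carrier E.K \<Longrightarrow> B x = x"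
  using proj by (auto simp: projection_hom_pair_def Let_def E.K_simps)

lemma conv_B_B':
  assumes X: "coalgebra X" and f: "f \<in> points X A"
  shows "conv X dcp (\<lambda>z. B (f z)) (\<lambda>z. B' (f z)) = f"
proof -
  interpret X: coalgebra X by fact
  have 1: "(\<lambda>z. conv A dcp B B' (f z)) = conv X dcp (\<lambda>z. B (f z)) (\<lambda>z. B' (f z))"
    by (rule X.conv_pre[OF TA.T.coalgebra_axioms f TA.vs_T dcp_bilinear E.B_linear E'.B_linear])
  have 2: "conv A dcp B B' (f z) = f z" for z
  proof (cases "z \<in> carrier X")
    case True
    then show ?thesis
      using proj linear_map_closed[OF points_linear[OF f]]
      by (simp add: conv_apply projection_hom_pair_def Let_def A_simps(1))
  next
    case False
    then show ?thesis
      using linear_hom_outside[OF points_linear_hom[OF f] False]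
        linear_map_zero[OF TA.vs_T TA.T.conv_linear[OF TA.vs_T dcp_bilinear E.B_linear E'.B_linear]]
      by simp
  qed
  show ?thesis using 1 unfolding 2 by (rule sym)
qed

text \<open>Here \<open>f = B(f) B'(f) = f B'(f)\<close>, and cancelling the invertible point
  \<open>f\<close> on the left leaves the unit.\<close>

lemma B'_trivial_on_K:
  assumes X: "coalgebra X" and f: "f \<in> points X A" and Bf: "(\<lambda>z. B (f z)) = f"
  shows "(\<lambda>z. B' (f z)) = conv_unit X A"
proof -
  note S = linear_map_comp[OF A.antipode_linear points_linear[OF f]]
    and B'f = E'.B_points[OF X f]
  have "(\<lambda>z. B' (f z)) = conv X dcp (conv X dcp (\<lambda>z. antipode A (f z)) f) (\<lambda>z. B' (f z))"
    using A.conv_antipode_left[OF X f] A_alg.conv_mult_unit_left[OF X points_linear_hom[OF B'f]]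
    by (simp add: A_simps(1))
  also have "\<dots> = conv X dcp (\<lambda>z. antipode A (f z)) (conv X dcp f (\<lambda>z. B' (f z)))"
    using A_alg.conv_mult_assoc[OF X S points_linear[OF f] points_linear[OF B'f]] by (simp add: A_simps(1))
  also have "conv X dcp f (\<lambda>z. B' (f z)) = f"
    using conv_B_B'[OF X f] by (simp only: fun_cong[OF Bf])
  also have "conv X dcp (\<lambda>z. antipode A (f z)) f = conv_unit X A"
    using A.conv_antipode_left[OF X f] by (simp add: A_simps(1))
  finally show ?thesis .
qed

lemma rota_baxter_points:
  assumes X: "cocommutative_coalgebra X" and \<xi>: "\<xi> \<in> points X A" and \<eta>: "\<eta> \<in> points X A"
    and B\<xi>: "(\<lambda>z. B (\<xi> z)) = \<xi>" and B\<eta>: "(\<lambda>z. B (\<eta> z)) = \<eta>"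
  shows "conv X dcp (\<lambda>z. B (part1 (\<xi> z))) (\<lambda>z. B (part1 (\<eta> z))) =
    (\<lambda>z. B (part1 (conv X dcp (conv X dcp (\<lambda>z. B (part1 (\<xi> z))) \<eta>)
      (conv X dcp (\<lambda>z. antipode A (B (part1 (\<xi> z)))) \<xi>) z)))"
proof -
  interpret X: cocommutative_coalgebra X by fact
  note cX = X.coalgebra_axioms
  let ?P\<xi> = "\<lambda>z. part1 (\<xi> z)" and ?Q\<xi> = "\<lambda>z. part2 (\<xi> z)" and ?P\<eta> = "\<lambda>z. part1 (\<eta> z)"
  have P\<xi>: "?P\<xi> \<in> points X A" and P\<eta>: "?P\<eta> \<in> points X A" and Q\<xi>: "?Q\<xi> \<in> points X A"
    using X.points_comp[OF TA.T.coalgebra_axioms _ TA.T.coalgebra_axioms points_coalgebra_map[OF part1_points]]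
      X.points_comp[OF TA.T.coalgebra_axioms _ TA.T.coalgebra_axioms points_coalgebra_map[OF part2_points]]
      \<xi> \<eta> by blast+
  note B = E.B_conv[OF cX, unfolded A_simps(1)] and B' = E'.B_conv[OF cX, unfolded A_simps(1)]
  note assoc = A_alg.conv_mult_assoc[OF cX, unfolded A_simps(1)]
    and unit_left = A_alg.conv_mult_unit_left[OF cX, unfolded A_simps(1)]
    and unit_right = A_alg.conv_mult_unit_right[OF cX, unfolded A_simps(1)]
    and inv_left = A.conv_antipode_left[OF cX, unfolded A_simps(1)]
  note pts = \<xi> \<eta> P\<xi> P\<eta> Q\<xi> conv_dcp_points[OF X] E.B_points[OF cX] E'.B_points[OF cX]
  \<comment> \<open>\<open>\<eta>\<close> is placed between the two parts of \<open>\<xi>\<close>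
    for two reasons: \<open>B'\<close> erases \<open>\<eta>\<close>, after which the parts rejoin to
    \<open>\<xi>\<close>, and \<open>part1\<close> sees only what stands to the left of
    \<open>part2\<close>.\<close>
  define u where "u = conv X dcp (conv X dcp ?P\<xi> \<eta>) ?Q\<xi>"
  have u: "u \<in> points X A"
    unfolding u_def by (intro pts)
  have "(\<lambda>z. B' (u z)) = conv X dcp (conv X dcp (\<lambda>z. B' (?P\<xi> z)) (\<lambda>z. B' (\<eta> z))) (\<lambda>z. B' (?Q\<xi> z))"
    unfolding u_def by (simp add: B' points_linear pts)
  also have "\<dots> = conv X dcp (\<lambda>z. B' (?P\<xi> z)) (\<lambda>z. B' (?Q\<xi> z))"
    by (simp add: B'_trivial_on_K[OF cX \<eta> B\<eta>] unit_right points_linear_hom pts)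
  also have "\<dots> = (\<lambda>z. B' (conv X dcp ?P\<xi> ?Q\<xi> z))"
    by (simp add: B' points_linear pts)
  also have "\<dots> = conv_unit X A"
    by (simp add: conv_parts12[OF X \<xi>] B'_trivial_on_K[OF cX \<xi> B\<xi>])
  finally have B'u: "(\<lambda>z. B' (u z)) = conv_unit X A" .
  have "u = conv X dcp (\<lambda>z. B (u z)) (\<lambda>z. B' (u z))"
    by (rule conv_B_B'[OF cX u, symmetric])
  also have "\<dots> = (\<lambda>z. B (u z))"
    by (simp add: B'u unit_right points_linear_hom pts u)
  also have "\<dots> = conv X dcp (conv X dcp (\<lambda>z. B (?P\<xi> z)) (\<lambda>z. B (\<eta> z))) (\<lambda>z. B (?Q\<xi> z))"
    unfolding u_def by (simp add: B points_linear pts)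
  also have "(\<lambda>z. B (\<eta> z)) = \<eta>" by (rule B\<eta>)
  \<comment> \<open>Since \<open>\<xi>\<close> is fixed by \<open>B\<close>, it factors as
    \<open>B(P(\<xi>)) B(Q(\<xi>))\<close>; this is solved for the second factor.\<close>
  also have "(\<lambda>z. B (?Q\<xi> z)) = conv X dcp (\<lambda>z. antipode A (B (?P\<xi> z))) \<xi>"
  proof -
    note S = linear_map_comp[OF A.antipode_linear points_linear[OF E.B_points[OF cX P\<xi>]]]
    have "\<xi> = (\<lambda>z. B (conv X dcp ?P\<xi> ?Q\<xi> z))"
      by (simp add: conv_parts12[OF X \<xi>] B\<xi>)
    also have "\<dots> = conv X dcp (\<lambda>z. B (?P\<xi> z)) (\<lambda>z. B (?Q\<xi> z))"
      by (simp add: B points_linear pts)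
    finally have "conv X dcp (\<lambda>z. antipode A (B (?P\<xi> z))) \<xi> =
        conv X dcp (\<lambda>z. antipode A (B (?P\<xi> z))) (conv X dcp (\<lambda>z. B (?P\<xi> z)) (\<lambda>z. B (?Q\<xi> z)))"
      by (rule arg_cong)
    also have "\<dots> = conv X dcp (conv X dcp (\<lambda>z. antipode A (B (?P\<xi> z))) (\<lambda>z. B (?P\<xi> z))) (\<lambda>z. B (?Q\<xi> z))"
      by (rule assoc[symmetric]) (simp_all add: S points_linear pts)
    also have "\<dots> = (\<lambda>z. B (?Q\<xi> z))"
      by (simp add: inv_left[OF E.B_points[OF cX P\<xi>]] unit_left points_linear_hom pts)
    finally show ?thesis ..
  qed
  finally have u': "u = conv X dcp (conv X dcp (\<lambda>z. B (?P\<xi> z)) \<eta>)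
      (conv X dcp (\<lambda>z. antipode A (B (?P\<xi> z))) \<xi>)" .
  have "(\<lambda>z. part1 (u z)) = (\<lambda>z. part1 (conv X dcp ?P\<xi> \<eta> z))"
    unfolding u_def by (rule part1_conv(2)[OF X \<xi>]) (intro pts)
  also have "\<dots> = conv X dcp ?P\<xi> ?P\<eta>"
    by (rule part1_conv(1)[OF X \<xi> \<eta>])
  finally have "(\<lambda>z. B (part1 (u z))) = (\<lambda>z. B (conv X dcp ?P\<xi> ?P\<eta> z))"
    by (rule arg_cong[where f = "\<lambda>h z. B (h z)"])
  also have "\<dots> = conv X dcp (\<lambda>z. B (?P\<xi> z)) (\<lambda>z. B (?P\<eta> z))"
    by (simp add: B points_linear pts)
  finally show ?thesis
    unfolding u' ..
qed

definition C where "C z = B (part1 z)"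

lemma C_points: "C \<in> points A A"
  unfolding C_def[abs_def] by (rule E.B_points[OF TA.T.coalgebra_axioms part1_points])

lemma C_in_K: "x \<in> carrier A \<Longrightarrow> C x \<in> carrier E.K"
  unfolding C_def by (rule E.B_in_K[OF linear_map_closed[OF points_linear[OF part1_points]]])

lemma first_part_C: "x \<in> carrier A \<Longrightarrow> B (first_part H H' x) = C x"
  by (simp add: C_def part1_def first_part_eq)

sublocale K: cocommutative_hopf_algebra E.K
  by (rule E.cocommutative_hopf_algebra_K)

text \<open>The universal case of \<open>rota_baxter_points\<close>: the projections of
  \<open>K \<otimes> K\<close> take values in \<open>K\<close>, hence are fixed by \<open>B\<close>,
  and evaluation at \<open>x \<otimes> y\<close> gives the identity for the elements.\<close>

lemma rota_baxter_C:
  assumes x: "x \<in> carrier E.K" and y: "y \<in> carrier E.K"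
  shows "dcp (C x) (C y) = C (sweedler3 E.K x (\<lambda>x\<^sub>1 x\<^sub>2 x\<^sub>3. dcp (dcp (dcp (C x\<^sub>1) y) (antipode A (C x\<^sub>2))) x\<^sub>3))"
proof -
  let ?K = "E.K"
  define X where "X = double_cross_product ?K ?K undefined undefined"
  interpret TX: cocommutative_tensor_coalgebra ?K ?K X
    by unfold_locales (simp_all add: X_def double_cross_product_def[of ?K ?K])
  note X = TX.T.cocommutative_coalgebra_axioms
  let ?f = TX.fst_part and ?g = TX.snd_part
  have f: "?f \<in> points X A" and g: "?g \<in> points X A"
    by (rule E.points_K TX.fst_part_points TX.snd_part_points)+
  have Bf: "(\<lambda>z. B (h z)) = h" if h: "h \<in> points X ?K" for h
  proof
    show "B (h z) = h z" for z
      using B_on_K linear_map_closed[OF points_linear[OF h]] linear_hom_outside[OF points_linear_hom[OF h]]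
        linear_map_zero[OF TA.vs_T E.B_linear] by (cases "z \<in> carrier X") simp_all
  qed
  define S where "S t = antipode A (C t)" for t
  have lid: "linear_map ?K A (\<lambda>t. t)"
    by (simp add: linear_map_def E.K_simps(2) E.K_subset)
  have lC: "linear_map ?K A C"
    using linear_map_comp[OF points_linear[OF C_points] lid] .
  have lS: "linear_map ?K A S"
    unfolding S_def[abs_def] by (rule linear_map_comp[OF A.antipode_linear lC])
  \<comment> \<open>\<open>\<gamma>\<close> inserts the fixed element \<open>y\<close> between two
    factors, so that the value at \<open>x \<otimes> y\<close> becomes a convolution on
    \<open>K\<close> in \<open>x\<close> alone.\<close>
  define \<gamma> where "\<gamma> s t = dcp (dcp s y) t" for s t
  note yA = E.K_subset[OF y]
  have b\<gamma>: "bilinear_map A A A \<gamma>"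
    unfolding \<gamma>_def using yA
    by - (assumption | rule bilinear_mapI bilinear_map_left[OF dcp_bilinear] bilinear_map_right[OF dcp_bilinear]
        linear_map_ident dcp_closed)+
  have 1: "conv X dcp (\<lambda>z. C (?f z)) (\<lambda>z. C (?g z)) = (\<lambda>z. C (conv X dcp (conv X dcp (\<lambda>z. C (?f z)) ?g)
      (conv X dcp (\<lambda>z. S (?f z)) ?f) z))"
    unfolding C_def S_def by (rule rota_baxter_points[OF X f g Bf[OF TX.fst_part_points] Bf[OF TX.snd_part_points]])
  \<comment> \<open>This product depends on the first projection only, so it is a map on
    \<open>K\<close> composed with that projection. As a single factor it fits
    \<open>conv_fst_snd_fst_eval\<close>, which splits \<open>x\<close> just once.\<close>
  have 2: "conv X dcp (\<lambda>z. S (?f z)) ?f = (\<lambda>z. conv ?K dcp S (\<lambda>t. t) (?f z))"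
    by (rule TX.T.conv_pre[OF K.coalg.coalgebra_axioms TX.fst_part_points TA.vs_T dcp_bilinear lS lid, symmetric])
  have eq: "conv X dcp (\<lambda>z. C (?f z)) (\<lambda>z. C (?g z)) (TX.pure x y) =
      C (conv X dcp (conv X dcp (\<lambda>z. C (?f z)) ?g) (\<lambda>z. conv ?K dcp S (\<lambda>t. t) (?f z)) (TX.pure x y))"
    using fun_cong[OF 1, of "TX.pure x y"] unfolding 2 .
  have "conv X dcp (conv X dcp (\<lambda>z. C (?f z)) ?g) (\<lambda>z. conv ?K dcp S (\<lambda>t. t) (?f z)) (TX.pure x y) =
      sweedler ?K x (\<lambda>x\<^sub>1 x\<^sub>2. \<gamma> (C x\<^sub>1) (conv ?K dcp S (\<lambda>t. t) x\<^sub>2))"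
    unfolding \<gamma>_def
    by (rule TX.conv_fst_snd_fst_eval[OF TA.vs_T TA.vs_T dcp_bilinear dcp_bilinear lC lid _ x y])
      (rule K.coalg.conv_linear[OF TA.vs_T dcp_bilinear lS lid])
  also have "\<dots> = conv ?K \<gamma> C (conv ?K dcp S (\<lambda>t. t)) x"
    by (rule conv_apply[OF x, symmetric])
  \<comment> \<open>Here the first half of \<open>x\<close> is split again rather than the second,
    to match the bracketing in \<open>sweedler3\<close>.\<close>
  also have "\<dots> = sweedler ?K x (\<lambda>p x\<^sub>3. sweedler ?K p (\<lambda>x\<^sub>1 x\<^sub>2. \<gamma> (C x\<^sub>1) (dcp (S x\<^sub>2) x\<^sub>3)))"
    by (rule K.coalg.conv_nested_right_apply'[OF TA.vs_T TA.vs_T dcp_bilinear b\<gamma> lC lS lid x])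
  also have "\<dots> = sweedler3 ?K x (\<lambda>x\<^sub>1 x\<^sub>2 x\<^sub>3. dcp (dcp (dcp (C x\<^sub>1) y) (antipode A (C x\<^sub>2))) x\<^sub>3)"
    unfolding sweedler3_def \<gamma>_def
  proof (rule sweedler_cong, rule sweedler_cong)
    fix p x3 x1 x2 assume "x3 \<in> carrier ?K" "x1 \<in> carrier ?K" "x2 \<in> carrier ?K"
    then show "dcp (dcp (C x1) y) (dcp (S x2) x3) = dcp (dcp (dcp (C x1) y) (antipode A (C x2))) x3"
      using linear_map_closed[OF lC] linear_map_closed[OF lS] E.K_subset yA
      by (simp add: dcp_assoc[of "dcp (C x1) y"] dcp_closed S_def)
  qed
  finally show ?thesis
    using eq TX.conv_parts_eval[OF TA.vs_T dcp_bilinear lC lC x y] by simp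
qed

text \<open>Outside the carrier of \<open>A\<close> the map \<open>C\<close> vanishes while
  \<open>first_part\<close> is unspecified, but the two operators agree on \<open>K\<close>, and the
  properties are carried over there.\<close>

lemma rota_baxter_first_part: "rota_baxter_operator E.K (\<lambda>z. B (first_part H H' z))"
proof -
  let ?K = "E.K" and ?R = "\<lambda>z. B (first_part H H' z)"
  have R: "C z = ?R z" if "z \<in> carrier ?K" for z
    by (rule first_part_C[OF E.K_subset[OF that], symmetric])
  have "coalgebra_map ?K ?K C"
    by (rule E.coalgebra_map_K[OF points_coalgebra_map[OF C_points] C_in_K[OF E.K_subset]])
  then have "coalgebra_map ?K ?K ?R"
    by (rule coalgebra_map_cong[OF K.vspace _ R])
  moreover have "?R x \<bullet>\<^bsub>?K\<^esub> ?R y = ?R (sweedler3 ?K x (\<lambda>x\<^sub>1 x\<^sub>2 x\<^sub>3.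
      ?R x\<^sub>1 \<bullet>\<^bsub>?K\<^esub> y \<bullet>\<^bsub>?K\<^esub> antipode ?K (?R x\<^sub>2) \<bullet>\<^bsub>?K\<^esub> x\<^sub>3))"
    if x: "x \<in> carrier ?K" and y: "y \<in> carrier ?K" for x y
  proof -
    let ?F = "\<lambda>x\<^sub>1 x\<^sub>2 x\<^sub>3. dcp (dcp (dcp (C x\<^sub>1) y) (antipode A (C x\<^sub>2))) x\<^sub>3"
    have "sweedler3 ?K x (\<lambda>x\<^sub>1 x\<^sub>2 x\<^sub>3. ?R x\<^sub>1 \<bullet>\<^bsub>?K\<^esub> y \<bullet>\<^bsub>?K\<^esub> antipode ?K (?R x\<^sub>2) \<bullet>\<^bsub>?K\<^esub> x\<^sub>3) =
        sweedler3 ?K x ?F"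
      unfolding sweedler3_def by (intro sweedler_cong) (simp add: R[symmetric] E.K_simps(3,7) A_simps(1))
    \<comment> \<open>The outer operator can be rewritten to \<open>C\<close> once its argument is
      known to lie in \<open>K\<close>.\<close>
    moreover have "sweedler3 ?K x ?F \<in> carrier ?K"
    proof -
      note lC = coalgebra_map_linear[OF \<open>coalgebra_map ?K ?K C\<close>]
        and lS = K.antipode_linear[unfolded E.K_simps(7)]
        and m = K.mult_bilinear[unfolded E.K_simps(3) A_simps(1)]
      note R = bilinear_map_left[OF m] bilinear_map_right[OF m] bilinear_map_closed[OF m] bilinear_mapI
        lC linear_map_comp[OF lS lC] linear_map_closed[OF lC] linear_map_closed[OF lS] linear_map_ident
        K.coalg.sweedler_linear[OF K.vspace] K.coalg.sweedler_linear_par[OF K.vspace K.vspace]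
      show ?thesis
        unfolding sweedler3_def using x y by - (rule K.coalg.sweedler_closed[OF K.vspace]; (assumption | rule R)+)
    qed
    ultimately show ?thesis
      using rota_baxter_C[OF x y] by (simp add: R[symmetric] x y E.K_simps(3) A_simps(1))
  qed
  ultimately show ?thesis
    by (simp add: rota_baxter_operator_def K.cocommutative_hopf_algebra_axioms)
qed

end

theorem theorem3p4:
  fixes H :: "('k::field_char_0, 'a::ab_group_add) hopf"
    and H' :: "('k, 'b::ab_group_add) hopf"
    and left :: "'a \<Rightarrow> 'b \<Rightarrow> 'b"
    and right :: "'a \<Rightarrow> 'b \<Rightarrow> 'a"
    and B B' :: "('k, 'b, 'a) tensor \<Rightarrow> ('k, 'b, 'a) tensor"
  assumes "cocommutative_hopf_algebra H"
    and "cocommutative_hopf_algebra H'"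
    and "matched_pair H H' left right"
    and "projection_hom_pair H H' left right B B'"
  shows "rota_baxter_operator
           (hopf_image (double_cross_product H H' left right) B)
           (\<lambda>z. B (first_part H H' z))"
proof -
  interpret projection_pair H H' left right B B'
    using assms by (simp add: projection_pair_def projection_pair_axioms_def cocommutative_matched_pair_def)
  show ?thesis by (rule rota_baxter_first_part)
qed

end
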